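(* There is an absolute constant $c > 0$ with the following property. If $n$ and $N$ are positive integers with $N$ prime and $n \leq cN$, then $M_3(n,N) = M_3(n) = \lceil n^2/2\rceil$. Furthermore, the only subsets of $\mathbb{Z}/N\mathbb{Z}$ with cardinality $n$ and $T_3(A) = M_3(n,N)$ are affine images (images under maps $x \mapsto ax+b$ with $a \in (\mathbb{Z}/N\mathbb{Z})^*$, $b \in \mathbb{Z}/N\mathbb{Z}$) of the sets $E(k,m)$, $F(k,m)$ ($k,m \in \mathbb{N}\cup\{0\}$), considered as subsets of $\mathbb{Z}/N\mathbb{Z}$ via reduction mod $N$.
   Context: For a set $A$ in an abelian group $G$, $T_3(A)$ denotes the number of pairs $(x,d) \in G \times G$ with $x, x+d, x+2d \in A$. $M_3(n)$ is the maximum of $T_3(A)$ over sets $A \subseteq \mathbb{Z}$ with $|A| = n$, and $M_3(n,N)$ is the maximum of $T_3(A)$ over sets $A \subseteq \mathbb{Z}/N\mathbb{Z}$ with $|A| = n$. For $k,m \in \mathbb{N}\cup\{0\}$, $E(k,m)$ is the set of integers consisting of all integers in $[-k,k]$ together with $\pm(k+2j)$ for $1 \le j \le m$; and $F(k,m)$ is the set consisting of all integers in $[-k,k]$ together with $k+2j$ for $1 \le j \le m$ and $-(k+2j)$ for $1 \le j \le m-1$. Thus $|E(k,m)| = 2k+2m+1$ and $|F(k,m)| = 2k+2m$. *)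

theory Defs
  imports
    "HOL-Number_Theory.Number_Theory"
    "HOL-Algebra.IntRing"
    Complex_Main
begin

text \<open>
  Abelian groups are the additive groups of ring records, as in the locale \<^locale>\<open>abelian_group\<close>.
  The integers are \<^const>\<open>int_ring\<close>; the integers modulo \<open>N\<close> are \<^term>\<open>residue_ring (int N)\<close>, with
  the representatives \<open>0, \<dots>, N - 1\<close> as carrier.
\<close>

definition T3 :: "('a, 'b) ring_scheme \<Rightarrow> 'a set \<Rightarrow> nat" where
  "T3 G A = card {(x, d). x \<in> carrier G \<and> d \<in> carrier G \<and>
     x \<in> A \<and> x \<oplus>\<^bsub>G\<^esub> d \<in> A \<and> x \<oplus>\<^bsub>G\<^esub> (d \<oplus>\<^bsub>G\<^esub> d) \<in> A}"

text \<open>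
  Since \<open>x\<close> and \<open>x + d\<close> determine \<open>d\<close>, the values of \<open>T3\<close> on sets of size \<open>n\<close> are at most \<open>n\<^sup>2\<close>,
  so \<^const>\<open>Max\<close> is taken over a finite set even in an infinite group; that set is nonempty as soon
  as \<open>G\<close> has a subset of size \<open>n\<close>.
\<close>

definition M3 :: "('a, 'b) ring_scheme \<Rightarrow> nat \<Rightarrow> nat" where
  "M3 G n = Max {T3 G A | A. A \<subseteq> carrier G \<and> finite A \<and> card A = n}"

definition E_set :: "nat \<Rightarrow> nat \<Rightarrow> int set" where
  "E_set k m = {- int k..int k}
     \<union> {int k + 2 * int j | j. 1 \<le> j \<and> j \<le> m}
     \<union> {- (int k + 2 * int j) | j. 1 \<le> j \<and> j \<le> m}"

text \<open>
  The bound \<open>j \<le> m - 1\<close> below is on natural numbers; for \<open>m = 0\<close> the range of \<open>j\<close> is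
  empty either way, and \<open>F_set k 0\<close> is the interval \<open>[-k, k]\<close>.
\<close>

definition F_set :: "nat \<Rightarrow> nat \<Rightarrow> int set" where
  "F_set k m = {- int k..int k}
     \<union> {int k + 2 * int j | j. 1 \<le> j \<and> j \<le> m}
     \<union> {- (int k + 2 * int j) | j. 1 \<le> j \<and> j \<le> m - 1}"

definition reduce_mod :: "nat \<Rightarrow> int set \<Rightarrow> int set" where
  "reduce_mod N S = (\<lambda>s. s mod int N) ` S"

definition affine_image :: "('a, 'b) ring_scheme \<Rightarrow> 'a set \<Rightarrow> 'a set \<Rightarrow> bool" where
  "affine_image R A S \<longleftrightarrow>
     (\<exists>a \<in> Units R. \<exists>b \<in> carrier R. A = (\<lambda>x. a \<otimes>\<^bsub>R\<^esub> x \<oplus>\<^bsub>R\<^esub> b) ` S)"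

end

theory Submission
  imports Defs "HOL-Library.Set_Algebras" "HOL-Library.FuncSet"
begin

text \<open>
  In the integers, the progressions with middle term \<open>y\<close> correspond to the elements whose reflection in
  \<open>y\<close> lies in the set, so there are at most \<open>1 + 2 min (b, a)\<close> of them if \<open>b\<close> elements lie below and \<open>a\<close>
  above \<open>y\<close>. Summing over \<open>y\<close> gives \<open>\<lceil>n\<^sup>2 / 2\<rceil>\<close>, with equality if and only if the shorter side of every
  \<open>y\<close> is reflected into the set; adding the elements in order of their distance from the centre, this
  leaves only the sets \<open>E\<close> and \<open>F\<close>.

  Modulo a prime \<open>p\<close> it therefore suffices to show that a sparse set \<open>A\<close> with at least \<open>n\<^sup>2 / 2\<close> progressions
  is contained in a short arc after a dilation, since it then has the same progressions as a set of
  integers. If a set has many progressions, a Balog--Szemeredi--Gowers argument yields a dense subset with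
  a small difference set, whose popular differences \<open>S\<close> have iterated sumsets of polynomial growth. Hence
  \<open>(j + 1) S\<close> is hardly larger than \<open>j S\<close> for some \<open>j\<close>, which forces a nearly maximal nontrivial Fourier
  coefficient, and a positive proportion of the set lies in a very short arc. By Dirichlet's theorem a
  further dilation merges all translates of the arc that contain many elements; the progressions that
  lie neither inside the arc nor inside its complement then become negligible. Repeating this on the
  complement shows that the number of progressions is essentially at most \<open>\<Sum> b\<^sub>i\<^sup>2 / 2\<close>, where the \<open>b\<^sub>i\<close> are
  the numbers of elements in the arcs, so one arc contains almost all of \<open>A\<close>. Finally a stray element would
  lie in too few progressions, so there is none.
\<close>

text \<open>The order in which the constants are chosen shapes the proof. Merging multiplies radii
  by a bounded but large factor, so the arc found by Fourier analysis must be far shorter than the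
  arc finally split off, and how much shorter depends on the number of splittings. This is not
  circular, because the proportion of the set caught by the first arc, \<open>\<eta> / 16\<close> in
  \<open>concentrated_piece\<close>, does not depend on the radius \<open>\<tau>\<close>; a smaller
  radius is paid for by the density bound alone. A merely large Fourier coefficient would not give
  this: it has to be within a factor \<open>1 - 2 * \<epsilon>\<close> of its maximum for any
  prescribed \<open>\<epsilon>\<close>, which is why consecutive sumsets of ratio at most
  \<open>1 + \<epsilon>\<close> are sought. All of this loses constants, whereas the extremal value
  exceeds half of the square of \<open>n\<close> by at most 1/2. So the end of the proof is exact:
  inside an arc the bound for integers carries over unchanged, rounding included, and stray elements
  are excluded by a comparison that leaves room for the rounding.\<close>

lemma sum_card_eq_card_pairs:
  assumes "finite A" "finite B"
  shows "(\<Sum>a\<in>A. card {b\<in>B. P a b}) = card {(a, b). a \<in> A \<and> b \<in> B \<and> P a b}"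
proof -
  have "{(a, b). a \<in> A \<and> b \<in> B \<and> P a b} = (SIGMA a:A. {b\<in>B. P a b})" by auto
  then show ?thesis using assms by simp
qed

lemma card_le_if_fibres_large:
  fixes f :: "'a \<Rightarrow> 'b" and c :: real
  assumes "finite S" "finite X" "\<And>x. x \<in> X \<Longrightarrow> c \<le> card {s\<in>S. f s = x}"
  shows "c * card X \<le> card S"
proof -
  have "c * card X = (\<Sum>x\<in>X. c)" by simp
  also have "\<dots> \<le> (\<Sum>x\<in>X. real (card {s\<in>S. f s = x}))"
    by (rule sum_mono) (use assms in auto)
  also have "\<dots> = real (\<Sum>x\<in>X. card {s\<in>S. f s = x})" by simp
  also have "(\<Sum>x\<in>X. card {s\<in>S. f s = x}) = card (\<Union>x\<in>X. {s\<in>S. f s = x})"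
    by (rule card_UN_disjoint[symmetric]) (use assms in auto)
  also have "\<dots> \<le> card S" by (rule card_mono) (use assms in auto)
  finally show ?thesis by simp
qed

lemma exists_ge_average:
  fixes f g :: "'a \<Rightarrow> real"
  assumes "finite A" "A \<noteq> {}" "sum g A \<le> sum f A"
  shows "\<exists>a\<in>A. g a \<le> f a"
proof (rule ccontr)
  assume "\<not> ?thesis"
  then have "sum f A < sum g A" using assms by (intro sum_strict_mono) auto
  then show False using assms by simp
qed

section \<open>A Balog--Szemeredi--Gowers lemma\<close>

text \<open>Dependent random choice: for a random vertex \<open>u\<close>, the neighbourhood of \<open>u\<close> is large on average,
  while a pair with few common neighbours is unlikely to lie in it.\<close>

lemma dependent_random_choice:
  fixes A :: "'a set" and G :: "'a \<Rightarrow> 'a \<Rightarrow> bool" and \<eta> :: real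
  assumes A: "finite A" "A \<noteq> {}" and \<eta>: "0 < \<eta>"
    and edges: "\<eta> * (card A)\<^sup>2 \<le> card {(x, z). x \<in> A \<and> z \<in> A \<and> G x z}"
  obtains B where "B \<subseteq> A" "\<eta> * card A / 2 \<le> card B"
    "8 * card {(a, b). a \<in> B \<and> b \<in> B \<and> card {w\<in>A. G a w \<and> G b w} < \<eta>\<^sup>2 / 16 * card A} \<le> (card B)\<^sup>2"
proof -
  define n where "n = real (card A)"
  have n: "n > 0" using A by (simp add: n_def card_gt_0_iff)
  define N where "N = (\<lambda>u. {x\<in>A. G x u})"
  define Bad where "Bad = (\<lambda>a b. card {w\<in>A. G a w \<and> G b w} < \<eta>\<^sup>2 / 16 * card A)"
  define bad where "bad = (\<lambda>u. {(a, b). a \<in> N u \<and> b \<in> N u \<and> Bad a b})"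
  have finN: "finite (N u)" for u using A by (simp add: N_def)
  have sumN: "\<eta> * n\<^sup>2 \<le> (\<Sum>u\<in>A. real (card (N u)))"
  proof -
    have "(\<Sum>u\<in>A. card (N u)) = card {(u, x). u \<in> A \<and> x \<in> A \<and> G x u}"
      unfolding N_def by (rule sum_card_eq_card_pairs) (use A in auto)
    also have "\<dots> = card {(x, z). x \<in> A \<and> z \<in> A \<and> G x z}"
      by (rule bij_betw_same_card[of prod.swap]) (auto simp: bij_betw_def inj_on_def image_def)
    finally show ?thesis using edges by (simp add: n_def flip: of_nat_sum)
  qed
  have sumbad: "(\<Sum>u\<in>A. real (card (bad u))) \<le> \<eta>\<^sup>2 / 16 * n * n\<^sup>2"
  proof -
    let ?P = "{(a, b). a \<in> A \<and> b \<in> A \<and> Bad a b}"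
    have finP: "finite ?P" by (rule finite_subset[of _ "A \<times> A"]) (use A in auto)
    have "(\<Sum>u\<in>A. card (bad u)) = (\<Sum>u\<in>A. card {q\<in>?P. G (fst q) u \<and> G (snd q) u})"
      by (rule sum.cong[OF refl], rule arg_cong[of _ _ card]) (auto simp: bad_def N_def)
    also have "\<dots> = (\<Sum>q\<in>?P. card {u\<in>A. G (fst q) u \<and> G (snd q) u})"
      using A finP by (intro sum_multicount_gen) auto
    finally have "(\<Sum>u\<in>A. real (card (bad u))) = (\<Sum>q\<in>?P. real (card {u\<in>A. G (fst q) u \<and> G (snd q) u}))"
      by (simp flip: of_nat_sum)
    also have "\<dots> \<le> (\<Sum>q\<in>?P. \<eta>\<^sup>2 / 16 * n)"
      by (rule sum_mono) (auto simp: Bad_def n_def)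
    also have "\<dots> = \<eta>\<^sup>2 / 16 * n * card ?P" by simp
    also have "\<dots> \<le> \<eta>\<^sup>2 / 16 * n * n\<^sup>2"
    proof (rule mult_left_mono)
      have "card ?P \<le> card (A \<times> A)" by (rule card_mono) (use A in auto)
      then show "real (card ?P) \<le> n\<^sup>2" by (simp add: n_def power2_eq_square card_cartesian_product flip: of_nat_mult)
    qed (use n in auto)
    finally show ?thesis .
  qed
  \<comment> \<open>One inequality serves both conclusions: dropping the first term on the left
    makes \<open>N u\<close> large, dropping the second makes its bad pairs rare. On average the
    left side is at most \<open>3 / 4 * \<eta>\<^sup>2 * n\<^sup>2\<close>, the right side at least
    \<open>\<eta>\<^sup>2 * n\<^sup>2\<close>.\<close>
  have "\<exists>u\<in>A. 8 * real (card (bad u)) + \<eta>\<^sup>2 / 4 * n\<^sup>2 \<le> (card (N u))\<^sup>2"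
  proof (rule exists_ge_average[OF A])
    have "\<eta>\<^sup>2 * n ^ 3 = 2 * \<eta> * n * (\<eta> * n\<^sup>2) - n * (\<eta> * n)\<^sup>2"
      by (simp add: power2_eq_square power3_eq_cube algebra_simps)
    also have "\<dots> \<le> 2 * \<eta> * n * (\<Sum>u\<in>A. real (card (N u))) - n * (\<eta> * n)\<^sup>2"
      by (intro diff_right_mono mult_left_mono sumN) (use \<eta> n in auto)
    also have "\<dots> = (\<Sum>u\<in>A. 2 * \<eta> * n * real (card (N u)) - (\<eta> * n)\<^sup>2)"
      by (simp add: sum_subtractf sum_distrib_left n_def)
    also have "\<dots> \<le> (\<Sum>u\<in>A. (real (card (N u)))\<^sup>2)"
    proof (rule sum_mono)
      fix u
      show "2 * \<eta> * n * real (card (N u)) - (\<eta> * n)\<^sup>2 \<le> (real (card (N u)))\<^sup>2"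
        using zero_le_power2[of "real (card (N u)) - \<eta> * n"] by (simp add: power2_diff mult_ac)
    qed
    finally have "\<eta>\<^sup>2 * n ^ 3 \<le> (\<Sum>u\<in>A. (real (card (N u)))\<^sup>2)" .
    moreover have "(\<Sum>u\<in>A. 8 * real (card (bad u)) + \<eta>\<^sup>2 / 4 * n\<^sup>2) \<le> 8 * (\<eta>\<^sup>2 / 16 * n * n\<^sup>2) + n * (\<eta>\<^sup>2 / 4 * n\<^sup>2)"
      using sumbad by (simp add: sum.distrib n_def algebra_simps flip: sum_distrib_right sum_distrib_left)
    moreover have "\<dots> \<le> \<eta>\<^sup>2 * n ^ 3"
      using n \<eta> by (simp add: power2_eq_square power3_eq_cube)
    ultimately show "(\<Sum>u\<in>A. 8 * real (card (bad u)) + \<eta>\<^sup>2 / 4 * n\<^sup>2) \<le> (\<Sum>u\<in>A. real ((card (N u))\<^sup>2))"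
      by simp
  qed
  then obtain u where u: "u \<in> A" "8 * real (card (bad u)) + \<eta>\<^sup>2 / 4 * n\<^sup>2 \<le> (card (N u))\<^sup>2" by blast
  show ?thesis
  proof
    show "N u \<subseteq> A" by (auto simp: N_def)
    have "(\<eta> * n / 2)\<^sup>2 \<le> (real (card (N u)))\<^sup>2"
      using u by (simp add: power_mult_distrib power_divide)
    then show "\<eta> * card A / 2 \<le> card (N u)"
      by (metis n_def of_nat_0_le_iff power2_le_imp_le)
    have "8 * real (card (bad u)) \<le> real ((card (N u))\<^sup>2)" using u(2)
      by (smt (verit, best) divide_nonneg_nonneg mult_nonneg_nonneg zero_le_power2)
    then have "8 * card (bad u) \<le> (card (N u))\<^sup>2" by linarith
    then show "8 * card {(a, b). a \<in> N u \<and> b \<in> N u \<and> card {w\<in>A. G a w \<and> G b w} < \<eta>\<^sup>2 / 16 * card A} \<le> (card (N u))\<^sup>2"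
      by (simp add: bad_def Bad_def)
  qed
qed

definition diffset :: "'a::ab_group_add set \<Rightarrow> 'a set" where
  "diffset X = {x - y | x y. x \<in> X \<and> y \<in> X}"

lemma diffset_eq_image: "diffset X = (\<lambda>(x, y). x - y) ` (X \<times> X)"
  by (auto simp: diffset_def)

lemma finite_diffset: "finite X \<Longrightarrow> finite (diffset X)"
  by (simp add: diffset_eq_image)

text \<open>A pair of \<open>B\<close> that is not bad has at least \<open>c * n\<close> common
  neighbours \<open>w\<close>, and each writes \<open>a - b\<close> as
  \<open>(a + w) - (b + w)\<close>, a difference of elements of \<open>D\<close>. As
  \<open>D \<times> D\<close> has at most \<open>n\<^sup>2\<close> pairs, the set \<open>P\<close>
  of differences with so many representations has at most \<open>n / c\<close> elements. Two
  elements of \<open>X\<close> share at least half of \<open>B\<close> as good partners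
  \<open>u\<close>, so \<open>a - b = (a - u) - (b - u)\<close> is represented at least
  \<open>m / 2\<close> times by \<open>P \<times> P\<close>.\<close>

lemma balog_szemeredi_gowers:
  fixes A D :: "'a::ab_group_add set" and \<eta> :: real
  assumes A: "finite A" "A \<noteq> {}" and D: "finite D" "card D \<le> card A" and \<eta>: "0 < \<eta>"
    and edges: "\<eta> * (card A)\<^sup>2 \<le> card {(x, z). x \<in> A \<and> z \<in> A \<and> x + z \<in> D}"
  obtains X where "X \<subseteq> A" "\<eta> / 4 * card A \<le> card X" "card (diffset X) \<le> 1024 / \<eta> ^ 5 * card A"
proof -
  define n where "n = real (card A)"
  have n: "n > 0" using A by (simp add: n_def card_gt_0_iff)
  define c where "c = \<eta>\<^sup>2 / 16"
  have c: "c > 0" using \<eta> by (simp add: c_def)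
  define Bad where "Bad = (\<lambda>a b. card {w\<in>A. a + w \<in> D \<and> b + w \<in> D} < c * n)"
  obtain B where B: "B \<subseteq> A" "\<eta> * n / 2 \<le> card B"
    "8 * card {(a, b). a \<in> B \<and> b \<in> B \<and> Bad a b} \<le> (card B)\<^sup>2"
    by (rule dependent_random_choice[OF A \<eta> edges]) (auto simp: Bad_def c_def n_def)
  define m where "m = real (card B)"
  have finB: "finite B" using A B(1) finite_subset by blast
  have m: "m > 0" "m \<ge> \<eta> * n / 2" proof -
    show "m \<ge> \<eta> * n / 2" using B(2) by (simp add: m_def)
    moreover have "\<eta> * n / 2 > 0" using \<eta> n by simp
    ultimately show "m > 0" by linarith
  qed
  define X where "X = {a\<in>B. 4 * card {b\<in>B. Bad a b} \<le> card B}"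
  have finX: "finite X" using finB by (simp add: X_def)
  have cardX: "card X \<ge> m / 2"
  proof -
    have "m / 4 * card (B - X) = (\<Sum>a\<in>B-X. m / 4)" by simp
    also have "\<dots> \<le> (\<Sum>a\<in>B-X. real (card {b\<in>B. Bad a b}))"
      by (rule sum_mono) (auto simp: X_def m_def)
    also have "\<dots> \<le> (\<Sum>a\<in>B. real (card {b\<in>B. Bad a b}))"
      by (rule sum_mono2) (use finB in auto)
    also have "\<dots> = card {(a, b). a \<in> B \<and> b \<in> B \<and> Bad a b}"
      using sum_card_eq_card_pairs[OF finB finB, of Bad] by (simp flip: of_nat_sum)
    also have "8 * \<dots> \<le> m\<^sup>2" using B(3) by (simp add: m_def flip: of_nat_power of_nat_mult)
    finally have "m * card (B - X) \<le> m * (m / 2)" by (simp add: power2_eq_square)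
    then have "card (B - X) \<le> m / 2" using m by simp
    moreover have "card (B - X) = m - card X"
      using finB by (subst card_Diff_subset) (auto simp: X_def m_def finX card_mono)
    ultimately show ?thesis by simp
  qed
  define P where "P = {x \<in> diffset D. c * n \<le> card {q \<in> D \<times> D. fst q - snd q = x}}"
  have finP: "finite P" using D by (simp add: P_def finite_diffset)
  have "c * n * card P \<le> card (D \<times> D)"
    by (rule card_le_if_fibres_large[where f = "\<lambda>q. fst q - snd q"]) (use D finP in \<open>auto simp: P_def\<close>)
  also have "\<dots> \<le> n\<^sup>2" using D(2) by (simp add: n_def power2_eq_square card_cartesian_product mult_mono flip: of_nat_mult)
  finally have "n * (c * card P) \<le> n * n" by (simp add: power2_eq_square mult_ac)
  then have cP: "c * card P \<le> n" using n by simp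
  have goodP: "a - b \<in> P" if ab: "\<not> Bad a b" for a b
  proof -
    let ?W = "{w\<in>A. a + w \<in> D \<and> b + w \<in> D}"
    have W: "c * n \<le> card ?W" using ab by (simp add: Bad_def)
    then have "card ?W > 0" using c n by (smt (verit) mult_pos_pos of_nat_0_less_iff)
    then obtain w where w: "w \<in> ?W" by (auto simp: card_gt_0_iff)
    have "a - b = (a + w) - (b + w)" by simp
    then have "a - b \<in> diffset D" using w unfolding diffset_def by blast
    moreover have "card ?W \<le> card {q \<in> D \<times> D. fst q - snd q = a - b}"
      by (rule card_inj_on_le[of "\<lambda>w. (a + w, b + w)"]) (use D in \<open>auto simp: inj_on_def\<close>)
    ultimately show ?thesis using W by (simp add: P_def)
  qed
  have "m / 2 * card (diffset X) \<le> card (P \<times> P)"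
  proof (rule card_le_if_fibres_large[where f = "\<lambda>q. fst q - snd q"])
    fix x assume "x \<in> diffset X"
    then obtain a b where ab: "a \<in> X" "b \<in> X" "x = a - b" by (auto simp: diffset_def)
    let ?U = "{u\<in>B. \<not> Bad a u \<and> \<not> Bad b u}"
    have "card ?U \<le> card {q \<in> P \<times> P. fst q - snd q = x}"
      by (rule card_inj_on_le[of "\<lambda>u. (a - u, b - u)"]) (use finP goodP ab in \<open>auto simp: inj_on_def\<close>)
    moreover have "card B \<le> card ?U + card {u\<in>B. Bad a u} + card {u\<in>B. Bad b u}"
    proof -
      have "B = ?U \<union> {u\<in>B. Bad a u} \<union> {u\<in>B. Bad b u}" by auto
      then show ?thesis
        by (metis (no_types, lifting) card_Un_le add_le_mono1 le_trans)
    qed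
    moreover have "4 * card {u\<in>B. Bad a u} \<le> card B" "4 * card {u\<in>B. Bad b u} \<le> card B"
      using ab by (auto simp: X_def)
    ultimately show "m / 2 \<le> card {q \<in> P \<times> P. fst q - snd q = x}" by (simp add: m_def)
  qed (use finP finX in \<open>auto simp: finite_diffset\<close>)
  then have 1: "m / 2 * card (diffset X) \<le> (real (card P))\<^sup>2" by (simp add: power2_eq_square card_cartesian_product)
  have "\<eta> * n / 4 * card (diffset X) \<le> m / 2 * card (diffset X)"
    by (rule mult_right_mono) (use m in auto)
  also note 1
  finally have "c\<^sup>2 * (\<eta> * n / 4 * card (diffset X)) \<le> c\<^sup>2 * (real (card P))\<^sup>2"
    by (rule mult_left_mono) auto
  also have "\<dots> = (c * card P)\<^sup>2" by (simp add: power_mult_distrib)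
  also have "\<dots> \<le> n\<^sup>2" by (rule power_mono[OF cP]) (use c in auto)
  finally have "n * (\<eta> ^ 5 * card (diffset X)) \<le> n * (1024 * n)"
    by (simp add: c_def power2_eq_square field_simps eval_nat_numeral)
  then have "\<eta> ^ 5 * card (diffset X) \<le> 1024 * n" using n by simp
  then have "card (diffset X) \<le> 1024 / \<eta> ^ 5 * card A" using \<eta> by (simp add: field_simps n_def)
  moreover have "\<eta> / 4 * card A \<le> card X" using cardX m by (simp add: n_def)
  moreover have "X \<subseteq> A" using B by (auto simp: X_def)
  ultimately show ?thesis using that by blast
qed

section \<open>Iterated sumsets and popular differences\<close>

lemma finite_set_plus_sets: "finite A \<Longrightarrow> finite B \<Longrightarrow> finite (A + B)"
  by (simp add: set_plus_image)

lemma card_set_plus_le: "finite A \<Longrightarrow> finite B \<Longrightarrow> card (A + B) \<le> card A * card B"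
  by (metis card_cartesian_product card_image_le finite_cartesian_product set_plus_image)

primrec iter_sum :: "nat \<Rightarrow> 'a::comm_monoid_add set \<Rightarrow> 'a set" where
  "iter_sum 0 S = {0}"
| "iter_sum (Suc k) S = S + iter_sum k S"

lemma finite_iter_sum: "finite S \<Longrightarrow> finite (iter_sum k S)"
  by (induction k) (auto simp: finite_set_plus_sets)

lemma iter_sum_mono_Suc:
  assumes "0 \<in> S" shows "iter_sum k S \<subseteq> iter_sum (Suc k) S"
proof
  fix x assume "x \<in> iter_sum k S"
  then have "0 + x \<in> S + iter_sum k S" using assms by (intro set_plus_intro)
  then show "x \<in> iter_sum (Suc k) S" by simp
qed

lemma iter_sum_mono: "0 \<in> S \<Longrightarrow> i \<le> j \<Longrightarrow> iter_sum i S \<subseteq> iter_sum j S"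
  using lift_Suc_mono_le[of "\<lambda>k. iter_sum k S"] iter_sum_mono_Suc by blast

lemma iter_sum_Suc_0: "iter_sum (Suc 0) S = S"
  by (auto simp: set_plus_def)

text \<open>\<open>S\<close> consists of the differences with at least \<open>n / (2 * K)\<close>
  representations. Unpopular differences account for at most half of all pairs, so some translate of
  \<open>S\<close> contains half of \<open>X\<close>. Popularity controls the sumset: a sum of four
  elements of \<open>S\<close> has at least \<open>(n / (2 * K)) ^ 3\<close> representations as a
  sum of four elements of \<open>D\<close>, which replaces an appeal to the Pluennecke
  inequality.\<close>

lemma popular_differences:
  fixes X :: "'a::ab_group_add set" and K :: real
  assumes X: "finite X" "X \<noteq> {}" and K: "card (diffset X) \<le> K * card X"
  obtains S a where "finite S" "0 \<in> S" "\<forall>s\<in>S. - s \<in> S" "S \<subseteq> diffset X"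
    "a \<in> X" "card X / 2 \<le> card {x\<in>X. x - a \<in> S}" "card (iter_sum 4 S) \<le> 8 * K ^ 7 * card X"
proof -
  define D where "D = diffset X"
  define n where "n = real (card X)"
  have n: "n > 0" using X by (simp add: n_def card_gt_0_iff)
  have finD: "finite D" using X by (simp add: D_def finite_diffset)
  have memD: "u - v \<in> D" if "u \<in> X" "v \<in> X" for u v using that by (auto simp: D_def diffset_def)
  obtain x0 where x0: "x0 \<in> X" using X by blast
  have "card X \<le> card D"
    by (rule card_inj_on_le[of "\<lambda>x. x - x0"]) (use x0 finD in \<open>auto simp: inj_on_def D_def diffset_def\<close>)
  then have "n * 1 \<le> n * K" using K by (simp add: n_def D_def mult.commute)
  then have K1: "K \<ge> 1" using n by (simp only: mult_le_cancel_left_pos)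
  define R where "R = (\<lambda>d. {q\<in>X\<times>X. fst q - snd q = d})"
  have finR: "finite (R d)" for d using X by (simp add: R_def)
  define S where "S = {d\<in>D. n / (2 * K) \<le> card (R d)}"
  have finS: "finite S" using finD by (simp add: S_def)
  have "card X \<le> card (R 0)"
    by (rule card_inj_on_le[of "\<lambda>x. (x, x)"]) (use X in \<open>auto simp: inj_on_def R_def\<close>)
  moreover have "n / (2 * K) \<le> n" using K1 n by (simp add: field_simps)
  moreover have "0 \<in> D" using x0 by (auto simp: D_def diffset_def intro!: exI[of _ x0])
  ultimately have S0: "0 \<in> S" by (simp add: S_def n_def)
  have Ssym: "- s \<in> S" if "s \<in> S" for s
  proof -
    have "x - y = - s \<longleftrightarrow> y - x = s" for x y by (metis minus_diff_eq minus_minus)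
    then have "R (- s) = prod.swap ` R s" by (auto simp: R_def image_iff)
    then have "card (R (- s)) = card (R s)" by (simp add: card_image)
    moreover have "- s \<in> D" using that by (force simp: S_def D_def diffset_def)
    ultimately show ?thesis using that by (simp add: S_def)
  qed
  have "\<exists>a\<in>X. n / 2 \<le> real (card {x\<in>X. x - a \<in> S})"
  proof (rule exists_ge_average[OF X])
    let ?Q = "{(a, x). a \<in> X \<and> x \<in> X \<and> x - a \<in> S}"
    let ?Q' = "{(x, a). a \<in> X \<and> x \<in> X \<and> x - a \<notin> S}"
    have 1: "(\<Sum>a\<in>X. card {x\<in>X. x - a \<in> S}) = card ?Q"
      by (rule sum_card_eq_card_pairs) (use X in auto)
    have Q': "?Q' = (\<Union>d\<in>D-S. R d)"
      by (auto simp: R_def D_def diffset_def) blast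
    have "real (card ?Q') = (\<Sum>d\<in>D-S. real (card (R d)))"
      unfolding Q' by (subst card_UN_disjoint) (use finD finR in \<open>auto simp: R_def\<close>)
    also have "\<dots> \<le> (\<Sum>d\<in>D-S. n / (2 * K))" by (rule sum_mono) (auto simp: S_def)
    also have "\<dots> \<le> (\<Sum>d\<in>D. n / (2 * K))" by (rule sum_mono2) (use finD n K1 in auto)
    also have "\<dots> = card D * (n / (2 * K))" by simp
    also have "\<dots> \<le> (K * n) * (n / (2 * K))" by (rule mult_right_mono) (use K n K1 in \<open>auto simp: D_def n_def\<close>)
    also have "\<dots> = n\<^sup>2 / 2" using K1 by (simp add: power2_eq_square)
    finally have 2: "real (card ?Q') \<le> n\<^sup>2 / 2" .
    have XX: "X \<times> X = ?Q \<union> prod.swap ` ?Q'" by (auto simp: image_iff)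
    have "card (X \<times> X) \<le> card ?Q + card (prod.swap ` ?Q')" unfolding XX by (rule card_Un_le)
    also have "card (prod.swap ` ?Q') = card ?Q'" by (rule card_image) auto
    finally have "n\<^sup>2 \<le> card ?Q + card ?Q'" by (simp add: card_cartesian_product n_def power2_eq_square flip: of_nat_mult of_nat_add)
    with 2 have "n\<^sup>2 / 2 \<le> card ?Q" by simp
    then show "(\<Sum>a\<in>X. n / 2) \<le> (\<Sum>a\<in>X. real (card {x\<in>X. x - a \<in> S}))"
      using 1 by (simp add: n_def power2_eq_square flip: of_nat_sum)
  qed
  then obtain a where a: "a \<in> X" "n / 2 \<le> real (card {x\<in>X. x - a \<in> S})" by blast
  have "(n / (2 * K)) ^ 3 * card (iter_sum 4 S) \<le> card (D \<times> D \<times> D \<times> D)"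
  proof (rule card_le_if_fibres_large[where f = "\<lambda>(p, q, r, s). p + q + r + s"])
    fix x assume "x \<in> iter_sum 4 S"
    then have "x \<in> S + (S + (S + (S + {0})))" by (simp add: eval_nat_numeral)
    then obtain s0 s1 s2 s3 where s: "s0 \<in> S" "s1 \<in> S" "s2 \<in> S" "s3 \<in> S" "x = s0 + (s1 + (s2 + s3))"
      unfolding set_plus_def by auto
    obtain b c where bc: "b \<in> X" "c \<in> X" "s0 = b - c" using s(1) by (auto simp: S_def D_def diffset_def)
    \<comment> \<open>Telescoping: each choice of representations of \<open>s1\<close>, \<open>s2\<close>, \<open>s3\<close> as differences regroups
      \<open>x\<close> as a sum of four elements of \<open>D\<close>.\<close>
    have "card (R s1 \<times> R s2 \<times> R s3) \<le> card {t \<in> D \<times> D \<times> D \<times> D. (\<lambda>(p, q, r, s). p + q + r + s) t = x}"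
    proof (rule card_inj_on_le[of "\<lambda>((b1,c1),(b2,c2),(b3,c3)). (b - c1, b1 - c2, b2 - c3, b3 - c)"])
      \<comment> \<open>The representation of the first summand stays fixed. Hence the first entry
        determines \<open>c1\<close>, then \<open>s1\<close> determines \<open>b1\<close>, the
        second entry \<open>c2\<close>, and so on.\<close>
      show "inj_on (\<lambda>((b1,c1),(b2,c2),(b3,c3)). (b - c1, b1 - c2, b2 - c3, b3 - c)) (R s1 \<times> R s2 \<times> R s3)"
        by (clarsimp simp: inj_on_def R_def diff_eq_eq)
      show "(\<lambda>((b1,c1),(b2,c2),(b3,c3)). (b - c1, b1 - c2, b2 - c3, b3 - c)) ` (R s1 \<times> R s2 \<times> R s3)
        \<subseteq> {t \<in> D \<times> D \<times> D \<times> D. (\<lambda>(p, q, r, s). p + q + r + s) t = x}"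
      proof clarify
        fix b1 c1 b2 c2 b3 c3 assume r: "(b1, c1) \<in> R s1" "(b2, c2) \<in> R s2" "(b3, c3) \<in> R s3"
        then have "x = (b - c) + ((b1 - c1) + ((b2 - c2) + (b3 - c3)))" using s(5) bc(3) by (simp add: R_def)
        also have "\<dots> = (b - c1) + (b1 - c2) + (b2 - c3) + (b3 - c)" by (simp add: algebra_simps)
        finally show "(b - c1, b1 - c2, b2 - c3, b3 - c) \<in> D \<times> D \<times> D \<times> D \<and>
          (b - c1) + (b1 - c2) + (b2 - c3) + (b3 - c) = x"
          using r bc by (auto simp: R_def intro: memD)
      qed
    qed (use finD in simp)
    moreover have "(n / (2 * K)) ^ 3 \<le> card (R s1 \<times> R s2 \<times> R s3)"
    proof -
      have "n / (2 * K) * (n / (2 * K) * (n / (2 * K))) \<le> card (R s1) * (card (R s2) * card (R s3))"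
        using s n K1 unfolding of_nat_mult by (intro mult_mono) (auto simp: S_def)
      then show ?thesis by (simp add: power3_eq_cube card_cartesian_product mult.assoc)
    qed
    ultimately show "(n / (2 * K)) ^ 3 \<le> card {t \<in> D \<times> D \<times> D \<times> D. (\<lambda>(p, q, r, s). p + q + r + s) t = x}"
      by linarith
  qed (use finD finS in \<open>auto simp: finite_iter_sum\<close>)
  also have "\<dots> = (real (card D)) ^ 4" by (simp add: card_cartesian_product eval_nat_numeral)
  also have "\<dots> \<le> (K * n) ^ 4" by (rule power_mono) (use K in \<open>auto simp: D_def n_def\<close>)
  finally have fin: "(n / (2 * K)) ^ 3 * card (iter_sum 4 S) \<le> (K * n) ^ 4" .
  have "n ^ 3 * card (iter_sum 4 S) = (2 * K) ^ 3 * ((n / (2 * K)) ^ 3 * card (iter_sum 4 S))"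
    using K1 by (simp add: power_divide)
  also have "\<dots> \<le> (2 * K) ^ 3 * (K * n) ^ 4" by (rule mult_left_mono[OF fin]) (use K1 in simp)
  also have "\<dots> = n ^ 3 * (8 * K ^ 7 * n)" by (simp add: power_mult_distrib eval_nat_numeral mult_ac)
  finally have "n ^ 3 * card (iter_sum 4 S) \<le> n ^ 3 * (8 * K ^ 7 * n)" .
  then have "card (iter_sum 4 S) \<le> 8 * K ^ 7 * card X" using n by (simp add: n_def)
  with that[OF finS S0 _ _ a(1)] Ssym a(2) show ?thesis by (auto simp: n_def S_def D_def)
qed

section \<open>Polynomial growth of iterated sumsets\<close>

lemma maximal_separated_subset:
  assumes "finite T" "\<And>x. x \<in> T \<Longrightarrow> R x x" "\<And>x y. R x y \<Longrightarrow> R y x"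
  obtains Y where "Y \<subseteq> T" "\<And>x y. x \<in> Y \<Longrightarrow> y \<in> Y \<Longrightarrow> R x y \<Longrightarrow> x = y" "\<And>t. t \<in> T \<Longrightarrow> \<exists>y\<in>Y. R t y"
proof -
  have "\<exists>Y\<subseteq>T. (\<forall>x\<in>Y. \<forall>y\<in>Y. R x y \<longrightarrow> x = y) \<and> (\<forall>t\<in>T. \<exists>y\<in>Y. R t y)"
    using assms(1,2)
  proof (induction T rule: finite_induct)
    case (insert t T)
    then obtain Y where Y: "Y \<subseteq> T" "\<forall>x\<in>Y. \<forall>y\<in>Y. R x y \<longrightarrow> x = y" "\<forall>t\<in>T. \<exists>y\<in>Y. R t y" by auto
    show ?case
    proof (cases "\<exists>y\<in>Y. R t y")
      case True
      then show ?thesis using Y by (intro exI[of _ Y]) auto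
    next
      case False
      have "insert t Y \<subseteq> insert t T" using Y(1) by auto
      moreover have "\<forall>x\<in>insert t Y. \<forall>y\<in>insert t Y. R x y \<longrightarrow> x = y" using Y(2) False assms(3) by auto
      moreover have "\<forall>s\<in>insert t T. \<exists>y\<in>insert t Y. R s y" using Y(3) insert.prems by auto
      ultimately show ?thesis by blast
    qed
  qed auto
  then show ?thesis using that by blast
qed

text \<open>Ruzsa's covering argument: choose a maximal \<open>Y\<close> for which the translates
  \<open>y + S\<close> are disjoint. They all lie in the fourfold sumset, which bounds
  \<open>Y\<close>; any \<open>t + S\<close> meets one of them, so \<open>t\<close> lies in
  \<open>y + S - S\<close>, and the symmetry of \<open>S\<close> turns the difference into a
  sum.\<close>

lemma iter_sum_3_covering:
  fixes S :: "'a::ab_group_add set" and L :: real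
  assumes S: "finite S" "0 \<in> S" "\<And>s. s \<in> S \<Longrightarrow> - s \<in> S" and L: "card (iter_sum 4 S) \<le> L * card S"
  obtains Y where "finite Y" "card Y \<le> L" "iter_sum 3 S \<subseteq> Y + iter_sum 2 S"
proof -
  define R where "R = (\<lambda>x y. \<exists>s\<in>S. \<exists>s'\<in>S. x + s = y + s')"
  have fin3: "finite (iter_sum 3 S)" using S by (simp add: finite_iter_sum)
  obtain Y where Y: "Y \<subseteq> iter_sum 3 S" "\<And>x y. x \<in> Y \<Longrightarrow> y \<in> Y \<Longrightarrow> R x y \<Longrightarrow> x = y"
    "\<And>t. t \<in> iter_sum 3 S \<Longrightarrow> \<exists>y\<in>Y. R t y"
  proof (rule maximal_separated_subset[of "iter_sum 3 S" R])
    show "R x x" for x using S(2) by (auto simp: R_def)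
    show "R y x" if "R x y" for x y using that unfolding R_def by metis
  qed (use fin3 in auto)
  have finY: "finite Y" using Y(1) fin3 finite_subset by blast
  have "card (Y \<times> S) \<le> card (iter_sum 4 S)"
  proof (rule card_inj_on_le[of "\<lambda>(y, s). y + s"])
    show "inj_on (\<lambda>(y, s). y + s) (Y \<times> S)" using Y(2) unfolding inj_on_def R_def by clarsimp (metis add_left_cancel)
    show "(\<lambda>(y, s). y + s) ` (Y \<times> S) \<subseteq> iter_sum 4 S"
    proof clarify
      fix y s assume "y \<in> Y" "s \<in> S"
      then have "s + y \<in> S + iter_sum 3 S" using Y(1) by (intro set_plus_intro) auto
      then show "y + s \<in> iter_sum 4 S" by (simp add: eval_nat_numeral add.commute)
    qed
  qed (use S in \<open>simp add: finite_iter_sum\<close>)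
  then have "real (card Y) * card S \<le> L * card S" using L by (simp add: card_cartesian_product flip: of_nat_mult)
  then have "card Y \<le> L" using S by (metis card_gt_0_iff empty_iff mult_le_cancel_right_pos of_nat_0_less_iff)
  moreover have "iter_sum 3 S \<subseteq> Y + iter_sum 2 S"
  proof
    fix t assume "t \<in> iter_sum 3 S"
    then obtain y s s' where y: "y \<in> Y" "s \<in> S" "s' \<in> S" "t + s = y + s'" using Y(3) unfolding R_def by blast
    then have "t = y + (s' + (- s + 0))" by (simp add: algebra_simps)
    also have "\<dots> \<in> Y + (S + (S + {0}))" using y S(3) by (intro set_plus_intro) auto
    finally show "t \<in> Y + iter_sum 2 S" by (simp add: eval_nat_numeral)
  qed
  ultimately show ?thesis using that finY by blast
qed

text \<open>By commutativity a sum of \<open>k\<close> elements of \<open>Y\<close> depends only on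
  the multiplicities of the elements, each at most \<open>k\<close>. This is the source of
  polynomial growth.\<close>

lemma card_iter_sum_le:
  fixes Y :: "'a::ab_group_add set"
  assumes Y: "finite Y"
  shows "card (iter_sum k Y) \<le> (k + 1) ^ card Y"
proof -
  define mul where "mul = (\<lambda>(n::nat) (y::'a). ((+) y ^^ n) 0)"
  have mul_Suc: "mul (Suc n) y = y + mul n y" for n y by (simp add: mul_def)
  have "iter_sum k Y \<subseteq> (\<lambda>c. \<Sum>y\<in>Y. mul (c y) y) ` (Y \<rightarrow>\<^sub>E {..k})"
  proof (induction k)
    case 0
    have "(\<lambda>c. \<Sum>y\<in>Y. mul (c y) y) (restrict (\<lambda>_. 0) Y) = 0" by (simp add: mul_def)
    then show ?case by (force intro: image_eqI[of _ _ "restrict (\<lambda>_. 0) Y"])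
  next
    case (Suc k)
    show ?case
    proof
      fix x assume "x \<in> iter_sum (Suc k) Y"
      then obtain y0 w where xw: "y0 \<in> Y" "w \<in> iter_sum k Y" "x = y0 + w" by (auto simp: set_plus_def)
      then obtain c where c: "c \<in> Y \<rightarrow>\<^sub>E {..k}" "w = (\<Sum>y\<in>Y. mul (c y) y)" using Suc by auto
      let ?c = "c(y0 := Suc (c y0))"
      have "(\<Sum>y\<in>Y. mul (?c y) y) = mul (?c y0) y0 + (\<Sum>y\<in>Y-{y0}. mul (?c y) y)"
        using xw Y by (intro sum.remove) auto
      also have "(\<Sum>y\<in>Y-{y0}. mul (?c y) y) = (\<Sum>y\<in>Y-{y0}. mul (c y) y)" by (rule sum.cong) auto
      also have "mul (?c y0) y0 + \<dots> = y0 + (\<Sum>y\<in>Y. mul (c y) y)"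
        using xw Y by (subst sum.remove[of Y y0]) (auto simp: mul_Suc add.assoc)
      finally have "x = (\<Sum>y\<in>Y. mul (?c y) y)" using c xw by simp
      moreover have "?c \<in> Y \<rightarrow>\<^sub>E {..Suc k}" using c xw by (fastforce simp: PiE_def Pi_def extensional_def le_Suc_eq)
      ultimately show "x \<in> (\<lambda>c. \<Sum>y\<in>Y. mul (c y) y) ` (Y \<rightarrow>\<^sub>E {..Suc k})" by blast
    qed
  qed
  moreover have "finite (Y \<rightarrow>\<^sub>E {..k})" using Y by (simp add: finite_PiE)
  ultimately have "card (iter_sum k Y) \<le> card (Y \<rightarrow>\<^sub>E {..k})"
    using surj_card_le by blast
  then show ?thesis using Y by (simp add: card_PiE)
qed

text \<open>By the covering of \<open>iter_sum 3 S\<close>, every further copy of \<open>S\<close>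
  costs one further copy of \<open>Y\<close>, so the growth is that of the sumsets of
  \<open>Y\<close>, of degree \<open>card Y \<le> L\<close>.\<close>

lemma iter_sum_growth:
  fixes S :: "'a::ab_group_add set" and L :: real
  assumes S: "finite S" "0 \<in> S" "\<And>s. s \<in> S \<Longrightarrow> - s \<in> S" and L: "card (iter_sum 4 S) \<le> L * card S"
  shows "card (iter_sum (k + 2) S) \<le> (real k + 1) ^ nat \<lfloor>L\<rfloor> * (L * card S)"
proof -
  obtain Y where Y: "finite Y" "card Y \<le> L" "iter_sum 3 S \<subseteq> Y + iter_sum 2 S"
    using iter_sum_3_covering[OF S L] by blast
  have "iter_sum (k + 2) S \<subseteq> iter_sum k Y + iter_sum 2 S"
  proof (induction k)
    case (Suc k)
    have "iter_sum (Suc k + 2) S = S + iter_sum (k + 2) S" by simp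
    also have "\<dots> \<subseteq> S + (iter_sum k Y + iter_sum 2 S)" by (rule set_plus_mono2[OF _ Suc]) auto
    also have "\<dots> = iter_sum k Y + (S + iter_sum 2 S)" by (simp only: add.left_commute)
    also have "S + iter_sum 2 S = iter_sum 3 S" by (simp add: eval_nat_numeral)
    also have "iter_sum k Y + iter_sum 3 S \<subseteq> iter_sum k Y + (Y + iter_sum 2 S)"
      by (rule set_plus_mono2[OF _ Y(3)]) auto
    also have "\<dots> = iter_sum (Suc k) Y + iter_sum 2 S" by (simp only: iter_sum.simps ac_simps)
    finally show ?case .
  qed (simp add: set_plus_def eval_nat_numeral)
  then have "card (iter_sum (k + 2) S) \<le> card (iter_sum k Y + iter_sum 2 S)"
    by (intro card_mono finite_set_plus_sets finite_iter_sum S Y)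
  also have "\<dots> \<le> card (iter_sum k Y) * card (iter_sum 2 S)"
    by (intro card_set_plus_le finite_iter_sum S Y)
  finally have 1: "real (card (iter_sum (k + 2) S)) \<le> real (card (iter_sum k Y)) * real (card (iter_sum 2 S))"
    by (simp flip: of_nat_mult)
  have "card (iter_sum 2 S) \<le> card (iter_sum 4 S)"
    by (intro card_mono finite_iter_sum iter_sum_mono S) simp
  then have 2: "card (iter_sum 2 S) \<le> L * card S" using L by simp
  have "real (card (iter_sum k Y)) \<le> real ((k + 1) ^ card Y)"
    using card_iter_sum_le[OF Y(1)] of_nat_le_iff by blast
  also have "\<dots> \<le> (real k + 1) ^ nat \<lfloor>L\<rfloor>"
    using Y(2) by (simp add: add.commute) (intro power_increasing, linarith, simp)
  finally show ?thesis using 1 2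
    by (smt (verit) mult_mono of_nat_0_le_iff)
qed

lemma exp_beats_power:
  fixes \<epsilon> L :: real
  assumes "\<epsilon> > 0" "L > 0"
  shows "\<exists>J::nat. L * (real J + 1) ^ M < (1 + \<epsilon>) ^ J"
proof -
  define l where "l = ln (1 + \<epsilon>)"
  have l: "l > 0" using assms by (simp add: l_def)
  have "((\<lambda>x. x ^ M / exp x) \<longlongrightarrow> (0::real)) at_top" by (rule tendsto_power_div_exp_0)
  moreover have "filterlim (\<lambda>J::nat. (real J + 1) * l) at_top sequentially"
    unfolding add.commute[of "real _" 1]
    using l by (intro filterlim_at_top_mult_tendsto_pos[OF tendsto_const] filterlim_tendsto_add_at_top[OF tendsto_const] filterlim_real_sequentially) auto
  ultimately have "(\<lambda>J::nat. ((real J + 1) * l) ^ M / exp ((real J + 1) * l)) \<longlonglongrightarrow> 0"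
    by (rule filterlim_compose)
  then have "\<forall>\<^sub>F J in sequentially. ((real J + 1) * l) ^ M / exp ((real J + 1) * l) < l ^ M / (L * (1 + \<epsilon>))"
    by (rule order_tendstoD) (use l assms in auto)
  then obtain J where J: "((real J + 1) * l) ^ M / exp ((real J + 1) * l) < l ^ M / (L * (1 + \<epsilon>))"
    by (meson eventually_happens' sequentially_bot)
  have "exp ((real J + 1) * l) = (1 + \<epsilon>) ^ J * (1 + \<epsilon>)"
    using assms by (simp add: distrib_right exp_add exp_of_nat_mult l_def)
  with J have "((real J + 1) * l) ^ M < l ^ M / (L * (1 + \<epsilon>)) * ((1 + \<epsilon>) ^ J * (1 + \<epsilon>))"
    using assms by (simp only: pos_divide_less_eq[OF mult_pos_pos[OF zero_less_power]])
  also have "\<dots> = l ^ M * ((1 + \<epsilon>) ^ J / L)" using assms by simp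
  finally have "l ^ M * (real J + 1) ^ M < l ^ M * ((1 + \<epsilon>) ^ J / L)" by (simp add: power_mult_distrib mult.commute)
  then have "(real J + 1) ^ M < (1 + \<epsilon>) ^ J / L" using l by (simp only: mult_less_cancel_left_pos zero_less_power)
  then show ?thesis using assms by (auto simp: field_simps)
qed

text \<open>Ratios above \<open>1 + \<epsilon>\<close> throughout would make
  \<open>iter_sum (J + 2) S\<close> exponentially large in \<open>J\<close>, against its polynomial
  bound. \<open>C\<close> is obtained before \<open>S\<close>: it depends only on
  \<open>\<epsilon>\<close> and \<open>L\<close>, so the density bound derived from it is
  absolute.\<close>

lemma iter_sum_almost_stable:
  fixes \<epsilon> L :: real
  assumes "\<epsilon> > 0" "L > 0"
  obtains C :: real where "\<And>S :: 'a::ab_group_add set. finite S \<Longrightarrow> 0 \<in> S \<Longrightarrow> (\<And>s. s \<in> S \<Longrightarrow> - s \<in> S) \<Longrightarrow>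
     card (iter_sum 4 S) \<le> L * card S \<Longrightarrow>
     \<exists>j. card (iter_sum (Suc j) S) \<le> (1 + \<epsilon>) * card (iter_sum j S) \<and> card (iter_sum (Suc j) S) \<le> C * card S"
proof -
  obtain J :: nat where J: "L * (real J + 1) ^ nat \<lfloor>L\<rfloor> < (1 + \<epsilon>) ^ J" using exp_beats_power assms by blast
  define C where "C = L * (real J + 1) ^ nat \<lfloor>L\<rfloor>"
  show ?thesis
  proof (rule that[of C])
    fix S :: "'a set" assume S: "finite S" "0 \<in> S" "\<And>s. s \<in> S \<Longrightarrow> - s \<in> S" "card (iter_sum 4 S) \<le> L * card S"
    have up: "card (iter_sum (J + 2) S) \<le> C * card S"
      using iter_sum_growth[OF S] by (simp add: C_def mult_ac)
    show "\<exists>j. card (iter_sum (Suc j) S) \<le> (1 + \<epsilon>) * card (iter_sum j S) \<and> card (iter_sum (Suc j) S) \<le> C * card S"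
    proof (rule ccontr)
      assume neg: "\<not> ?thesis"
      have gr: "card (iter_sum (Suc j) S) > (1 + \<epsilon>) * card (iter_sum j S)" if "j < J + 2" for j
      proof -
        have "card (iter_sum (Suc j) S) \<le> card (iter_sum (J + 2) S)"
          by (rule card_mono[OF finite_iter_sum[OF S(1)] iter_sum_mono[OF S(2)]]) (use that in auto)
        then have "card (iter_sum (Suc j) S) \<le> C * card S" using up by linarith
        then show ?thesis using neg by (meson not_le)
      qed
      have "card (iter_sum (Suc j) S) \<ge> (1 + \<epsilon>) ^ j * card S" if "j \<le> J + 1" for j
        using that
      proof (induction j)
        case 0
        then show ?case by (simp add: iter_sum_Suc_0 del: iter_sum.simps)
      next
        case (Suc j)
        then have "(1 + \<epsilon>) * ((1 + \<epsilon>) ^ j * card S) \<le> (1 + \<epsilon>) * card (iter_sum (Suc j) S)"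
          using assms by (intro mult_left_mono) auto
        also have "\<dots> \<le> card (iter_sum (Suc (Suc j)) S)" using gr[of "Suc j"] Suc.prems by simp
        finally show ?case by (simp add: mult.assoc)
      qed
      from this[of "J + 1"] have "(1 + \<epsilon>) ^ (J + 1) * card S \<le> card (iter_sum (J + 2) S)" by simp
      also note up
      finally have "(1 + \<epsilon>) ^ (J + 1) * card S \<le> C * card S" .
      moreover have "card S > 0" using S by (auto simp: card_gt_0_iff)
      ultimately have "(1 + \<epsilon>) ^ (J + 1) \<le> C" by simp
      moreover have "(1 + \<epsilon>) ^ J \<le> (1 + \<epsilon>) ^ (J + 1)" using assms by (intro power_increasing) auto
      ultimately show False using J by (simp add: C_def)
    qed
  qed
qed

section \<open>Approximate groups inside sets with many progressions\<close>

lemma approximate_group_piece: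
  fixes \<eta> \<epsilon> :: real
  assumes \<eta>: "0 < \<eta>" and \<epsilon>: "0 < \<epsilon>"
  obtains C :: real where "\<And>A D H :: 'a::ab_group_add set. finite A \<Longrightarrow> A \<noteq> {} \<Longrightarrow> finite D \<Longrightarrow> card D \<le> card A \<Longrightarrow>
     \<eta> * (card A)\<^sup>2 \<le> card {(x, z). x \<in> A \<and> z \<in> A \<and> x + z \<in> D} \<Longrightarrow>
     A \<subseteq> H \<Longrightarrow> (\<And>x y. x \<in> H \<Longrightarrow> y \<in> H \<Longrightarrow> x - y \<in> H) \<Longrightarrow>
     \<exists>U V B a. finite U \<and> U \<noteq> {} \<and> finite V \<and> U \<subseteq> H \<and> V \<subseteq> H \<and> B \<subseteq> A \<and> \<eta> / 8 * card A \<le> card B \<and> a \<in> A \<and>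
       (\<forall>u\<in>U. \<forall>b\<in>B. u + (b - a) \<in> V) \<and> card V \<le> (1 + \<epsilon>) * card U \<and> card V \<le> C * card A"
proof -
  \<comment> \<open>\<open>K\<close> bounds the size of \<open>diffset X\<close> relative to
    \<open>X\<close>: the factor \<open>1024 / \<eta> ^ 5\<close> is relative to \<open>A\<close>,
    which is at most \<open>4 / \<eta>\<close> times as large as \<open>X\<close>. The passage from
    \<open>8 * K ^ 7\<close> to \<open>L\<close> comes from
    \<open>card X \<le> 2 * card S\<close>.\<close>
  define K where "K = 4096 / \<eta> ^ 6"
  define L where "L = 16 * K ^ 7"
  have K: "K > 0" using \<eta> by (simp add: K_def)
  then have "L > 0" by (simp add: L_def)
  then show ?thesis
  proof (rule iter_sum_almost_stable[where 'a='a, OF \<epsilon>])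
    fix C :: real
    assume C: "\<And>S :: 'a set. finite S \<Longrightarrow> 0 \<in> S \<Longrightarrow> (\<And>s. s \<in> S \<Longrightarrow> - s \<in> S) \<Longrightarrow>
       card (iter_sum 4 S) \<le> L * card S \<Longrightarrow>
       \<exists>j. card (iter_sum (Suc j) S) \<le> (1 + \<epsilon>) * card (iter_sum j S) \<and> card (iter_sum (Suc j) S) \<le> C * card S"
    show ?thesis
    \<comment> \<open>The second factor converts a bound relative to \<open>S\<close> into one
      relative to \<open>A\<close>, as \<open>S\<close> lies in the difference set of
      \<open>X\<close>. The maximum keeps this monotone, the sign of \<open>C\<close> being unknown.
      The set \<open>H\<close> will be the group of torsion points, where Fourier analysis is
      available for \<open>U\<close> and \<open>V\<close>.\<close>
    proof (rule that[of "max C 0 * (1024 / \<eta> ^ 5)"])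
      fix A D H :: "'a set"
      assume A: "finite A" "A \<noteq> {}" and D: "finite D" "card D \<le> card A"
        and edges: "\<eta> * (card A)\<^sup>2 \<le> card {(x, z). x \<in> A \<and> z \<in> A \<and> x + z \<in> D}"
        and H: "A \<subseteq> H" "\<And>x y. x \<in> H \<Longrightarrow> y \<in> H \<Longrightarrow> x - y \<in> H"
      obtain X where X: "X \<subseteq> A" "\<eta> / 4 * card A \<le> card X" "card (diffset X) \<le> 1024 / \<eta> ^ 5 * card A"
        using balog_szemeredi_gowers[OF A D \<eta> edges] by blast
      have finX: "finite X" using X(1) A finite_subset by blast
      have "\<eta> / 4 * card A > 0" using \<eta> A by (simp add: card_gt_0_iff)
      then have Xne: "X \<noteq> {}" using X(2) by auto
      have "card (diffset X) \<le> K * card X"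
      proof -
        have "1024 / \<eta> ^ 5 * card A = 4096 / \<eta> ^ 6 * (\<eta> / 4 * card A)"
          using \<eta> by (simp add: field_simps eval_nat_numeral)
        also have "\<dots> \<le> 4096 / \<eta> ^ 6 * card X" by (rule mult_left_mono[OF X(2)]) (use \<eta> in auto)
        finally show ?thesis using X(3) by (simp add: K_def)
      qed
      from popular_differences[OF finX Xne this] obtain S a
        where S: "finite S" "0 \<in> S" "\<forall>s\<in>S. - s \<in> S" "S \<subseteq> diffset X" "a \<in> X"
          and half: "card X / 2 \<le> card {x\<in>X. x - a \<in> S}" and S4: "card (iter_sum 4 S) \<le> 8 * K ^ 7 * card X"
        by blast
      define B where "B = {x\<in>X. x - a \<in> S}"
      have "card B \<le> card S"
        by (rule card_inj_on_le[of "\<lambda>x. x - a"]) (use S in \<open>auto simp: B_def inj_on_def\<close>)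
      then have XS: "card X \<le> 2 * real (card S)" using half by (simp add: B_def)
      have "8 * K ^ 7 * card X \<le> 8 * K ^ 7 * (2 * real (card S))"
        by (rule mult_left_mono[OF XS]) (use K in simp)
      then have "card (iter_sum 4 S) \<le> L * card S" using S4 unfolding L_def by linarith
      from C[OF S(1,2) _ this] S(3) obtain j where j: "card (iter_sum (Suc j) S) \<le> (1 + \<epsilon>) * card (iter_sum j S)"
        "card (iter_sum (Suc j) S) \<le> C * card S" by blast
      have H0: "0 \<in> H" using A(2) H by (metis all_not_in_conv diff_self subsetD)
      have Hneg: "- x \<in> H" if "x \<in> H" for x using H(2)[OF H0 that] by simp
      have Hplus: "x + y \<in> H" if "x \<in> H" "y \<in> H" for x y using H(2)[OF that(1) Hneg[OF that(2)]] by simp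
      have "diffset X \<subseteq> H" using X(1) H(1) by (auto simp: diffset_def intro!: H(2))
      then have SH: "S \<subseteq> H" using S(4) by blast
      have iterH: "iter_sum k S \<subseteq> H" for k
      proof (induction k)
        case (Suc k)
        then show ?case using SH Hplus by (auto simp: set_plus_def)
      qed (use H0 in simp)
      have ne: "iter_sum j S \<noteq> {}" using iter_sum_mono[OF S(2), of 0 j] by auto
      have "C * card S \<le> max C 0 * (1024 / \<eta> ^ 5 * card A)"
      proof (rule mult_mono)
        have "card S \<le> card (diffset X)" by (rule card_mono[OF finite_diffset[OF finX] S(4)])
        then show "card S \<le> 1024 / \<eta> ^ 5 * card A" using X(3) by linarith
      qed auto
      then have "card (iter_sum (Suc j) S) \<le> max C 0 * (1024 / \<eta> ^ 5) * card A" using j(2) by (simp add: mult.assoc)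
      moreover have "u + (b - a) \<in> iter_sum (Suc j) S" if "u \<in> iter_sum j S" "b \<in> B" for u b
      proof -
        have "(b - a) + u \<in> S + iter_sum j S" using that by (intro set_plus_intro) (auto simp: B_def)
        then show ?thesis by (simp add: add.commute)
      qed
      moreover have "\<eta> / 8 * card A \<le> card B" using half X(2) by (simp add: B_def)
      moreover have "B \<subseteq> A" "a \<in> A" using X(1) S(5) by (auto simp: B_def)
      ultimately show "\<exists>U V B a. finite U \<and> U \<noteq> {} \<and> finite V \<and> U \<subseteq> H \<and> V \<subseteq> H \<and> B \<subseteq> A \<and> \<eta> / 8 * card A \<le> card B \<and> a \<in> A \<and>
         (\<forall>u\<in>U. \<forall>b\<in>B. u + (b - a) \<in> V) \<and> card V \<le> (1 + \<epsilon>) * card U \<and> card V \<le> max C 0 * (1024 / \<eta> ^ 5) * card A"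
        using iterH finite_iter_sum[OF S(1)] ne j(1)
        by (intro exI[of _ "iter_sum j S"] exI[of _ "iter_sum (Suc j) S"] exI[of _ B] exI[of _ a])
          (simp del: iter_sum.simps)
    qed
  qed
qed

section \<open>Fourier analysis on the circle group\<close>

text \<open>The circle group is a single type of class \<open>ab_group_add\<close> containing all the groups of integers
  modulo \<open>N\<close>, so that the results above apply to each of them.\<close>

quotient_type circle = real / "\<lambda>x y :: real. x - y \<in> \<int>"
proof (rule equivpI)
  show "symp (\<lambda>x y :: real. x - y \<in> \<int>)" by (rule sympI) (metis Ints_minus minus_diff_eq)
  show "transp (\<lambda>x y :: real. x - y \<in> \<int>)" by (rule transpI) (use Ints_add in fastforce)
qed (simp add: reflp_def)

instantiation circle :: ab_group_add
begin

lift_definition zero_circle :: circle is 0 .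

lift_definition plus_circle :: "circle \<Rightarrow> circle \<Rightarrow> circle" is "(+)"
  by (drule (1) Ints_add) (simp add: algebra_simps)

lift_definition uminus_circle :: "circle \<Rightarrow> circle" is uminus
  by (metis Ints_minus minus_diff_minus)

lift_definition minus_circle :: "circle \<Rightarrow> circle \<Rightarrow> circle" is "(-)"
  by (drule (1) Ints_diff) (simp add: algebra_simps)

instance by standard (transfer; simp)+

end

section \<open>Characters, orthogonality and Parseval's identity\<close>

lift_definition character :: "int \<Rightarrow> circle \<Rightarrow> complex" is "\<lambda>r x. cis (2 * pi * (of_int r * x))"
proof -
  fix r :: int and x y :: real assume "x - y \<in> \<int>"
  then have 1: "cis (2 * pi * (of_int r * (x - y))) = 1" by (intro cis_multiple_2pi) auto
  have "2 * pi * (of_int r * x) = 2 * pi * (of_int r * y) + 2 * pi * (of_int r * (x - y))"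
    by (simp add: algebra_simps)
  then show "cis (2 * pi * (of_int r * x)) = cis (2 * pi * (of_int r * y))"
    using 1 by (metis cis_mult mult.right_neutral)
qed

lemma character_add: "character r (x + y) = character r x * character r y"
  by transfer (simp add: cis_mult distrib_left)

lemma character_minus: "character r (- x) = cnj (character r x)"
  by transfer (simp add: cis_cnj)

lemma character_diff: "character r (x - y) = character r x * cnj (character r y)"
  by (metis character_add character_minus diff_conv_add_uminus)

lemma norm_character [simp]: "norm (character r x) = 1"
  by transfer simp

lemma character_0 [simp]: "character 0 x = 1" "character r 0 = 1"
  by (transfer, simp)+

text \<open>The embedding of the integers modulo \<open>N\<close> into the circle as its
  \<open>N\<close>-torsion subgroup, whose characters are the restrictions of
  \<open>character r\<close> with \<open>0 \<le> r < N\<close>.\<close>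

definition torsion_point :: "nat \<Rightarrow> int \<Rightarrow> circle" where
  "torsion_point N a = abs_circle (of_int a / of_nat N)"

lemma torsion_point_eq_iff:
  assumes "N > 0" shows "torsion_point N a = torsion_point N b \<longleftrightarrow> int N dvd a - b"
proof -
  have "torsion_point N a = torsion_point N b \<longleftrightarrow> real_of_int a / real N - real_of_int b / real N \<in> \<int>"
    unfolding torsion_point_def by (simp add: circle.abs_eq_iff)
  also have "\<dots> \<longleftrightarrow> (\<exists>k. real_of_int (a - b) / real_of_int (int N) = real_of_int k)"
    by (auto simp: Ints_def diff_divide_distrib)
  also have "\<dots> \<longleftrightarrow> (\<exists>k. real_of_int (a - b) = real_of_int (int N * k))"
    using assms by (auto simp: field_simps)
  also have "\<dots> \<longleftrightarrow> int N dvd a - b" unfolding dvd_def of_int_eq_iff ..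
  finally show ?thesis .
qed

lemma torsion_point_add: "torsion_point N (a + b) = torsion_point N a + torsion_point N b"
  by (simp add: torsion_point_def plus_circle.abs_eq add_divide_distrib)

lemma torsion_point_diff: "torsion_point N (a - b) = torsion_point N a - torsion_point N b"
  by (simp add: torsion_point_def minus_circle.abs_eq diff_divide_distrib)

lemma character_torsion_point: "character r (torsion_point N a) = cis (2 * pi * (of_int r * (of_int a / of_nat N)))"
  by (simp add: torsion_point_def character.abs_eq)

lemma cis_eq_1_iff: "cis (2 * pi * t) = 1 \<longleftrightarrow> t \<in> \<int>"
proof
  assume "cis (2 * pi * t) = 1"
  then have "cos (2 * pi * t) = 1" by (metis cis.sel(1) one_complex.sel(1))
  then obtain n :: int where "2 * pi * t = of_int n * 2 * pi" using cos_one_2pi_int by blast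
  then show "t \<in> \<int>" by simp
qed (rule cis_multiple_2pi)

lemma sum_character:
  assumes N: "N > 0" and x: "x \<in> range (torsion_point N)"
  shows "(\<Sum>r<N. character (int r) x) = (if x = 0 then of_nat N else 0)"
proof -
  obtain a where a: "x = torsion_point N a" using x by blast
  define w where "w = cis (2 * pi * (of_int a / of_nat N))"
  have pw: "character (int r) x = w ^ r" for r
    by (simp add: a character_torsion_point w_def DeMoivre algebra_simps)
  have "x = 0 \<longleftrightarrow> torsion_point N a = torsion_point N 0"
    by (simp add: a torsion_point_def zero_circle_def)
  also have "\<dots> \<longleftrightarrow> w = 1"
    unfolding w_def cis_eq_1_iff by (simp add: torsion_point_def circle.abs_eq_iff)
  finally have x0: "x = 0 \<longleftrightarrow> w = 1" .
  have "w ^ N = 1" using N by (simp add: w_def DeMoivre)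
  then show ?thesis using x0 by (simp add: pw geometric_sum)
qed

definition fourier :: "int \<Rightarrow> circle set \<Rightarrow> complex" where
  "fourier r S = (\<Sum>x\<in>S. character r x)"

lemma fourier_0 [simp]: "fourier 0 S = of_nat (card S)"
  by (simp add: fourier_def)

lemma torsion_diff: "x \<in> range (torsion_point N) \<Longrightarrow> y \<in> range (torsion_point N) \<Longrightarrow> x - y \<in> range (torsion_point N)"
  by (auto simp flip: torsion_point_diff)

lemma norm_fourier_squared:
  "of_real ((norm (fourier r S))\<^sup>2) = (\<Sum>x\<in>S. \<Sum>y\<in>S. character r (x - y))"
  unfolding complex_norm_square fourier_def
  by (simp add: sum_product character_diff)

lemma parseval:
  assumes N: "N > 0" and S: "finite S" "S \<subseteq> range (torsion_point N)"
  shows "(\<Sum>r<N. (norm (fourier (int r) S))\<^sup>2) = N * card S"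
proof -
  have "complex_of_real (\<Sum>r<N. (norm (fourier (int r) S))\<^sup>2) = (\<Sum>r<N. \<Sum>x\<in>S. \<Sum>y\<in>S. character (int r) (x - y))"
    unfolding of_real_sum norm_fourier_squared ..
  also have "\<dots> = (\<Sum>x\<in>S. \<Sum>y\<in>S. \<Sum>r<N. character (int r) (x - y))"
    by (subst sum.swap, rule sum.cong[OF refl], rule sum.swap)
  also have "\<dots> = (\<Sum>x\<in>S. \<Sum>y\<in>S. if x = y then of_nat N else 0)"
    using S(2) by (intro sum.cong refl) (subst sum_character[OF N torsion_diff], auto)
  also have "\<dots> = of_nat (N * card S)" using S by simp
  finally show ?thesis by (metis of_real_eq_iff of_real_of_nat_eq)
qed

text \<open>By orthogonality the left side is \<open>N\<close> times the number of solutions of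
  \<open>u + b = v\<close>, and every pair \<open>(u, b)\<close> has exactly one.\<close>

lemma sum_fourier_triple:
  assumes N: "N > 0" and fin: "finite U" "finite B" "finite V"
    and tor: "U \<subseteq> range (torsion_point N)" "B \<subseteq> range (torsion_point N)" "V \<subseteq> range (torsion_point N)"
    and sub: "\<And>u b. u \<in> U \<Longrightarrow> b \<in> B \<Longrightarrow> u + b \<in> V"
  shows "(\<Sum>r<N. fourier (int r) U * fourier (int r) B * cnj (fourier (int r) V)) = of_nat (N * (card U * card B))"
proof -
  have "(\<Sum>r<N. fourier (int r) U * fourier (int r) B * cnj (fourier (int r) V))
     = (\<Sum>r<N. \<Sum>u\<in>U. \<Sum>b\<in>B. \<Sum>v\<in>V. character (int r) (u + b - v))"
  proof (rule sum.cong[OF refl])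
    fix r
    have "fourier (int r) U * fourier (int r) B * cnj (fourier (int r) V)
      = (\<Sum>u\<in>U. \<Sum>b\<in>B. character (int r) u * character (int r) b) * (\<Sum>v\<in>V. cnj (character (int r) v))"
      by (simp only: fourier_def sum_product cnj_sum)
    also have "\<dots> = (\<Sum>u\<in>U. \<Sum>b\<in>B. \<Sum>v\<in>V. character (int r) u * character (int r) b * cnj (character (int r) v))"
      by (simp only: sum_distrib_right) (simp only: sum_distrib_left)
    finally show "fourier (int r) U * fourier (int r) B * cnj (fourier (int r) V)
      = (\<Sum>u\<in>U. \<Sum>b\<in>B. \<Sum>v\<in>V. character (int r) (u + b - v))"
      by (simp only: character_diff character_add)
  qed
  also have "\<dots> = (\<Sum>u\<in>U. \<Sum>b\<in>B. \<Sum>v\<in>V. \<Sum>r<N. character (int r) (u + b - v))"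
    by (subst sum.swap, rule sum.cong[OF refl], subst sum.swap, rule sum.cong[OF refl], rule sum.swap)
  also have "\<dots> = (\<Sum>u\<in>U. \<Sum>b\<in>B. \<Sum>v\<in>V. if u + b = v then of_nat N else 0)"
  proof (intro sum.cong refl)
    fix u b v assume "u \<in> U" "b \<in> B" "v \<in> V"
    then have "u + b - v \<in> range (torsion_point N)"
      by (intro torsion_diff subsetD[OF tor(3)] sub)
    from sum_character[OF N this] show "(\<Sum>r<N. character (int r) (u + b - v)) = (if u + b = v then of_nat N else 0)"
      by simp
  qed
  also have "\<dots> = (\<Sum>u\<in>U. \<Sum>b\<in>B. of_nat N)"
    by (intro sum.cong refl) (use fin sub in \<open>simp add: sum.delta'\<close>)
  also have "\<dots> = of_nat (N * (card U * card B))" by (simp add: mult_ac)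
  finally show ?thesis .
qed

text \<open>If \<open>U + B\<close> is hardly larger than \<open>U\<close> and both are sparse, the frequency \<open>0\<close> cannot carry the
  whole Fourier mass, so some other character must be almost constant on \<open>B\<close>.\<close>

lemma large_fourier_coefficient:
  fixes \<epsilon> :: real
  assumes N: "N > 0" and fin: "finite U" "finite B" "finite V" and ne: "U \<noteq> {}" "B \<noteq> {}"
    and tor: "U \<subseteq> range (torsion_point N)" "B \<subseteq> range (torsion_point N)" "V \<subseteq> range (torsion_point N)"
    and sub: "\<And>u b. u \<in> U \<Longrightarrow> b \<in> B \<Longrightarrow> u + b \<in> V"
    and \<epsilon>: "0 < \<epsilon>" "\<epsilon> < 1 / 2" and V: "card V \<le> (1 + \<epsilon>) * card U" "card V \<le> \<epsilon> * N"
  obtains r where "0 < r" "r < N" "(1 - 2 * \<epsilon>) * card B \<le> norm (fourier (int r) B)"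
proof -
  define F where "F = (\<lambda>r S. norm (fourier (int r) S))"
  have F0: "F r S \<ge> 0" for r S by (simp add: F_def)
  have "\<exists>r. 0 < r \<and> r < N \<and> (1 - 2 * \<epsilon>) * card B \<le> F r B"
  proof (rule ccontr)
    assume neg: "\<not> ?thesis"
    have cU: "card U > 0" and cB: "card B > 0" using ne fin by (auto simp: card_gt_0_iff)
    have Nset: "{..<N} = insert 0 {1..<N}" using N by auto
    have "(\<Sum>r<N. fourier (int r) U * fourier (int r) B * cnj (fourier (int r) V)) =
      of_nat (card U * card B * card V) + (\<Sum>r=1..<N. fourier (int r) U * fourier (int r) B * cnj (fourier (int r) V))"
      unfolding Nset by simp
    then have "(\<Sum>r=1..<N. fourier (int r) U * fourier (int r) B * cnj (fourier (int r) V))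
      = complex_of_real (card U * card B * (real N - card V))"
      using sum_fourier_triple[OF N fin tor sub] by (simp add: algebra_simps)
    then have "norm (\<Sum>r=1..<N. fourier (int r) U * fourier (int r) B * cnj (fourier (int r) V))
      = \<bar>card U * card B * (real N - card V)\<bar>" by (simp only: norm_of_real)
    then have "card U * card B * (real N - card V) \<le> (\<Sum>r=1..<N. F r U * F r B * F r V)"
      using norm_sum[of "\<lambda>r. fourier (int r) U * fourier (int r) B * cnj (fourier (int r) V)" "{1..<N}"]
      by (simp add: F_def norm_mult)
    \<comment> \<open>At nonzero frequencies \<open>F r B\<close> is below the threshold by
      assumption. The remaining product is split by the inequality of arithmetic and geometric
      means, so that Parseval applies to \<open>U\<close> and \<open>V\<close> separately; this
      loses little because their sizes nearly agree.\<close>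
    also have "\<dots> \<le> (\<Sum>r=1..<N. ((1 - 2 * \<epsilon>) * card B) * (((F r U)\<^sup>2 + (F r V)\<^sup>2) / 2))"
    proof (rule sum_mono)
      fix r assume "r \<in> {1..<N}"
      then have 1: "F r B \<le> (1 - 2 * \<epsilon>) * card B" using neg by (auto simp: not_le)
      have 2: "F r U * F r V \<le> ((F r U)\<^sup>2 + (F r V)\<^sup>2) / 2"
        using zero_le_power2[of "F r U - F r V"] by (simp add: power2_diff)
      have "F r B * (F r U * F r V) \<le> ((1 - 2 * \<epsilon>) * card B) * (((F r U)\<^sup>2 + (F r V)\<^sup>2) / 2)"
        by (rule mult_mono[OF 1 2]) (use F0 \<epsilon> in auto)
      then show "F r U * F r B * F r V \<le> ((1 - 2 * \<epsilon>) * card B) * (((F r U)\<^sup>2 + (F r V)\<^sup>2) / 2)"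
        by (simp add: mult_ac)
    qed
    also have "\<dots> = ((1 - 2 * \<epsilon>) * card B / 2) * (\<Sum>r=1..<N. (F r U)\<^sup>2 + (F r V)\<^sup>2)"
      unfolding sum_distrib_left by (rule sum.cong) auto
    also have "\<dots> \<le> ((1 - 2 * \<epsilon>) * card B / 2) * (\<Sum>r<N. (F r U)\<^sup>2 + (F r V)\<^sup>2)"
      by (intro mult_left_mono sum_mono2) (use \<epsilon> in auto)
    also have "(\<Sum>r<N. (F r U)\<^sup>2 + (F r V)\<^sup>2) = N * real (card U) + N * real (card V)"
      unfolding sum.distrib F_def parseval[OF N fin(1) tor(1)] parseval[OF N fin(3) tor(3)] by simp
    also have "((1 - 2 * \<epsilon>) * card B / 2) * (N * real (card U) + N * real (card V))
       \<le> ((1 - 2 * \<epsilon>) * card B / 2) * (N * real (card U) + N * ((1 + \<epsilon>) * card U))"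
      by (intro mult_left_mono add_left_mono V) (use \<epsilon> in auto)
    also have "\<dots> = N * (card U * card B) * ((1 - 2 * \<epsilon>) * (1 + \<epsilon> / 2))" by (simp add: field_simps)
    finally have 3: "card U * card B * (real N - card V) \<le> N * (card U * card B) * ((1 - 2 * \<epsilon>) * (1 + \<epsilon> / 2))" .
    have "card U * card B * (real N - \<epsilon> * N) \<le> card U * card B * (real N - card V)"
      using V(2) by (intro mult_left_mono) auto
    with 3 have "(N * (real (card U) * card B)) * (1 - \<epsilon>) \<le> (N * (real (card U) * card B)) * ((1 - 2 * \<epsilon>) * (1 + \<epsilon> / 2))"
      by (simp add: algebra_simps)
    \<comment> \<open>The right side equals
      \<open>1 - 3 / 2 * \<epsilon> - \<epsilon>\<^sup>2\<close>; the factor 2 in the threshold is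
      what makes it too small.\<close>
    then have "1 - \<epsilon> \<le> (1 - 2 * \<epsilon>) * (1 + \<epsilon> / 2)"
      using N cU cB by (subst (asm) mult_le_cancel_left_pos) auto
    then have "\<epsilon> / 2 + \<epsilon> * \<epsilon> \<le> 0" by (simp add: algebra_simps)
    moreover have "\<epsilon> * \<epsilon> > 0" using \<epsilon> by simp
    ultimately show False using \<epsilon> by linarith
  qed
  then show ?thesis using that by (auto simp: F_def)
qed

text \<open>The mean of \<open>Re (character r (x - b))\<close> over all pairs is the square of the
  normalised coefficient, so at least \<open>1 - 4 * \<epsilon>\<close>. For some \<open>b\<close>
  the nonnegative deficit \<open>1 - Re (character r (x - b))\<close> has mean at most
  \<open>4 * \<epsilon>\<close>, and by Markov's inequality at most half of \<open>B\<close> has a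
  deficit above \<open>8 * \<epsilon>\<close>.\<close>

lemma concentrated_half:
  fixes \<epsilon> :: real
  assumes B: "finite B" "B \<noteq> {}" and \<epsilon>: "0 < \<epsilon>" "\<epsilon> < 1 / 2"
    and large: "(1 - 2 * \<epsilon>) * card B \<le> norm (fourier r B)"
  obtains b where "b \<in> B" "card B / 2 \<le> card {x\<in>B. 1 - 8 * \<epsilon> \<le> Re (character r (x - b))}"
proof -
  have "complex_of_real ((norm (fourier r B))\<^sup>2) = (\<Sum>b\<in>B. \<Sum>x\<in>B. character r (x - b))"
    unfolding norm_fourier_squared by (rule sum.swap)
  then have sq: "(norm (fourier r B))\<^sup>2 = (\<Sum>b\<in>B. \<Sum>x\<in>B. Re (character r (x - b)))"
    by (metis (no_types, lifting) Re_complex_of_real Re_sum sum.cong)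
  have "(1 - 4 * \<epsilon>) * (card B)\<^sup>2 \<le> ((1 - 2 * \<epsilon>) * card B)\<^sup>2"
    unfolding power_mult_distrib of_nat_power
    by (rule mult_right_mono) (auto simp: power2_eq_square algebra_simps)
  also have "\<dots> \<le> (norm (fourier r B))\<^sup>2" by (rule power_mono[OF large]) (use \<epsilon> in auto)
  finally have "(\<Sum>b\<in>B. (1 - 4 * \<epsilon>) * card B) \<le> (\<Sum>b\<in>B. \<Sum>x\<in>B. Re (character r (x - b)))"
    unfolding sq by (simp add: power2_eq_square mult_ac)
  from exists_ge_average[OF B this] obtain b where b: "b \<in> B" "(1 - 4 * \<epsilon>) * card B \<le> (\<Sum>x\<in>B. Re (character r (x - b)))"
    by blast
  define G where "G = {x\<in>B. 1 - 8 * \<epsilon> \<le> Re (character r (x - b))}"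
  have le1: "Re (character r x) \<le> 1" for x using complex_Re_le_cmod[of "character r x"] by simp
  have "8 * \<epsilon> * card (B - G) = (\<Sum>x\<in>B-G. 8 * \<epsilon>)" by simp
  also have "\<dots> \<le> (\<Sum>x\<in>B-G. 1 - Re (character r (x - b)))"
    by (rule sum_mono) (auto simp: G_def)
  also have "\<dots> \<le> (\<Sum>x\<in>B. 1 - Re (character r (x - b)))"
    by (rule sum_mono2) (use B le1 in auto)
  also have "\<dots> = card B - (\<Sum>x\<in>B. Re (character r (x - b)))" by (simp add: sum_subtractf)
  also have "\<dots> \<le> 8 * \<epsilon> * (card B / 2)" using b(2) by (simp add: algebra_simps)
  finally have "card (B - G) \<le> card B / 2" using \<epsilon> by (simp only: mult_le_cancel_left_pos)
  moreover have "card (B - G) = real (card B) - card G"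
    using B by (subst card_Diff_subset) (auto simp: G_def intro!: of_nat_diff card_mono)
  ultimately show ?thesis using that[OF b(1)] by (simp add: G_def)
qed

section \<open>Arcs in the integers modulo a prime\<close>

text \<open>The distance of \<open>t\<close> from the multiples of \<open>N\<close>, as a relation
  on integers: it adds up under sums and scales under integer multiples without any choice of
  representatives.\<close>

definition near :: "nat \<Rightarrow> real \<Rightarrow> int \<Rightarrow> bool" where
  "near N c t \<longleftrightarrow> (\<exists>k. \<bar>real_of_int (t - k * int N)\<bar> \<le> c)"

abbreviation arc :: "nat \<Rightarrow> real \<Rightarrow> int \<Rightarrow> int \<Rightarrow> int set \<Rightarrow> int set" where
  "arc N c l a A \<equiv> {x\<in>A. near N c (l * (x - a))}"

lemma near_mono: "near N c t \<Longrightarrow> c \<le> d \<Longrightarrow> near N d t"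
  unfolding near_def by (meson order_trans)

lemma near_0: "0 \<le> c \<Longrightarrow> near N c 0"
  unfolding near_def by (rule exI[of _ 0]) simp

lemma near_add:
  assumes "near N c s" "near N d t" shows "near N (c + d) (s + t)"
proof -
  obtain k l where "\<bar>real_of_int (s - k * int N)\<bar> \<le> c" "\<bar>real_of_int (t - l * int N)\<bar> \<le> d"
    using assms unfolding near_def by blast
  then have "\<bar>real_of_int (s + t - (k + l) * int N)\<bar> \<le> c + d" by (simp add: algebra_simps)
  then show ?thesis unfolding near_def by blast
qed

lemma near_minus: "near N c (- t) \<longleftrightarrow> near N c t"
proof -
  have "near N c (- t)" if t: "near N c t" for t
  proof -
    obtain k where "\<bar>real_of_int (t - k * int N)\<bar> \<le> c" using t unfolding near_def by blast
    then have "\<bar>real_of_int (- t - (- k) * int N)\<bar> \<le> c" by (simp add: algebra_simps)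
    then show ?thesis unfolding near_def by blast
  qed
  from this[of t] this[of "- t"] show ?thesis by auto
qed

lemma near_diff: "near N c s \<Longrightarrow> near N d t \<Longrightarrow> near N (c + d) (s - t)"
  using near_add[of N c s d "- t"] by (simp add: near_minus)

lemma near_mult:
  assumes "near N c t" shows "near N (real q * c) (int q * t)"
proof -
  obtain k where k: "\<bar>real_of_int (t - k * int N)\<bar> \<le> c" using assms unfolding near_def by blast
  have "real_of_int (int q * t - (int q * k) * int N) = real q * real_of_int (t - k * int N)"
    by (simp add: algebra_simps)
  then have "\<bar>real_of_int (int q * t - (int q * k) * int N)\<bar> = real q * \<bar>real_of_int (t - k * int N)\<bar>"
    by (simp only: abs_mult abs_of_nat)
  also have "\<dots> \<le> real q * c" by (rule mult_left_mono[OF k]) simp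
  finally show ?thesis unfolding near_def by blast
qed

lemma near_cong:
  assumes "int N dvd s - t" shows "near N c s \<longleftrightarrow> near N c t"
proof -
  have "near N c s" if t: "near N c t" and d: "int N dvd s - t" for s t
  proof -
    obtain k where k: "\<bar>real_of_int (t - k * int N)\<bar> \<le> c" using t unfolding near_def by blast
    obtain l where "s - t = int N * l" using d by blast
    then have "s - (k + l) * int N = t - k * int N" by (simp add: algebra_simps)
    then show ?thesis using k unfolding near_def by metis
  qed
  then show ?thesis using assms dvd_minus_iff[of "int N" "s - t"] by (metis minus_diff_eq)
qed

text \<open>Progressions as triples instead of pairs \<open>(x, d)\<close>, so that all three terms
  are treated alike. The modulus 0 gives the progressions of integers, since 0 divides only
  0.\<close>

definition aps :: "nat \<Rightarrow> int set \<Rightarrow> (int \<times> int \<times> int) set" where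
  "aps N A = {(x, y, z). x \<in> A \<and> y \<in> A \<and> z \<in> A \<and> int N dvd x + z - 2 * y}"

lemma finite_aps: "finite A \<Longrightarrow> finite (aps N A)"
  by (rule finite_subset[of _ "A \<times> A \<times> A"]) (auto simp: aps_def)

lemma residue_eqI:
  assumes "x \<in> {0..<int N}" "y \<in> {0..<int N}" "int N dvd x - y" shows "x = y"
  using assms by (metis atLeastLessThan_iff mod_eq_dvd_iff mod_pos_pos_trivial)

lemma odd_dvd_double: "odd N \<Longrightarrow> int N dvd 2 * t \<Longrightarrow> int N dvd t"
  by (metis coprime_dvd_mult_right_iff coprime_right_2_iff_odd even_of_nat)

section \<open>From nearly constant characters to short arcs\<close>

lemma near_if_cos_le:
  assumes N: "N > 0" and \<tau>: "0 < \<tau>" "\<tau> < 1 / 2"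
    and c: "cos (2 * pi * \<tau>) \<le> cos (2 * pi * (of_int t / of_nat N))"
  shows "near N (\<tau> * N) t"
proof -
  define u where "u = real_of_int t / real N"
  define k where "k = round u"
  define d where "d = \<bar>u - of_int k\<bar>"
  have d: "d \<le> 1 / 2" using of_int_round_abs_le[of u] by (simp add: d_def k_def abs_minus_commute)
  have "cis (2 * pi * u) = cis (2 * pi * (u - of_int k)) * cis (2 * pi * of_int k)"
    by (simp add: cis_mult algebra_simps)
  then have "cos (2 * pi * u) = cos (2 * pi * (u - of_int k))"
    by (metis Ints_of_int cis.sel(1) cis_multiple_2pi mult.right_neutral)
  also have "\<dots> = cos (2 * pi * d)"
  proof (cases "0 \<le> u - of_int k")
    case False
    then have "2 * pi * d = - (2 * pi * (u - of_int k))" by (simp add: d_def algebra_simps)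
    then show ?thesis by (metis cos_minus)
  qed (simp add: d_def)
  finally have c': "cos (2 * pi * \<tau>) \<le> cos (2 * pi * d)" using c by (simp add: u_def)
  have "d \<le> \<tau>"
  proof (rule ccontr)
    assume "\<not> d \<le> \<tau>"
    then have "cos (2 * pi * d) < cos (2 * pi * \<tau>)"
      using \<tau> d by (intro cos_monotone_0_pi) auto
    then show False using c' by simp
  qed
  then have "\<bar>real_of_int (t - k * int N)\<bar> \<le> \<tau> * N"
  proof -
    have "real_of_int (t - k * int N) = (u - of_int k) * N" using N by (simp add: u_def field_simps)
    then have "\<bar>real_of_int (t - k * int N)\<bar> = d * N" by (simp add: abs_mult d_def)
    then show ?thesis using \<open>d \<le> \<tau>\<close> by (simp add: mult_right_mono)
  qed
  then show ?thesis unfolding near_def by blast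
qed

text \<open>Progressions in \<open>A\<close> correspond to pairs whose sum is the double of an
  element, so the sumset results apply with \<open>D\<close> the set of doubles. The proportion is
  the \<open>\<eta> / 8\<close> of \<open>approximate_group_piece\<close>, halved by
  \<open>concentrated_half\<close>.\<close>

lemma concentrated_piece:
  fixes \<eta> \<tau> :: real
  assumes \<eta>: "0 < \<eta>" and \<tau>: "0 < \<tau>" "\<tau> < 1 / 2"
  shows "\<exists>c::real. c > 0 \<and> (\<forall>N A. odd N \<and> finite A \<and> A \<noteq> {} \<and> A \<subseteq> {0..<int N} \<and> card A \<le> c * N \<and> \<eta> * (card A)\<^sup>2 \<le> card (aps N A) \<longrightarrow>
    (\<exists>r a. 0 < r \<and> r < int N \<and> a \<in> A \<and> \<eta> / 16 * card A \<le> card (arc N (\<tau> * N) r a A)))"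
proof -
  \<comment> \<open>The deficit \<open>8 * \<epsilon>\<close> of \<open>concentrated_half\<close>
    then corresponds to an angle of \<open>2 * pi * \<tau>\<close>.\<close>
  define \<epsilon> where "\<epsilon> = (1 - cos (2 * pi * \<tau>)) / 8"
  have "cos (2 * pi * \<tau>) < cos 0" using \<tau> by (intro cos_monotone_0_pi) auto
  then have "cos (2 * pi * \<tau>) < 1" by simp
  moreover have "0 < (1 - c) / 8 \<and> (1 - c) / 8 < 1 / 2" if "c < 1" "- 1 \<le> c" for c :: real
    using that by simp
  ultimately have \<epsilon>: "0 < \<epsilon>" "\<epsilon> < 1 / 2" using cos_ge_minus_one[of "2 * pi * \<tau>"] unfolding \<epsilon>_def by blast+
  have "1 - 8 * ((1 - c) / 8) = c" for c :: real by (simp add: diff_divide_distrib)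
  then have \<epsilon>8: "1 - 8 * \<epsilon> = cos (2 * pi * \<tau>)" unfolding \<epsilon>_def by blast
  show ?thesis
  proof (rule approximate_group_piece[where 'a = circle, OF \<eta> \<epsilon>(1)])
    fix C :: real
    assume C: "\<And>A D H :: circle set. finite A \<Longrightarrow> A \<noteq> {} \<Longrightarrow> finite D \<Longrightarrow> card D \<le> card A \<Longrightarrow>
     \<eta> * (card A)\<^sup>2 \<le> card {(x, z). x \<in> A \<and> z \<in> A \<and> x + z \<in> D} \<Longrightarrow>
     A \<subseteq> H \<Longrightarrow> (\<And>x y. x \<in> H \<Longrightarrow> y \<in> H \<Longrightarrow> x - y \<in> H) \<Longrightarrow>
     \<exists>U V B a. finite U \<and> U \<noteq> {} \<and> finite V \<and> U \<subseteq> H \<and> V \<subseteq> H \<and> B \<subseteq> A \<and> \<eta> / 8 * card A \<le> card B \<and> a \<in> A \<and>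
       (\<forall>u\<in>U. \<forall>b\<in>B. u + (b - a) \<in> V) \<and> card V \<le> (1 + \<epsilon>) * card U \<and> card V \<le> C * card A"
    show ?thesis
    \<comment> \<open>This density forces \<open>card V \<le> \<epsilon> * N\<close>; otherwise
      \<open>U\<close> and \<open>V\<close> could be nearly the whole group and carry no
      information. The maximum guards against a small or negative \<open>C\<close>.\<close>
    proof (rule exI[of _ "\<epsilon> / max C 1"], intro conjI allI impI, goal_cases)
      case 1
      show ?case using \<epsilon> by simp
    next
      case (2 N A)
      then have N: "odd N" "N > 0" and A: "finite A" "A \<noteq> {}" "A \<subseteq> {0..<int N}" "card A \<le> \<epsilon> / max C 1 * N"
        and edges: "\<eta> * (card A)\<^sup>2 \<le> card (aps N A)"
        by (auto simp: odd_pos)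
      let ?t = "torsion_point N"
      have inj: "inj_on ?t A"
        using A(3) by (auto intro!: inj_onI residue_eqI simp: torsion_point_eq_iff[OF N(2)])
      define A' where "A' = ?t ` A"
      have cA': "card A' = card A" by (simp add: A'_def card_image inj)
      define D where "D = (\<lambda>x. x + x) ` A'"
      define G where "G = {(x, z). x \<in> A' \<and> z \<in> A' \<and> x + z \<in> D}"
      have finA': "finite A'" "A' \<noteq> {}" using A by (auto simp: A'_def)
      have D: "finite D" "card D \<le> card A'" using finA' by (auto simp: D_def card_image_le)
      have finG: "finite G" by (rule finite_subset[of _ "A' \<times> A'"]) (use finA' in \<open>auto simp: G_def\<close>)
      have "card (aps N A) \<le> card G"
      proof (rule card_inj_on_le[of "\<lambda>(x, y, z). (?t x, ?t z)"])
        show "inj_on (\<lambda>(x, y, z). (?t x, ?t z)) (aps N A)"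
        proof (rule inj_onI, clarsimp simp: aps_def)
          fix x y z x' y' z'
          assume h: "x \<in> A" "y \<in> A" "z \<in> A" "int N dvd x + z - 2 * y" "x' \<in> A" "y' \<in> A" "z' \<in> A"
            "int N dvd x' + z' - 2 * y'" "?t x = ?t x'" "?t z = ?t z'"
          then have xz: "x = x'" "z = z'" using inj by (auto simp: inj_on_def)
          have "int N dvd (x' + z' - 2 * y') - (x + z - 2 * y)" by (rule dvd_diff) (use h in auto)
          then have "int N dvd 2 * (y - y')" using xz by (simp add: algebra_simps)
          from residue_eqI[OF subsetD[OF A(3) h(2)] subsetD[OF A(3) h(6)] odd_dvd_double[OF N(1) this]]
          have "y = y'" .
          then show "x = x' \<and> y = y' \<and> z = z'" using xz by simp
        qed
        show "(\<lambda>(x, y, z). (?t x, ?t z)) ` aps N A \<subseteq> G"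
        proof (clarsimp simp: aps_def G_def A'_def D_def image_image)
          fix x y z assume h: "y \<in> A" "int N dvd x + z - 2 * y"
          then have "?t (x + z) = ?t (y + y)" by (simp add: torsion_point_eq_iff[OF N(2)])
          then have "?t x + ?t z = ?t y + ?t y" by (simp only: torsion_point_add)
          then show "?t x + ?t z \<in> (\<lambda>x. ?t x + ?t x) ` A" by (rule image_eqI[OF _ h(1)])
        qed
      qed (rule finG)
      then have edges': "\<eta> * (card A')\<^sup>2 \<le> card {(x, z). x \<in> A' \<and> z \<in> A' \<and> x + z \<in> D}"
        using edges by (simp add: cA' G_def)
      have "A' \<subseteq> range ?t" by (auto simp: A'_def)
      from C[OF finA' D edges' this torsion_diff] obtain U V B a
        where U: "finite U" "U \<noteq> {}" "finite V" "U \<subseteq> range ?t" "V \<subseteq> range ?t" "B \<subseteq> A'" "\<eta> / 8 * card A' \<le> card B" "a \<in> A'"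
          "\<forall>u\<in>U. \<forall>b\<in>B. u + (b - a) \<in> V" "card V \<le> (1 + \<epsilon>) * card U" "card V \<le> C * card A'"
        by blast
      have "\<eta> / 8 * card A' > 0" using \<eta> finA' by (simp add: card_gt_0_iff)
      then have Bne: "B \<noteq> {}" using U(7) by auto
      have finB: "finite B" using U(6) finA' finite_subset by blast
      define B' where "B' = (\<lambda>b. b - a) ` B"
      have cB': "card B' = card B" unfolding B'_def by (rule card_image) (auto simp: inj_on_def)
      have V\<epsilon>: "card V \<le> \<epsilon> * N"
      proof -
        have "C * card A \<le> max C 1 * (\<epsilon> / max C 1 * N)" by (rule mult_mono) (use A in auto)
        then show ?thesis using U(11) by (simp add: cA')
      qed
      have tor: "B' \<subseteq> range ?t" unfolding B'_def using U(6,8) by (auto simp: A'_def simp flip: torsion_point_diff)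
      have sub: "u + b \<in> V" if "u \<in> U" "b \<in> B'" for u b using that U(9) by (auto simp: B'_def)
      have finB': "finite B'" "B' \<noteq> {}" using finB Bne by (auto simp: B'_def)
      obtain r where r: "0 < r" "r < N" "(1 - 2 * \<epsilon>) * card B' \<le> norm (fourier (int r) B')"
        by (rule large_fourier_coefficient[OF N(2) U(1) finB'(1) U(3,2) finB'(2) U(4) tor U(5) sub \<epsilon> U(10) V\<epsilon>])
      obtain b where b: "b \<in> B'" "card B' / 2 \<le> card {x\<in>B'. 1 - 8 * \<epsilon> \<le> Re (character (int r) (x - b))}"
        by (rule concentrated_half[OF finB' \<epsilon> r(3)])
      obtain b0 where b0: "b0 \<in> A" "b = ?t b0 - a" using b(1) U(6) by (auto simp: B'_def A'_def)
      let ?F = "arc N (\<tau> * N) (int r) b0 A"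
      have "{x\<in>B'. 1 - 8 * \<epsilon> \<le> Re (character (int r) (x - b))} \<subseteq> (\<lambda>x. ?t x - a) ` ?F"
      proof clarify
        fix x assume x: "x \<in> B'" "1 - 8 * \<epsilon> \<le> Re (character (int r) (x - b))"
        then obtain y where y: "y \<in> A" "x = ?t y - a" using U(6) by (auto simp: B'_def A'_def)
        have "x - b = ?t (y - b0)" by (simp add: y b0 torsion_point_diff)
        then have "cos (2 * pi * \<tau>) \<le> cos (2 * pi * (of_int (int r * (y - b0)) / of_nat N))"
          using x(2) by (simp add: \<epsilon>8 character_torsion_point)
        then have "near N (\<tau> * N) (int r * (y - b0))" by (rule near_if_cos_le[OF N(2) \<tau>])
        then show "x \<in> (\<lambda>x. ?t x - a) ` ?F" using y by auto
      qed
      then have "card {x\<in>B'. 1 - 8 * \<epsilon> \<le> Re (character (int r) (x - b))} \<le> card ?F"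
        using A(1) by (intro surj_card_le) auto
      then have "\<eta> / 16 * card A \<le> card ?F" using b(2) U(7) by (simp add: cA' cB')
      then show ?case using r b0(1) by (intro exI[of _ "int r"] exI[of _ b0]) auto
    qed
  qed
qed

section \<open>Merging arcs\<close>

text \<open>Dirichlet's pigeonhole: \<open>M ^ card I + 1\<close> multipliers fall into
  \<open>M ^ card I\<close> boxes. The bound on \<open>q\<close> does not involve \<open>N\<close>,
  so for a large prime \<open>N\<close> the multiplier is an invertible dilation.\<close>

lemma simultaneous_approximation:
  fixes v :: "'b \<Rightarrow> int" and M N :: nat
  assumes I: "finite I" and M: "M > 0" and N: "N > 0"
  obtains q where "1 \<le> q" "q \<le> M ^ card I" "\<And>i. i \<in> I \<Longrightarrow> near N (N / M) (int q * v i)"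
proof -
  define w where "w = (\<lambda>q i. real_of_int (int q * v i) / real N)"
  define f where "f = (\<lambda>q. restrict (\<lambda>i. nat \<lfloor>M * frac (w q i)\<rfloor>) I)"
  have "f ` {..M ^ card I} \<subseteq> I \<rightarrow>\<^sub>E {..<M}"
  proof (clarsimp simp: f_def)
    fix q i
    have "real M * frac (w q i) < real M * 1" using M by (intro mult_strict_left_mono frac_lt_1) auto
    then show "nat \<lfloor>M * frac (w q i)\<rfloor> < M" using M by (simp add: nat_less_iff floor_less_iff)
  qed
  then have "card (f ` {..M ^ card I}) \<le> card (I \<rightarrow>\<^sub>E {..<M})" using I by (intro card_mono finite_PiE) auto
  also have "\<dots> < card {..M ^ card I}" using I by (simp add: card_PiE)
  finally have "\<not> inj_on f {..M ^ card I}" by (rule pigeonhole)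
  then obtain q1 q2 where q: "q1 \<le> M ^ card I" "q2 \<le> M ^ card I" "q1 < q2" "f q1 = f q2"
    unfolding inj_on_def by (metis atMost_iff linorder_neqE_nat)
  show ?thesis
  proof (rule that[of "q2 - q1"])
    fix i assume i: "i \<in> I"
    have "nat \<lfloor>M * frac (w q1 i)\<rfloor> = nat \<lfloor>M * frac (w q2 i)\<rfloor>" using fun_cong[OF q(4), of i] i by (simp add: f_def)
    then have "\<lfloor>M * frac (w q1 i)\<rfloor> = \<lfloor>M * frac (w q2 i)\<rfloor>"
      by (subst (asm) eq_nat_nat_iff) auto
    then have "\<bar>M * frac (w q2 i) - M * frac (w q1 i)\<bar> \<le> 1" by linarith
    then have 1: "M * \<bar>frac (w q2 i) - frac (w q1 i)\<bar> \<le> 1" by (simp add: abs_mult flip: right_diff_distrib)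
    define k where "k = \<lfloor>w q2 i\<rfloor> - \<lfloor>w q1 i\<rfloor>"
    have "real_of_int (int (q2 - q1) * v i - k * int N) = N * (frac (w q2 i) - frac (w q1 i))"
      using N q(3) by (simp add: frac_def w_def k_def of_nat_diff field_simps)
    then have "\<bar>real_of_int (int (q2 - q1) * v i - k * int N)\<bar> = N * \<bar>frac (w q2 i) - frac (w q1 i)\<bar>"
      by (simp add: abs_mult)
    also have "\<dots> \<le> N * (1 / M)" by (rule mult_left_mono) (use 1 M in \<open>auto simp: field_simps\<close>)
    finally show "near N (N / M) (int (q2 - q1) * v i)" unfolding near_def by auto
  qed (use q in auto)
qed

lemma card_le_fibre_bound:
  fixes s :: real
  assumes "finite F" "finite X" "g ` F \<subseteq> X" "\<And>x. x \<in> X \<Longrightarrow> card {f\<in>F. g f = x} \<le> s"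
  shows "card F \<le> s * card X"
proof -
  have "F = (\<Union>x\<in>X. {f\<in>F. g f = x})" using assms(3) by auto
  then have "card F \<le> (\<Sum>x\<in>X. card {f\<in>F. g f = x})" using card_UN_le[OF assms(2)] by metis
  then have "real (card F) \<le> (\<Sum>x\<in>X. real (card {f\<in>F. g f = x}))" by (simp flip: of_nat_sum)
  also have "\<dots> \<le> (\<Sum>x\<in>X. s)" by (rule sum_mono) (rule assms(4))
  finally show ?thesis by (simp add: mult.commute)
qed

text \<open>A maximal \<open>8 * \<rho>\<close>-separated set of rich points has disjoint
  \<open>4 * \<rho>\<close>-neighbourhoods with at least \<open>s\<close> elements each, hence at
  most \<open>m\<close> points. Dirichlet's theorem brings these close to \<open>a\<close>, and
  every rich point is within \<open>8 * \<rho>\<close> of one of them. The additional factor 2 in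
  the dilation is meant for middle terms: two outer terms in an arc control only twice the middle
  one.\<close>

lemma merge_rich_translates:
  fixes \<rho> s :: real and N M m :: nat
  assumes R: "finite R" "card R \<le> m * s" and s: "0 < s" and NM: "N > 0" "M > 0" and \<rho>: "0 \<le> \<rho>"
  obtains q where "1 \<le> q" "q \<le> M ^ m"
    "\<And>u. u \<in> R \<Longrightarrow> s \<le> card {z\<in>R. near N (4 * \<rho>) (l * (z - u))} \<Longrightarrow>
       near N (N / M + 16 * real q * \<rho>) (int q * (2 * l * (u - a)))"
proof -
  define nb where "nb = (\<lambda>u. {z\<in>R. near N (4 * \<rho>) (l * (z - u))})"
  define U where "U = {u\<in>R. s \<le> card (nb u)}"
  define rel where "rel = (\<lambda>x y. near N (8 * \<rho>) (l * (x - y)))"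
  have finU: "finite U" using R by (simp add: U_def)
  have rr: "rel x x" for x using \<rho> by (simp add: rel_def near_0)
  have rs: "rel y x" if "rel x y" for x y
    using that unfolding rel_def by (metis near_minus minus_diff_eq mult_minus_right)
  obtain Y where Y: "Y \<subseteq> U" "\<And>x y. x \<in> Y \<Longrightarrow> y \<in> Y \<Longrightarrow> rel x y \<Longrightarrow> x = y"
    "\<And>t. t \<in> U \<Longrightarrow> \<exists>y\<in>Y. rel t y"
  proof (rule maximal_separated_subset[of U rel])
    show "rel x x" for x by (rule rr)
    show "rel y x" if "rel x y" for x y by (rule rs[OF that])
  qed (use finU in auto)
  have finY: "finite Y" using Y(1) finU finite_subset by blast
  have "s * card Y = (\<Sum>y\<in>Y. s)" by simp
  also have "\<dots> \<le> (\<Sum>y\<in>Y. real (card (nb y)))" by (rule sum_mono) (use Y(1) in \<open>auto simp: U_def\<close>)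
  also have "\<dots> = real (card (\<Union>y\<in>Y. nb y))"
  proof (subst card_UN_disjoint)
    show "\<forall>i\<in>Y. \<forall>j\<in>Y. i \<noteq> j \<longrightarrow> nb i \<inter> nb j = {}"
    proof (intro ballI impI equals0I)
      fix i j z assume ij: "i \<in> Y" "j \<in> Y" "i \<noteq> j" "z \<in> nb i \<inter> nb j"
      then have "near N (4 * \<rho> + 4 * \<rho>) (l * (z - j) - l * (z - i))"
        by (intro near_diff) (auto simp: nb_def)
      then have "rel i j" by (simp add: rel_def algebra_simps)
      then show False using Y(2) ij by blast
    qed
  qed (use finY R in \<open>auto simp: nb_def\<close>)
  also have "\<dots> \<le> card R" using card_mono[OF R(1), of "\<Union>y\<in>Y. nb y"] by (auto simp: nb_def)
  also have "\<dots> \<le> m * s" by (rule R(2))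
  finally have cY: "card Y \<le> m" using s by (simp add: mult.commute)
  obtain q where q: "1 \<le> q" "q \<le> M ^ card Y" "\<And>y. y \<in> Y \<Longrightarrow> near N (N / M) (int q * (2 * l * (y - a)))"
    by (rule simultaneous_approximation[OF finY NM(2,1), of "\<lambda>y. 2 * l * (y - a)"]) blast
  show ?thesis
  proof (rule that[OF q(1)])
    show "q \<le> M ^ m" using q(2) power_increasing[OF cY, of M] NM(2) by simp
  next
    fix u assume "u \<in> R" "s \<le> card {z\<in>R. near N (4 * \<rho>) (l * (z - u))}"
    then have "u \<in> U" by (simp add: U_def nb_def)
    then obtain y where y: "y \<in> Y" "near N (8 * \<rho>) (l * (u - y))" using Y(3) unfolding rel_def by blast
    have "near N (N / M + real (2 * q) * (8 * \<rho>)) (int q * (2 * l * (y - a)) + int (2 * q) * (l * (u - y)))"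
      by (intro near_add q y near_mult)
    then show "near N (N / M + 16 * real q * \<rho>) (int q * (2 * l * (u - a)))" by (simp add: algebra_simps)
  qed
qed

section \<open>Counting progressions by two of their terms\<close>

lemma inj_on_aps:
  assumes "odd N" "A \<subseteq> {0..<int N}"
  shows "inj_on (\<lambda>(x, y, z). (x, y)) (aps N A)" "inj_on (\<lambda>(x, y, z). (x, z)) (aps N A)"
    "inj_on (\<lambda>(x, y, z). (y, z)) (aps N A)"
proof -
  have *: "int N dvd (x + z - 2 * y) - (x' + z' - 2 * y')"
    if "int N dvd x + z - 2 * y" "int N dvd x' + z' - 2 * y'" for x y z x' y' z'
    using that by (rule dvd_diff)
  show "inj_on (\<lambda>(x, y, z). (x, y)) (aps N A)"
  proof (rule inj_onI, clarsimp simp: aps_def)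
    fix x y z z' assume h: "z \<in> A" "z' \<in> A" "int N dvd x + z - 2 * y" "int N dvd x + z' - 2 * y"
    from *[OF h(3,4)] have "int N dvd z - z'" by simp
    then show "z = z'" by (rule residue_eqI[OF subsetD[OF assms(2) h(1)] subsetD[OF assms(2) h(2)]])
  qed
  show "inj_on (\<lambda>(x, y, z). (x, z)) (aps N A)"
  proof (rule inj_onI, clarsimp simp: aps_def)
    fix x y z y' assume h: "y \<in> A" "y' \<in> A" "int N dvd x + z - 2 * y" "int N dvd x + z - 2 * y'"
    from *[OF h(4,3)] have "int N dvd 2 * (y - y')" by (simp add: algebra_simps)
    then have "int N dvd y - y'" by (rule odd_dvd_double[OF assms(1)])
    then show "y = y'" by (rule residue_eqI[OF subsetD[OF assms(2) h(1)] subsetD[OF assms(2) h(2)]])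
  qed
  show "inj_on (\<lambda>(x, y, z). (y, z)) (aps N A)"
  proof (rule inj_onI, clarsimp simp: aps_def)
    fix x y z x' assume h: "x \<in> A" "x' \<in> A" "int N dvd x + z - 2 * y" "int N dvd x' + z - 2 * y"
    from *[OF h(3,4)] have "int N dvd x - x'" by simp
    then show "x = x'" by (rule residue_eqI[OF subsetD[OF assms(2) h(1)] subsetD[OF assms(2) h(2)]])
  qed
qed

lemma near_third_term:
  assumes d: "int N dvd x + z - 2 * y" and x: "near N \<rho> (l * (x - a))"
  shows "near N \<rho> (l * (y - a)) \<Longrightarrow> near N (3 * \<rho>) (l * (z - a))"
    and "near N \<rho> (l * (z - a)) \<Longrightarrow> near N (2 * \<rho>) (2 * l * (y - a))"
proof -
  have d': "int N dvd l * (x + z - 2 * y)" using d by (rule dvd_mult)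
  show "near N (3 * \<rho>) (l * (z - a))" if y: "near N \<rho> (l * (y - a))"
  proof -
    have "near N (\<rho> + \<rho> + \<rho>) ((l * (y - a) + l * (y - a)) - l * (x - a))"
      by (intro near_diff near_add x y)
    moreover have "int N dvd l * (z - a) - ((l * (y - a) + l * (y - a)) - l * (x - a))"
      using d' by (simp add: algebra_simps)
    ultimately show ?thesis using near_cong by fastforce
  qed
  show "near N (2 * \<rho>) (2 * l * (y - a))" if z: "near N \<rho> (l * (z - a))"
  proof -
    have "near N (\<rho> + \<rho>) (l * (x - a) + l * (z - a))" by (intro near_add x z)
    moreover have "int N dvd (l * (x - a) + l * (z - a)) - 2 * l * (y - a)"
      using d' by (simp add: algebra_simps)
    ultimately show ?thesis using near_cong by fastforce
  qed
qed

lemma card_aps_pairs_le: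
  assumes inj: "inj_on (\<lambda>t. (g t, h t)) (aps N A)" and S: "finite S" "finite S'"
  shows "card {t \<in> aps N A. g t \<in> S \<and> h t \<in> S'} \<le> card S * card S'"
proof -
  have "card {t \<in> aps N A. g t \<in> S \<and> h t \<in> S'} \<le> card (S \<times> S')"
  proof (rule card_inj_on_le)
    show "inj_on (\<lambda>t. (g t, h t)) {t \<in> aps N A. g t \<in> S \<and> h t \<in> S'}" using inj by (rule inj_on_subset) auto
  qed (use S in auto)
  then show ?thesis by (simp add: card_cartesian_product)
qed

definition fst3 :: "'a \<times> 'a \<times> 'a \<Rightarrow> 'a" where "fst3 = (\<lambda>(x, y, z). x)"
definition snd3 :: "'a \<times> 'a \<times> 'a \<Rightarrow> 'a" where "snd3 = (\<lambda>(x, y, z). y)"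
definition thd3 :: "'a \<times> 'a \<times> 'a \<Rightarrow> 'a" where "thd3 = (\<lambda>(x, y, z). z)"
lemmas coords = fst3_def snd3_def thd3_def

lemma inj_on_aps_coords:
  assumes "odd N" "A \<subseteq> {0..<int N}"
  shows "inj_on (\<lambda>t. (fst3 t, snd3 t)) (aps N A)" "inj_on (\<lambda>t. (fst3 t, thd3 t)) (aps N A)"
    "inj_on (\<lambda>t. (snd3 t, thd3 t)) (aps N A)" "inj_on (\<lambda>t. (snd3 t, fst3 t)) (aps N A)"
    "inj_on (\<lambda>t. (thd3 t, fst3 t)) (aps N A)" "inj_on (\<lambda>t. (thd3 t, snd3 t)) (aps N A)"
proof -
  show 1: "inj_on (\<lambda>t. (fst3 t, snd3 t)) (aps N A)" "inj_on (\<lambda>t. (fst3 t, thd3 t)) (aps N A)"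
    "inj_on (\<lambda>t. (snd3 t, thd3 t)) (aps N A)"
    using inj_on_aps[OF assms] by (simp_all add: coords case_prod_unfold)
  show "inj_on (\<lambda>t. (snd3 t, fst3 t)) (aps N A)" "inj_on (\<lambda>t. (thd3 t, fst3 t)) (aps N A)"
    "inj_on (\<lambda>t. (thd3 t, snd3 t)) (aps N A)"
    using 1 unfolding inj_on_def by blast+
qed

text \<open>Cross terms are controlled: a progression with two terms in the arc \<open>B\<close> has its third term in \<open>E\<close>,
  and one with a single term in \<open>B\<close> has its other two terms in a pair of translates of the arc that
  contain few elements of \<open>R\<close> unless they lie in \<open>E\<close>.\<close>

lemma card_aps_split:
  fixes s \<rho> :: real
  assumes N: "odd N" and R: "R \<subseteq> {0..<int N}" and s: "0 \<le> s"
    and B: "B = arc N \<rho> l a R" and \<rho>: "0 \<le> \<rho>" and E: "B \<subseteq> E" "E \<subseteq> R" "card (E - B) \<le> s"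
    and arc: "\<And>x. x \<in> R \<Longrightarrow> near N (6 * \<rho>) (2 * l * (x - a)) \<Longrightarrow> x \<in> E"
    and rich: "\<And>u. u \<in> R \<Longrightarrow> s \<le> card {z\<in>R. near N (4 * \<rho>) (l * (z - u))} \<Longrightarrow> u \<in> E"
  shows "card (aps N R) \<le> card (aps N B) + card (aps N (R - B)) + 6 * s * card R"
proof -
  have finR: "finite R" using R finite_subset by blast
  have finE: "finite E" using E(2) finR finite_subset by blast
  note inj = inj_on_aps_coords[OF N R]
  have cR: "fst3 t \<in> R" "snd3 t \<in> R" "thd3 t \<in> R" if "t \<in> aps N R" for t
    using that by (auto simp: aps_def coords)
  \<comment> \<open>There are at most \<open>s\<close> choices for a term in \<open>E - B\<close>,
    and together with one other term it determines the progression.\<close>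
  have two: "card {t \<in> aps N R. g t \<in> E - B} \<le> s * card R"
    if inj: "inj_on (\<lambda>t. (g t, h t)) (aps N R)" and h: "\<And>t. t \<in> aps N R \<Longrightarrow> h t \<in> R" for g h
  proof -
    have "{t \<in> aps N R. g t \<in> E - B} = {t \<in> aps N R. g t \<in> E - B \<and> h t \<in> R}" using h by auto
    then have "card {t \<in> aps N R. g t \<in> E - B} \<le> card (E - B) * card R"
      using card_aps_pairs_le[OF inj, of "E - B" R] finR finE by simp
    then have "real (card {t \<in> aps N R. g t \<in> E - B}) \<le> card (E - B) * real (card R)"
      by (simp flip: of_nat_mult)
    also have "\<dots> \<le> s * card R" by (rule mult_right_mono) (use E in auto)
    finally show ?thesis .
  qed
  \<comment> \<open>For a fixed term \<open>g t\<close> the terms \<open>h t\<close> are within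
    \<open>4 * \<rho>\<close> of each other and outside \<open>E\<close>; by \<open>rich\<close> the
    neighbourhood of any one of them has fewer than \<open>s\<close> elements.\<close>
  have poor: "card F \<le> s * card R"
    if inj: "inj_on (\<lambda>t. (g t, h t)) (aps N R)" and F: "F \<subseteq> aps N R" "g ` F \<subseteq> R" "h ` F \<subseteq> R - E"
      and close: "\<And>t t'. t \<in> F \<Longrightarrow> t' \<in> F \<Longrightarrow> g t = g t' \<Longrightarrow> near N (4 * \<rho>) (l * (h t - h t'))" for F g h
  proof (rule card_le_fibre_bound[where g = g])
    show "finite F" using finite_aps[OF finR] F(1) by (rule finite_subset[rotated])
    fix x
    show "card {f\<in>F. g f = x} \<le> s"
    proof (cases "{f\<in>F. g f = x} = {}")
      case True
      then show ?thesis using s by (simp only: card.empty)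
    next
      case False
      then obtain t' where t': "t' \<in> F" "g t' = x" by blast
      have "h t' \<in> R" "h t' \<notin> E" using t'(1) F(3) by auto
      then have lt: "card {z\<in>R. near N (4 * \<rho>) (l * (z - h t'))} < s" using rich not_le by blast
      have "card {f\<in>F. g f = x} \<le> card {z\<in>R. near N (4 * \<rho>) (l * (z - h t'))}"
      proof (rule card_inj_on_le)
        show "inj_on h {f\<in>F. g f = x}" using inj F(1) unfolding inj_on_def by blast
        show "h ` {f\<in>F. g f = x} \<subseteq> {z\<in>R. near N (4 * \<rho>) (l * (z - h t'))}"
        proof (rule image_subsetI)
          fix f assume "f \<in> {f\<in>F. g f = x}"
          then have f: "f \<in> F" "g f = g t'" using t'(2) by simp_all
          then have "h f \<in> R" using F(3) by blast
          then show "h f \<in> {z\<in>R. near N (4 * \<rho>) (l * (z - h t'))}" using close[OF f(1) t'(1) f(2)] by simp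
        qed
      qed (use finR in simp)
      then show ?thesis using lt by linarith
    qed
  qed (use finR F in auto)
  define X1 X2 X3 where "X1 = {t \<in> aps N R. fst3 t \<in> B \<and> snd3 t \<in> R - E \<and> thd3 t \<in> R - E}"
    and "X2 = {t \<in> aps N R. snd3 t \<in> B \<and> fst3 t \<in> R - E \<and> thd3 t \<in> R - E}"
    and "X3 = {t \<in> aps N R. thd3 t \<in> B \<and> fst3 t \<in> R - E \<and> snd3 t \<in> R - E}"
  note X = X1_def X2_def X3_def
  have nB: "near N \<rho> (l * (x - a))" if "x \<in> B" for x using that B by simp
  have rel: "int N dvd l * (x + z - 2 * y) - l * (x' + z' - 2 * y')"
    if "(x, y, z) \<in> aps N R" "(x', y', z') \<in> aps N R" for x y z x' y' z'
    using that by (intro dvd_diff[OF dvd_mult dvd_mult]) (auto simp: aps_def)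
  have B2: "near N (2 * \<rho>) (l * (x - x'))" if "x \<in> B" "x' \<in> B" for x x'
    using near_diff[OF nB[OF that(1)] nB[OF that(2)]] by (simp add: algebra_simps)
  have X1: "card X1 \<le> s * card R"
  proof (rule poor[OF inj(3)])
    fix t t' assume h: "t \<in> X1" "t' \<in> X1" "snd3 t = snd3 t'"
    obtain x y z x' y' z' where t: "t = (x, y, z)" "t' = (x', y', z')" by (cases t, cases t') auto
    have m: "t \<in> aps N R" "t' \<in> aps N R" "x \<in> B" "x' \<in> B" "y = y'" using h t by (auto simp: X coords)
    have "int N dvd l * (z - z') - l * (x' - x)"
      using rel[OF m(1,2)[unfolded t]] m(5) by (simp add: algebra_simps)
    then have "near N (2 * \<rho>) (l * (z - z'))" using near_cong B2[OF m(4,3)] by blast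
    then show "near N (4 * \<rho>) (l * (thd3 t - thd3 t'))" using \<rho> by (auto simp: coords t elim: near_mono)
  qed (use cR in \<open>auto simp: X\<close>)
  have X3: "card X3 \<le> s * card R"
  proof (rule poor[OF inj(4)])
    fix t t' assume h: "t \<in> X3" "t' \<in> X3" "snd3 t = snd3 t'"
    obtain x y z x' y' z' where t: "t = (x, y, z)" "t' = (x', y', z')" by (cases t, cases t') auto
    have m: "t \<in> aps N R" "t' \<in> aps N R" "z \<in> B" "z' \<in> B" "y = y'" using h t by (auto simp: X coords)
    have "int N dvd l * (x - x') - l * (z' - z)"
      using rel[OF m(1,2)[unfolded t]] m(5) by (simp add: algebra_simps)
    then have "near N (2 * \<rho>) (l * (x - x'))" using near_cong B2[OF m(4,3)] by blast
    then show "near N (4 * \<rho>) (l * (fst3 t - fst3 t'))" using \<rho> by (auto simp: coords t elim: near_mono)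
  qed (use cR in \<open>auto simp: X\<close>)
  \<comment> \<open>Here the middle term lies in \<open>B\<close>: shifting it by
    \<open>2 * \<rho>\<close> shifts the free outer term by \<open>4 * \<rho>\<close>. This case
    dictates the radius in \<open>rich\<close>.\<close>
  have X2: "card X2 \<le> s * card R"
  proof (rule poor[OF inj(2)])
    fix t t' assume h: "t \<in> X2" "t' \<in> X2" "fst3 t = fst3 t'"
    obtain x y z x' y' z' where t: "t = (x, y, z)" "t' = (x', y', z')" by (cases t, cases t') auto
    have m: "t \<in> aps N R" "t' \<in> aps N R" "y \<in> B" "y' \<in> B" "x = x'" using h t by (auto simp: X coords)
    have "int N dvd l * (z - z') - (l * (y - y') + l * (y - y'))"
      using rel[OF m(1,2)[unfolded t]] m(5) by (simp add: algebra_simps)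
    then have "near N (2 * \<rho> + 2 * \<rho>) (l * (z - z'))" using near_cong near_add[OF B2 B2, OF m(3,4) m(3,4)] by blast
    then show "near N (4 * \<rho>) (l * (thd3 t - thd3 t'))" using \<rho> by (auto simp: coords t)
  qed (use cR in \<open>auto simp: X\<close>)
  \<comment> \<open>Radius \<open>6 * \<rho>\<close> under the dilation \<open>2 * l\<close> covers
    both kinds of third term: an outer one, within \<open>3 * \<rho>\<close> under \<open>l\<close>,
    and a middle one, within \<open>2 * \<rho>\<close> under \<open>2 * l\<close>.\<close>
  have arc': "x \<in> E" if x: "x \<in> R" and n: "near N (3 * \<rho>) (l * (x - a)) \<or> near N (2 * \<rho>) (2 * l * (x - a))" for x
    using n
  proof
    assume "near N (3 * \<rho>) (l * (x - a))"
    then have "near N (real 2 * (3 * \<rho>)) (int 2 * (l * (x - a)))" by (rule near_mult)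
    then show ?thesis using arc[OF x] by (simp add: mult.assoc)
  next
    assume "near N (2 * \<rho>) (2 * l * (x - a))"
    then show ?thesis using \<rho> by (intro arc[OF x]) (erule near_mono, simp)
  qed
  define W1 W2 W3 where "W1 = {t \<in> aps N R. fst3 t \<in> E - B}" and "W2 = {t \<in> aps N R. snd3 t \<in> E - B}"
    and "W3 = {t \<in> aps N R. thd3 t \<in> E - B}"
  note W = W1_def W2_def W3_def
  \<comment> \<open>Two terms in \<open>B\<close> force the third into \<open>E\<close>, that is,
    into \<open>B\<close> or \<open>E - B\<close>. So a progression that avoids \<open>E - B\<close>
    and lies in neither \<open>B\<close> nor \<open>R - B\<close> has exactly one term in
    \<open>B\<close> and two outside \<open>E\<close>.\<close>
  have cover: "aps N R \<subseteq> aps N B \<union> aps N (R - B) \<union> W1 \<union> W2 \<union> W3 \<union> X1 \<union> X2 \<union> X3"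
  proof
    fix t assume t: "t \<in> aps N R"
    obtain x y z where xyz: "t = (x, y, z)" by (cases t) auto
    have d: "int N dvd x + z - 2 * y" and R3: "x \<in> R" "y \<in> R" "z \<in> R" using t xyz by (auto simp: aps_def)
    have d': "int N dvd z + x - 2 * y" using d by (simp add: add.commute)
    have 12: "z \<in> E" if "x \<in> B" "y \<in> B"
      using near_third_term(1)[OF d nB nB, OF that] arc' R3 by blast
    have 32: "x \<in> E" if "z \<in> B" "y \<in> B"
      using near_third_term(1)[OF d' nB nB, OF that] arc' R3 by blast
    have 13: "y \<in> E" if "x \<in> B" "z \<in> B"
      using near_third_term(2)[OF d nB nB, OF that] arc' R3 by blast
    show "t \<in> aps N B \<union> aps N (R - B) \<union> W1 \<union> W2 \<union> W3 \<union> X1 \<union> X2 \<union> X3"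
      using t d R3 12 32 13 unfolding xyz W X coords aps_def by simp blast
  qed
  have fin: "finite (aps N R)" by (rule finite_aps[OF finR])
  have BR: "B \<subseteq> R" using E by blast
  have "finite (aps N B \<union> aps N (R - B) \<union> W1 \<union> W2 \<union> W3 \<union> X1 \<union> X2 \<union> X3)"
    using fin finR BR by (simp add: W X finite_aps finite_subset)
  then have "card (aps N R) \<le> card (aps N B \<union> aps N (R - B) \<union> W1 \<union> W2 \<union> W3 \<union> X1 \<union> X2 \<union> X3)"
    using cover by (rule card_mono)
  also have "\<dots> \<le> card (aps N B) + card (aps N (R - B)) + card W1 + card W2 + card W3 + card X1 + card X2 + card X3"
    by (intro order_trans[OF card_Un_le] add_mono order_refl)
  finally have "real (card (aps N R)) \<le> card (aps N B) + card (aps N (R - B)) + card W1 + card W2 + card W3 + card X1 + card X2 + card X3"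
    by (simp flip: of_nat_add)
  moreover have "card W1 \<le> s * card R" unfolding W by (rule two[OF inj(1) cR(2)])
  moreover have "card W2 \<le> s * card R" unfolding W by (rule two[OF inj(4) cR(1)])
  moreover have "card W3 \<le> s * card R" unfolding W by (rule two[OF inj(6) cR(2)])
  ultimately show ?thesis using X1 X2 X3 by linarith
qed

section \<open>Iterated merging until an arc splits off\<close>

definition arc_splits :: "real \<Rightarrow> nat \<Rightarrow> int set \<Rightarrow> real \<Rightarrow> int \<Rightarrow> real \<Rightarrow> int \<Rightarrow> real \<Rightarrow> bool" where
  "arc_splits \<delta> p R n a \<tau>0 l \<tau> \<longleftrightarrow> (\<exists>B l'. arc p (\<tau>0 * p) l a R \<subseteq> B \<and> B \<subseteq> R \<and>
     \<not> int p dvd l' \<and> (\<forall>x\<in>B. near p (\<tau> * p) (l' * (x - a))) \<and>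
     real (card (aps p R)) \<le> real (card (aps p B) + card (aps p (R - B))) + 6 * \<delta> * n\<^sup>2)"

text \<open>Each failed attempt to split yields a merged arc with more than
  \<open>\<delta> * n\<close> new elements, which can happen only about \<open>1 / \<delta>\<close>
  times. As radii grow with every merging, they are chosen backwards, from the final
  \<open>\<tau>\<close> down to \<open>\<tau>0\<close>. Errors refer to a fixed bound
  \<open>n\<close> instead of \<open>card R\<close>, so that they add up when further arcs are split
  off.\<close>

lemma split_off_arc:
  fixes \<delta> \<tau> :: real
  assumes \<delta>: "0 < \<delta>" and \<tau>: "0 < \<tau>"
  shows "\<exists>(\<tau>0::real) (p0::nat). 0 < \<tau>0 \<and> (\<forall>(p::nat) R (n::real) l a. prime p \<and> p > p0 \<and> R \<subseteq> {0..<int p} \<and> card R \<le> n \<and> 0 < n \<and> \<not> int p dvd l \<longrightarrow>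
    arc_splits \<delta> p R n a \<tau>0 l \<tau>)"
proof -
  \<comment> \<open>The induction statement: either an arc splits off, or mergings have led to an
    arc with at least \<open>j * \<delta> * n\<close> elements that still contains the original
    one.\<close>
  define P where "P = (\<lambda>(j::nat) (\<tau>::real) (\<tau>0::real) (p0::nat). (\<forall>(p::nat) R (n::real) l a. prime p \<and> p > p0 \<and> R \<subseteq> {0..<int p} \<and> card R \<le> n \<and> 0 < n \<and> \<not> int p dvd l \<longrightarrow>
     arc_splits \<delta> p R n a \<tau>0 l \<tau> \<or>
     (\<exists>l'. \<not> int p dvd l' \<and> arc p (\<tau>0 * p) l a R \<subseteq> arc p (\<tau> * p) l' a R \<and>
        j * \<delta> * n \<le> card (arc p (\<tau> * p) l' a R))))"
  have step: "\<exists>\<tau>0 p0. 0 < \<tau>0 \<and> P j \<tau> \<tau>0 p0" if "0 < \<tau>" for j :: nat and \<tau> :: real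
    using that
  proof (induction j arbitrary: \<tau>)
    case 0
    then show ?case by (intro exI[of _ \<tau>] exI[of _ 0]) (auto simp: P_def)
  next
    case (Suc j)
    define m where "m = nat \<lceil>1 / \<delta>\<rceil>"
    have m: "1 \<le> m * \<delta>"
    proof -
      have "1 / \<delta> \<le> m" unfolding m_def by linarith
      then show ?thesis using \<delta> by (simp add: field_simps)
    qed
    define M where "M = Suc (nat \<lceil>2 / \<tau>\<rceil>)"
    have M: "M > 0" "1 / M \<le> \<tau> / 2"
    proof -
      have "2 / \<tau> \<le> M" unfolding M_def by linarith
      then have "2 \<le> \<tau> * M" using Suc.prems by (simp add: pos_divide_le_eq mult.commute)
      moreover show "M > 0" by (simp add: M_def)
      ultimately show "1 / M \<le> \<tau> / 2" by (simp add: field_simps)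
    qed
    define Q where "Q = M ^ m"
    have Q: "Q \<ge> 1" using M by (simp add: Q_def)
    \<comment> \<open>Both error terms of \<open>merge_rich_translates\<close>, \<open>1 / M\<close>
      and \<open>16 * q * t\<close>, then take up at most half of \<open>\<tau>\<close>.\<close>
    define t where "t = \<tau> / (32 * Q)"
    have t: "0 < t" "t \<le> \<tau>" using Q Suc.prems by (auto simp: t_def field_simps intro: order_trans[of _ "\<tau> * 1"])
    obtain \<tau>0 p0 where IH: "0 < \<tau>0" "P j t \<tau>0 p0" using Suc.IH[OF t(1)] by blast
    show ?case
      unfolding P_def
    proof (intro exI[of _ \<tau>0] exI[of _ "max p0 (max 2 Q)"] conjI IH(1) allI impI)
      fix p R and n :: real and l a
      assume "prime p \<and> max p0 (max 2 Q) < p \<and> R \<subseteq> {0..<int p} \<and> card R \<le> n \<and> 0 < n \<and> \<not> int p dvd l"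
      then have p: "prime p" "p0 < p" "2 < p" "Q < p" and R: "R \<subseteq> {0..<int p}" "card R \<le> n" "0 < n" and l: "\<not> int p dvd l"
        by auto
      have podd: "odd p" using p prime_odd_nat by blast
      have tp: "t * p \<le> \<tau> * p" by (rule mult_right_mono[OF t(2)]) simp
      have finR: "finite R" using R finite_subset by blast
      have "arc_splits \<delta> p R n a \<tau>0 l t \<or>
        (\<exists>l'. \<not> int p dvd l' \<and> arc p (\<tau>0 * p) l a R \<subseteq> arc p (t * p) l' a R \<and>
        j * \<delta> * n \<le> card (arc p (t * p) l' a R))"
        using IH(2)[unfolded P_def, THEN spec, THEN spec, THEN spec, THEN spec, THEN spec, THEN mp] p R l by simp
      then show "arc_splits \<delta> p R n a \<tau>0 l \<tau> \<or>
        (\<exists>l'. \<not> int p dvd l' \<and> arc p (\<tau>0 * p) l a R \<subseteq> arc p (\<tau> * p) l' a R \<and>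
        Suc j * \<delta> * n \<le> card (arc p (\<tau> * p) l' a R))"
      proof
        assume "arc_splits \<delta> p R n a \<tau>0 l t"
        then obtain B l' where "arc p (\<tau>0 * p) l a R \<subseteq> B" "B \<subseteq> R" "\<not> int p dvd l'"
          and n: "\<forall>x\<in>B. near p (t * p) (l' * (x - a))"
          and "card (aps p R) \<le> card (aps p B) + card (aps p (R - B)) + 6 * \<delta> * n\<^sup>2"
          unfolding arc_splits_def by (elim exE conjE) (rule that)
        moreover have "\<forall>x\<in>B. near p (\<tau> * p) (l' * (x - a))"
          using n near_mono[OF _ tp] by blast
        ultimately have "arc_splits \<delta> p R n a \<tau>0 l \<tau>" unfolding arc_splits_def by blast
        then show ?thesis ..
      next
        assume "\<exists>l'. \<not> int p dvd l' \<and> arc p (\<tau>0 * p) l a R \<subseteq> arc p (t * p) l' a R \<and>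
          j * \<delta> * n \<le> card (arc p (t * p) l' a R)"
        then obtain l1 where l1: "\<not> int p dvd l1"
          "arc p (\<tau>0 * p) l a R \<subseteq> arc p (t * p) l1 a R"
          "j * \<delta> * n \<le> card (arc p (t * p) l1 a R)" by blast
        define \<rho> where "\<rho> = t * p"
        have \<rho>: "0 \<le> \<rho>" using t by (simp add: \<rho>_def)
        define B where "B = arc p \<rho> l1 a R"
        have "1 * n \<le> (m * \<delta>) * n" by (rule mult_right_mono) (use m R in auto)
        then have "card R \<le> m * (\<delta> * n)" using R(2) unfolding mult.assoc by linarith
        moreover have "0 < \<delta> * n" using \<delta> R by simp
        ultimately obtain q where q: "1 \<le> q" "q \<le> M ^ m"
          "\<And>u. u \<in> R \<Longrightarrow> \<delta> * n \<le> card {z\<in>R. near p (4 * \<rho>) (l1 * (z - u))} \<Longrightarrow>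
            near p (p / M + 16 * real q * \<rho>) (int q * (2 * l1 * (u - a)))"
          using merge_rich_translates[OF finR _ _ _ M(1) \<rho>, of m "\<delta> * n" p l1 a] p(3) by auto
        define l2 where "l2 = int q * (2 * l1)"
        have qQ: "q \<le> Q" using q by (simp add: Q_def)
        have l2: "\<not> int p dvd l2"
        proof -
          have "\<not> p dvd q" using qQ p(4) q(1) by (auto dest: dvd_imp_le)
          moreover have "\<not> int p dvd 2" using p(3) zdvd_imp_le[of "int p" 2] by linarith
          ultimately show ?thesis using l1(1) p(1) unfolding l2_def
            by (simp add: prime_dvd_mult_iff)
        qed
        define E where "E = arc p (\<tau> * p) l2 a R"
        have bound: "p / M + 16 * real q * \<rho> \<le> \<tau> * p"
        proof -
          have "16 * real q * \<rho> \<le> 16 * real Q * \<rho>" using qQ \<rho> by (intro mult_right_mono) auto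
          also have "\<dots> = \<tau> * p / 2" using Q by (simp add: \<rho>_def t_def)
          finally have "16 * real q * \<rho> \<le> \<tau> * p / 2" .
          moreover have "p * (1 / M) \<le> p * (\<tau> / 2)" by (rule mult_left_mono[OF M(2)]) simp
          then have "p / M \<le> \<tau> * p / 2" by (simp add: mult.commute)
          ultimately show ?thesis by linarith
        qed
        have bound6: "6 * real q * \<rho> \<le> \<tau> * p"
        proof -
          have "6 * (q * \<rho>) \<le> 16 * (q * \<rho>)" using \<rho> by (intro mult_right_mono) auto
          moreover have "0 \<le> p / M" by simp
          ultimately show ?thesis using bound by linarith
        qed
        have arcE: "x \<in> E" if "x \<in> R" "near p (6 * \<rho>) (2 * l1 * (x - a))" for x
        proof -
          have "near p (q * (6 * \<rho>)) (int q * (2 * l1 * (x - a)))" by (rule near_mult) fact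
          then have "near p (\<tau> * p) (l2 * (x - a))" using bound6 by (auto simp: l2_def mult_ac elim!: near_mono)
          then show ?thesis using that by (simp add: E_def)
        qed
        have BE: "B \<subseteq> E"
        proof
          fix x assume x: "x \<in> B"
          then have "near p (real 2 * \<rho>) (int 2 * (l1 * (x - a)))" by (intro near_mult) (simp add: B_def)
          then have "near p (6 * \<rho>) (2 * l1 * (x - a))" using \<rho> by (auto simp: mult_ac elim!: near_mono)
          then show "x \<in> E" using arcE x by (simp add: B_def)
        qed
        have ER: "E \<subseteq> R" by (auto simp: E_def)
        then have finE: "finite E" using finR finite_subset by blast
        have richE: "u \<in> E" if "u \<in> R" "\<delta> * n \<le> card {z\<in>R. near p (4 * \<rho>) (l1 * (z - u))}" for u
        proof -
          have "near p (\<tau> * p) (int q * (2 * l1 * (u - a)))" by (rule near_mono[OF q(3)[OF that] bound])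
          then show ?thesis using that by (simp add: E_def l2_def mult_ac)
        qed
        show ?thesis
        \<comment> \<open>With few elements in \<open>E - B\<close> the arc \<open>B\<close> can be
          split off; otherwise \<open>E\<close> is the next, richer arc.\<close>
        proof (cases "card (E - B) \<le> \<delta> * n")
          case True
          have "card (aps p R) \<le> card (aps p B) + card (aps p (R - B)) + 6 * (\<delta> * n) * card R"
            by (rule card_aps_split[OF podd R(1) _ B_def \<rho> BE ER True arcE richE]) (use \<delta> R in auto)
          also have "\<dots> \<le> card (aps p B) + card (aps p (R - B)) + 6 * (\<delta> * n) * n"
            by (intro add_left_mono mult_left_mono R) (use \<delta> R in auto)
          finally have "card (aps p R) \<le> card (aps p B) + card (aps p (R - B)) + 6 * \<delta> * n\<^sup>2"
            by (simp add: power2_eq_square mult.assoc)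
          moreover have "arc p (\<tau>0 * p) l a R \<subseteq> B" using l1(2) by (simp add: B_def \<rho>_def)
          moreover have "\<forall>x\<in>B. near p (\<tau> * p) (l1 * (x - a))"
            using near_mono[OF _ tp] by (simp add: B_def \<rho>_def)
          moreover have "B \<subseteq> R" by (auto simp: B_def)
          ultimately have "arc_splits \<delta> p R n a \<tau>0 l \<tau>" using l1(1) unfolding arc_splits_def by blast
          then show ?thesis ..
        next
          case False
          have "card (E - B) = real (card E) - card B"
            using card_Diff_subset[OF finite_subset[OF BE finE] BE] card_mono[OF finE BE] by simp
          then have "real (Suc j) * \<delta> * n \<le> card E"
            using False l1(3) by (simp add: B_def \<rho>_def algebra_simps)
          moreover have "arc p (\<tau>0 * p) l a R \<subseteq> E" using l1(2) BE by (auto simp: B_def \<rho>_def)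
          ultimately show ?thesis using l2 unfolding E_def by blast
        qed
      qed
    qed
  qed
  define j where "j = Suc (nat \<lceil>1 / \<delta>\<rceil>)"
  have j: "1 < j * \<delta>"
  proof -
    have "1 / \<delta> < j" unfolding j_def by linarith
    then show ?thesis using \<delta> by (simp add: field_simps)
  qed
  obtain \<tau>0 p0 where st: "0 < \<tau>0" "P j \<tau> \<tau>0 p0" using step[OF \<tau>, of j] by blast
  show ?thesis
  proof (intro exI[of _ \<tau>0] exI[of _ p0] conjI st(1) allI impI)
    fix p R and n :: real and l a
    assume "prime p \<and> p0 < p \<and> R \<subseteq> {0..<int p} \<and> card R \<le> n \<and> 0 < n \<and> \<not> int p dvd l"
    then have h: "prime p" "p0 < p" "R \<subseteq> {0..<int p}" "card R \<le> n" "0 < n" "\<not> int p dvd l" by auto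
    have finR: "finite R" using h(3) finite_subset by blast
    have "\<not> j * \<delta> * n \<le> card (arc p (\<tau> * p) l' a R)" for l'
    proof -
      have "card (arc p (\<tau> * p) l' a R) \<le> card R" by (rule card_mono) (use finR in auto)
      then have "card (arc p (\<tau> * p) l' a R) \<le> n" using h(4) by linarith
      moreover have "1 * n < j * \<delta> * n" by (rule mult_strict_right_mono[OF j h(5)])
      ultimately show ?thesis by linarith
    qed
    then have "arc_splits \<delta> p R n a \<tau>0 l \<tau>" using st(2) h unfolding P_def by blast
    then show "arc_splits \<delta> p R n a \<tau>0 l \<tau>" .
  qed
qed

section \<open>Sets of integers\<close>

lemma aps_0: "aps 0 A = {(x, y, z). x \<in> A \<and> y \<in> A \<and> z \<in> A \<and> x + z = 2 * y}"
  by (auto simp: aps_def)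

text \<open>The shorter side need not be named: reflection is injective, so a side that is reflected
  into \<open>A\<close> has at most as many elements as the other one.\<close>

definition reflecting :: "int set \<Rightarrow> int \<Rightarrow> bool" where
  "reflecting A y \<longleftrightarrow> (\<forall>x\<in>A. x < y \<longrightarrow> 2 * y - x \<in> A) \<or> (\<forall>x\<in>A. y < x \<longrightarrow> 2 * y - x \<in> A)"

lemma card_reflections:
  assumes "finite A" "y \<in> A"
  defines "b \<equiv> card {x\<in>A. x < y}" and "a \<equiv> card {x\<in>A. y < x}"
  shows "card {x\<in>A. 2 * y - x \<in> A} \<le> 1 + 2 * min b a"
    and "card {x\<in>A. 2 * y - x \<in> A} = 1 + 2 * min b a \<longleftrightarrow> reflecting A y"
    and "reflecting A y \<Longrightarrow> b \<le> a \<Longrightarrow> x \<in> A \<Longrightarrow> x < y \<Longrightarrow> 2 * y - x \<in> A"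
    and "reflecting A y \<Longrightarrow> a \<le> b \<Longrightarrow> x \<in> A \<Longrightarrow> y < x \<Longrightarrow> 2 * y - x \<in> A"
proof -
  define L where "L = {x\<in>A. x < y \<and> 2 * y - x \<in> A}"
  define U where "U = {x\<in>A. y < x \<and> 2 * y - x \<in> A}"
  have fin: "finite L" "finite U" using assms by (auto simp: L_def U_def)
  have "U = (\<lambda>x. 2 * y - x) ` L"
  proof (intro equalityI subsetI)
    fix x assume "x \<in> U"
    then show "x \<in> (\<lambda>x. 2 * y - x) ` L" by (intro rev_image_eqI[of "2 * y - x"]) (auto simp: L_def U_def)
  qed (auto simp: L_def U_def)
  then have UL: "card U = card L" by (simp add: card_image inj_on_def)
  have "{x\<in>A. 2 * y - x \<in> A} = insert y (L \<union> U)" using assms by (auto simp: L_def U_def)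
  moreover have "y \<notin> L \<union> U" "L \<inter> U = {}" by (auto simp: L_def U_def)
  ultimately have r: "card {x\<in>A. 2 * y - x \<in> A} = 1 + 2 * card L"
    using fin UL by (simp add: card_Un_disjoint)
  have Lb: "card L \<le> b" unfolding b_def L_def by (rule card_mono) (use assms in auto)
  have Ua: "card U \<le> a" unfolding a_def U_def by (rule card_mono) (use assms in auto)
  show "card {x\<in>A. 2 * y - x \<in> A} \<le> 1 + 2 * min b a" using r Lb Ua UL by simp
  have Lfull: "card L = b \<longleftrightarrow> (\<forall>x\<in>A. x < y \<longrightarrow> 2 * y - x \<in> A)"
  proof
    assume "card L = b"
    then have "L = {x\<in>A. x < y}" unfolding b_def L_def by (intro card_subset_eq) (use assms in auto)
    then show "\<forall>x\<in>A. x < y \<longrightarrow> 2 * y - x \<in> A" by (auto simp: L_def)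
  next
    assume "\<forall>x\<in>A. x < y \<longrightarrow> 2 * y - x \<in> A"
    then have "L = {x\<in>A. x < y}" by (auto simp: L_def)
    then show "card L = b" by (simp add: b_def)
  qed
  have Ufull: "card U = a \<longleftrightarrow> (\<forall>x\<in>A. y < x \<longrightarrow> 2 * y - x \<in> A)"
  proof
    assume "card U = a"
    then have "U = {x\<in>A. y < x}" unfolding a_def U_def by (intro card_subset_eq) (use assms in auto)
    then show "\<forall>x\<in>A. y < x \<longrightarrow> 2 * y - x \<in> A" by (auto simp: U_def)
  next
    assume "\<forall>x\<in>A. y < x \<longrightarrow> 2 * y - x \<in> A"
    then have "U = {x\<in>A. y < x}" by (auto simp: U_def)
    then show "card U = a" by (simp add: a_def)
  qed
  have refl: "reflecting A y \<longleftrightarrow> card L = b \<or> card U = a" unfolding reflecting_def Lfull Ufull ..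
  show "card {x\<in>A. 2 * y - x \<in> A} = 1 + 2 * min b a \<longleftrightarrow> reflecting A y"
    unfolding r refl using Lb Ua UL by auto
  show "2 * y - x \<in> A" if "reflecting A y" "b \<le> a" "x \<in> A" "x < y"
    using that Lb Ua UL Lfull unfolding refl by auto
  show "2 * y - x \<in> A" if "reflecting A y" "a \<le> b" "x \<in> A" "y < x"
    using that Lb Ua UL Ufull unfolding refl by auto
qed

lemma bij_betw_rank:
  fixes A :: "int set"
  assumes "finite A"
  shows "bij_betw (\<lambda>y. card {x\<in>A. x < y}) A {..<card A}"
proof -
  have mono: "card {x\<in>A. x < y} < card {x\<in>A. x < z}" if "y \<in> A" "y < z" for y z
    by (rule psubset_card_mono) (use assms that in auto)
  have inj: "inj_on (\<lambda>y. card {x\<in>A. x < y}) A"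
  proof (rule inj_onI)
    fix y z assume "y \<in> A" "z \<in> A" "card {x\<in>A. x < y} = card {x\<in>A. x < z}"
    then show "y = z" using mono[of y z] mono[of z y] by (cases y z rule: linorder_cases) auto
  qed
  have sub: "(\<lambda>y. card {x\<in>A. x < y}) ` A \<subseteq> {..<card A}"
    using assms by (auto intro!: psubset_card_mono)
  have "(\<lambda>y. card {x\<in>A. x < y}) ` A = {..<card A}"
    by (rule card_subset_eq[OF _ sub]) (simp_all add: card_image[OF inj])
  then show ?thesis using inj by (simp add: bij_betw_def)
qed

lemma card_above:
  fixes A :: "int set"
  assumes "finite A" "y \<in> A"
  shows "card A = Suc (card {x\<in>A. x < y} + card {x\<in>A. y < x})"
proof -
  have "A = insert y ({x\<in>A. x < y} \<union> {x\<in>A. y < x})" using assms by auto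
  then have "card A = card (insert y ({x\<in>A. x < y} \<union> {x\<in>A. y < x}))" by simp
  also have "\<dots> = Suc (card ({x\<in>A. x < y} \<union> {x\<in>A. y < x}))" using assms by (intro card_insert_disjoint) auto
  also have "card ({x\<in>A. x < y} \<union> {x\<in>A. y < x}) = card {x\<in>A. x < y} + card {x\<in>A. y < x}"
    using assms by (intro card_Un_disjoint) auto
  finally show ?thesis .
qed

text \<open>Induction in steps of two: the two extreme ranks contribute 1 each, and every inner term
  grows by 2. The right side is the ceiling of \<open>n\<^sup>2 / 2\<close>.\<close>

lemma sum_min_ranks: "(\<Sum>i<n. 1 + 2 * min i (n - 1 - i)) = (n\<^sup>2 + 1) div 2" for n :: nat
proof (induction n rule: induct_nat_012)
  case (ge2 n)
  have "(\<Sum>i<Suc (Suc n). 1 + 2 * min i (Suc (Suc n) - 1 - i)) = 2 + (\<Sum>i<n. 1 + 2 * min (Suc i) (Suc n - Suc i))"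
    by (subst sum.lessThan_Suc, subst sum.lessThan_Suc_shift) simp
  also have "(\<Sum>i<n. 1 + 2 * min (Suc i) (Suc n - Suc i)) = (\<Sum>i<n. (1 + 2 * min i (n - 1 - i)) + 2)"
    by (rule sum.cong) (auto simp: min_def)
  also have "\<dots> = (\<Sum>i<n. 1 + 2 * min i (n - 1 - i)) + 2 * n" by (subst sum.distrib) simp
  also have "\<dots> = (n\<^sup>2 + 1) div 2 + 2 * n" by (simp only: ge2(1))
  also have "2 + \<dots> = ((Suc (Suc n))\<^sup>2 + 1) div 2" by (simp add: power2_eq_square)
  finally show ?case .
qed auto

lemma card_aps_int:
  fixes A :: "int set"
  assumes A: "finite A"
  shows "card (aps 0 A) \<le> ((card A)\<^sup>2 + 1) div 2"
    and "card (aps 0 A) = ((card A)\<^sup>2 + 1) div 2 \<longleftrightarrow> (\<forall>y\<in>A. reflecting A y)"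
proof -
  define g where "g = (\<lambda>y. 1 + 2 * min (card {x\<in>A. x < y}) (card {x\<in>A. y < x}))"
  have "card (aps 0 A) = card {(y, x). y \<in> A \<and> x \<in> A \<and> 2 * y - x \<in> A}"
  proof (rule bij_betw_same_card)
    have aps: "aps 0 A = {(x, y, z). x \<in> A \<and> y \<in> A \<and> z \<in> A \<and> z = 2 * y - x}"
      by (auto simp: aps_0)
    show "bij_betw (\<lambda>(x, y, z). (y, x)) (aps 0 A) {(y, x). y \<in> A \<and> x \<in> A \<and> 2 * y - x \<in> A}"
      by (rule bij_betw_byWitness[where f' = "\<lambda>(y, x). (x, y, 2 * y - x)"]) (auto simp: aps)
  qed
  also have "\<dots> = (\<Sum>y\<in>A. card {x\<in>A. 2 * y - x \<in> A})"
    by (rule sum_card_eq_card_pairs[symmetric]) (use A in auto)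
  finally have T: "card (aps 0 A) = (\<Sum>y\<in>A. card {x\<in>A. 2 * y - x \<in> A})" .
  have "(\<Sum>y\<in>A. g y) = (\<Sum>y\<in>A. 1 + 2 * min (card {x\<in>A. x < y}) (card A - 1 - card {x\<in>A. x < y}))"
    using card_above[OF A] by (intro sum.cong) (auto simp: g_def)
  also have "\<dots> = (\<Sum>i<card A. 1 + 2 * min i (card A - 1 - i))"
    by (rule sum.reindex_bij_betw[OF bij_betw_rank[OF A]])
  finally have G: "(\<Sum>y\<in>A. g y) = ((card A)\<^sup>2 + 1) div 2" using sum_min_ranks by simp
  have le: "card {x\<in>A. 2 * y - x \<in> A} \<le> g y" if "y \<in> A" for y
    unfolding g_def by (rule card_reflections(1)[OF A that])
  show "card (aps 0 A) \<le> ((card A)\<^sup>2 + 1) div 2"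
    unfolding T G[symmetric] by (rule sum_mono) (rule le)
  have "card (aps 0 A) = ((card A)\<^sup>2 + 1) div 2 \<longleftrightarrow> (\<forall>y\<in>A. card {x\<in>A. 2 * y - x \<in> A} = g y)"
  proof
    assume e: "card (aps 0 A) = ((card A)\<^sup>2 + 1) div 2"
    show "\<forall>y\<in>A. card {x\<in>A. 2 * y - x \<in> A} = g y"
      using sum_mono_inv[OF e[unfolded T G[symmetric]] le _ A] by blast
  next
    assume "\<forall>y\<in>A. card {x\<in>A. 2 * y - x \<in> A} = g y"
    then show "card (aps 0 A) = ((card A)\<^sup>2 + 1) div 2" unfolding T G[symmetric] by (intro sum.cong) auto
  qed
  then show "card (aps 0 A) = ((card A)\<^sup>2 + 1) div 2 \<longleftrightarrow> (\<forall>y\<in>A. reflecting A y)"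
    using card_reflections(2)[OF A] by (simp add: g_def)
qed

section \<open>The sets E and F attain the bound\<close>

lemma E_set_eq: "E_set k m = {x. \<bar>x\<bar> \<le> int k \<or> \<bar>x\<bar> \<le> int k + 2 * int m \<and> even (x - int k)}"
proof (intro equalityI subsetI)
  fix x assume "x \<in> E_set k m"
  then show "x \<in> {x. \<bar>x\<bar> \<le> int k \<or> \<bar>x\<bar> \<le> int k + 2 * int m \<and> even (x - int k)}"
    by (auto simp: E_set_def)
next
  fix x assume x: "x \<in> {x. \<bar>x\<bar> \<le> int k \<or> \<bar>x\<bar> \<le> int k + 2 * int m \<and> even (x - int k)}"
  show "x \<in> E_set k m"
  proof (cases "\<bar>x\<bar> \<le> int k")
    case False
    define j where "j = nat ((\<bar>x\<bar> - int k) div 2)"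
    have "even (\<bar>x\<bar> - int k)" using x False by auto
    then have j: "\<bar>x\<bar> = int k + 2 * int j" using False by (auto simp: j_def)
    then have "1 \<le> j" "j \<le> m" using x False by auto
    then have "x \<in> {int k + 2 * int j | j. 1 \<le> j \<and> j \<le> m} \<or> x \<in> {- (int k + 2 * int j) | j. 1 \<le> j \<and> j \<le> m}"
    proof (cases "x \<ge> 0")
      case True
      then have "x = int k + 2 * int j" using j by simp
      then show ?thesis using \<open>1 \<le> j\<close> \<open>j \<le> m\<close> by blast
    next
      case False
      then have "x = - (int k + 2 * int j)" using j by simp
      then show ?thesis using \<open>1 \<le> j\<close> \<open>j \<le> m\<close> by blast
    qed
    then show ?thesis unfolding E_set_def by auto
  qed (auto simp: E_set_def)
qed

lemma F_set_Suc_eq: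
  "F_set k (Suc m) = {x. \<bar>x\<bar> \<le> int k \<or> - (int k + 2 * int m) \<le> x \<and> x \<le> int k + 2 * int m + 2 \<and> even (x - int k)}"
proof (intro equalityI subsetI)
  fix x assume "x \<in> F_set k (Suc m)"
  then show "x \<in> {x. \<bar>x\<bar> \<le> int k \<or> - (int k + 2 * int m) \<le> x \<and> x \<le> int k + 2 * int m + 2 \<and> even (x - int k)}"
    by (auto simp: F_set_def)
next
  fix x assume x: "x \<in> {x. \<bar>x\<bar> \<le> int k \<or> - (int k + 2 * int m) \<le> x \<and> x \<le> int k + 2 * int m + 2 \<and> even (x - int k)}"
  show "x \<in> F_set k (Suc m)"
  proof (cases "\<bar>x\<bar> \<le> int k")
    case False
    define j where "j = nat ((\<bar>x\<bar> - int k) div 2)"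
    have "even (\<bar>x\<bar> - int k)" using x False by auto
    then have j: "\<bar>x\<bar> = int k + 2 * int j" using False by (auto simp: j_def)
    then have "1 \<le> j" "j \<le> Suc m" "x < 0 \<longrightarrow> j \<le> m" using x False by auto
    then have "x \<in> {int k + 2 * int j | j. 1 \<le> j \<and> j \<le> Suc m} \<or> x \<in> {- (int k + 2 * int j) | j. 1 \<le> j \<and> j \<le> Suc m - 1}"
    proof (cases "x \<ge> 0")
      case True
      then have "x = int k + 2 * int j" using j by simp
      then show ?thesis using \<open>1 \<le> j\<close> \<open>j \<le> Suc m\<close> by blast
    next
      case False
      then have "x = - (int k + 2 * int j)" using j by simp
      then show ?thesis using \<open>1 \<le> j\<close> \<open>x < 0 \<longrightarrow> j \<le> m\<close> False by auto
    qed
    then show ?thesis unfolding F_set_def by auto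
  qed (auto simp: F_set_def)
qed

lemma F_set_0: "F_set k 0 = E_set k 0"
  by (auto simp: F_set_def E_set_def)

lemma even_reflection: "even (2 * y - x - c) \<longleftrightarrow> even (x - c)" for c x y :: int
  by presburger

text \<open>Reflecting the outer side of \<open>y\<close> does not increase absolute values and
  preserves the parity relative to \<open>k\<close>, and these two data decide membership.\<close>

lemma reflecting_E_set:
  assumes "y \<in> E_set k m" shows "reflecting (E_set k m) y"
proof (cases "y \<ge> 0")
  case True
  have "2 * y - x \<in> E_set k m" if "x \<in> E_set k m" "y < x" for x
  proof -
    have "\<bar>2 * y - x\<bar> \<le> \<bar>x\<bar>" using True that(2) by arith
    then show ?thesis using that(1) even_reflection[of y x "int k"] unfolding E_set_eq mem_Collect_eq by (meson order_trans)
  qed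
  then show ?thesis by (simp add: reflecting_def)
next
  case False
  have "2 * y - x \<in> E_set k m" if "x \<in> E_set k m" "x < y" for x
  proof -
    have "\<bar>2 * y - x\<bar> \<le> \<bar>x\<bar>" using False that(2) by arith
    then show ?thesis using that(1) even_reflection[of y x "int k"] unfolding E_set_eq mem_Collect_eq by (meson order_trans)
  qed
  then show ?thesis by (simp add: reflecting_def)
qed

lemma reflecting_F_set:
  assumes "y \<in> F_set k m" shows "reflecting (F_set k m) y"
proof (cases m)
  case 0
  then show ?thesis using assms by (simp add: F_set_0 reflecting_E_set)
next
  case (Suc m')
  show ?thesis
  \<comment> \<open>The arms have unequal length and the midpoint of the whole range is 1: the
    longer arm ends at \<open>k + 2 * m' + 2\<close>, and its end is reflected to
    \<open>- (k + 2 * m')\<close> or above exactly if \<open>y \<ge> 1\<close>.\<close>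
  proof (cases "y \<ge> 1")
    case True
    have "2 * y - x \<in> F_set k m" if x: "x \<in> F_set k m" "y < x" for x
      using x(1) unfolding Suc F_set_Suc_eq mem_Collect_eq even_reflection
    proof (elim disjE)
      assume "\<bar>x\<bar> \<le> int k"
      then have "\<bar>2 * y - x\<bar> \<le> int k" using True x(2) by arith
      then show "\<bar>2 * y - x\<bar> \<le> int k \<or> - (int k + 2 * int m') \<le> 2 * y - x \<and>
        2 * y - x \<le> int k + 2 * int m' + 2 \<and> even (x - int k)" ..
    qed (use True x(2) in auto)
    then show ?thesis by (simp add: reflecting_def)
  next
    case False
    have "2 * y - x \<in> F_set k m" if x: "x \<in> F_set k m" "x < y" for x
      using x(1) unfolding Suc F_set_Suc_eq mem_Collect_eq even_reflection
    proof (elim disjE)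
      assume "\<bar>x\<bar> \<le> int k"
      then have "\<bar>2 * y - x\<bar> \<le> int k" using False x(2) by arith
      then show "\<bar>2 * y - x\<bar> \<le> int k \<or> - (int k + 2 * int m') \<le> 2 * y - x \<and>
        2 * y - x \<le> int k + 2 * int m' + 2 \<and> even (x - int k)" ..
    qed (use False x(2) in auto)
    then show ?thesis by (simp add: reflecting_def)
  qed
qed

section \<open>Symmetric sets grown outwards from their centre\<close>

definition pos_part :: "nat \<Rightarrow> nat \<Rightarrow> int set" where
  "pos_part k m = {s. 1 \<le> s \<and> (s \<le> int k \<or> s \<le> int k + 2 * int m \<and> even (s - int k))}"

definition symmetrize :: "int set \<Rightarrow> int set" where
  "symmetrize P = P \<union> {0} \<union> uminus ` P"

lemma mem_symmetrize: "x \<in> symmetrize P \<longleftrightarrow> x \<in> P \<or> x = 0 \<or> - x \<in> P"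
  by (auto simp: symmetrize_def intro: rev_image_eqI[of "- x"])

lemma symmetrize_mult: "symmetrize ((*) d ` P) = (*) d ` symmetrize P"
  by (auto simp: symmetrize_def image_Un image_image)

lemma E_set_eq_symmetrize: "1 \<le> k \<Longrightarrow> E_set k m = symmetrize (pos_part k m)"
  by (auto simp: set_eq_iff E_set_eq mem_symmetrize pos_part_def)

lemma F_set_eq_symmetrize:
  assumes "1 \<le> k"
  shows "F_set k (Suc m) = insert (int k + 2 * int m + 2) (symmetrize (pos_part k m))"
proof -
  have "x \<in> F_set k (Suc m) \<longleftrightarrow> x = int k + 2 * int m + 2 \<or> x \<in> E_set k m" for x
  proof (cases "x \<le> int k + 2 * int m")
    case True
    then show ?thesis unfolding F_set_Suc_eq E_set_eq mem_Collect_eq abs_le_iff by linarith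
  next
    case False
    have "x = c + 2" if "\<not> x \<le> c" "x \<le> c + 2" "even (x - c)" for c using that by presburger
    from this[OF False] False show ?thesis unfolding F_set_Suc_eq E_set_eq mem_Collect_eq abs_le_iff by auto
  qed
  then show ?thesis unfolding E_set_eq_symmetrize[OF assms, symmetric] by blast
qed

text \<open>Reflecting \<open>b\<close> in the smallest element \<open>d\<close> shows that
  \<open>b\<close> is a multiple of \<open>d\<close>, at most two steps beyond the largest element
  so far. For \<open>m > 0\<close> a single step is excluded, since its reflection
  \<open>- d * (k + 2 * m - 1)\<close> falls into a gap.\<close>

lemma next_element:
  assumes k: "1 \<le> k" and d: "0 < d" and b: "\<And>a. a \<in> (*) d ` pos_part k m \<Longrightarrow> a < b"
    and refl: "\<And>a. a \<in> (*) d ` pos_part k m \<Longrightarrow> 2 * a - b \<in> symmetrize ((*) d ` pos_part k m)"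
  shows "m = 0 \<and> b = d * (int k + 1) \<or> b = d * (int k + 2 * int m + 2)"
proof -
  have 1: "1 \<in> pos_part k m" and M: "int k + 2 * int m \<in> pos_part k m" using k by (auto simp: pos_part_def)
  have "d * 1 \<in> (*) d ` pos_part k m" using 1 by (rule imageI)
  then have "2 * (d * 1) - b \<in> symmetrize ((*) d ` pos_part k m)" by (rule refl)
  then obtain e where e: "e \<in> symmetrize (pos_part k m)" "2 * (d * 1) - b = d * e"
    unfolding symmetrize_mult by (rule imageE)
  then have e2: "b = d * (2 - e)" by (simp add: algebra_simps)
  have "d * (int k + 2 * int m) < d * (2 - e)" using b[OF imageI[OF M]] e2 by simp
  then have "int k + 2 * int m < 2 - e" using d by simp
  moreover have "- e \<le> int k + 2 * int m" using e(1) by (auto simp: mem_symmetrize pos_part_def)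
  ultimately have "2 - e = int k + 2 * int m + 1 \<or> 2 - e = int k + 2 * int m + 2" by linarith
  moreover have "m = 0" if "2 - e = int k + 2 * int m + 1"
  proof (rule ccontr)
    assume "m \<noteq> 0"
    have e': "e = 1 - int k - 2 * int m" using that by simp
    show False using e(1) k \<open>m \<noteq> 0\<close> unfolding e' by (auto simp: mem_symmetrize pos_part_def)
  qed
  ultimately show ?thesis using e2 by auto
qed

lemma pos_part_Suc:
  "pos_part (Suc k) 0 = insert (int k + 1) (pos_part k 0)"
  "pos_part k (Suc m) = insert (int k + 2 * int m + 2) (pos_part k m)"
proof -
  show "pos_part (Suc k) 0 = insert (int k + 1) (pos_part k 0)" by (auto simp: pos_part_def)
  have "x \<in> pos_part k (Suc m) \<longleftrightarrow> x = int k + 2 * int m + 2 \<or> x \<in> pos_part k m" for x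
  proof (cases "x \<le> int k + 2 * int m")
    case True
    then show ?thesis unfolding pos_part_def mem_Collect_eq by auto
  next
    case False
    show ?thesis
    proof
      assume "x \<in> pos_part k (Suc m)"
      then have "x \<le> int k + 2 * int m + 2" "even (x - int k)" using False by (auto simp: pos_part_def)
      then have "x = int k + 2 * int m + 2" using False by presburger
      then show "x = int k + 2 * int m + 2 \<or> x \<in> pos_part k m" ..
    next
      assume "x = int k + 2 * int m + 2 \<or> x \<in> pos_part k m"
      then have "x = int k + 2 * int m + 2" using False by (auto simp: pos_part_def)
      then show "x \<in> pos_part k (Suc m)" by (simp add: pos_part_def)
    qed
  qed
  then show "pos_part k (Suc m) = insert (int k + 2 * int m + 2) (pos_part k m)" by blast
qed

lemma reflecting_positive_part:
  fixes P :: "int set"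
  assumes "finite P" "\<And>a. a \<in> P \<Longrightarrow> 0 < a"
    and "\<And>a b. a \<in> P \<Longrightarrow> b \<in> P \<Longrightarrow> a < b \<Longrightarrow> 2 * a - b \<in> symmetrize P"
  shows "P = {} \<or> (\<exists>d>0. \<exists>k m. 1 \<le> k \<and> P = (*) d ` pos_part k m)"
  using assms
proof (induction "card P" arbitrary: P)
  case 0
  then show ?case by auto
next
  case (Suc n)
  define b where "b = Max P"
  define P' where "P' = P - {b}"
  have ne: "P \<noteq> {}" using Suc(2) by auto
  have b: "b \<in> P" "\<And>a. a \<in> P \<Longrightarrow> a \<le> b" using Max_in[OF Suc.prems(1) ne] Max_ge[OF Suc.prems(1)] by (auto simp: b_def)
  have P: "P = insert b P'" using b by (auto simp: P'_def)
  have lt: "a < b" if "a \<in> P'" for a using b(2)[of a] that by (auto simp: P'_def)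
  \<comment> \<open>The reflection is below \<open>a\<close> and above \<open>- c\<close>, so
    neither it nor its negative is the maximum \<open>b\<close>, and it survives the removal of
    \<open>b\<close>.\<close>
  have refl: "2 * a - c \<in> symmetrize P'" if "a \<in> P'" "c \<in> P" "a < c" for a c
  proof -
    have "0 < a" "c \<le> b" "2 * a - c \<in> symmetrize P" using that Suc.prems b by (auto simp: P'_def)
    then show ?thesis using lt[OF that(1)] that(3) by (auto simp: P mem_symmetrize)
  qed
  have "P' = {} \<or> (\<exists>d>0. \<exists>k m. 1 \<le> k \<and> P' = (*) d ` pos_part k m)"
  proof (rule Suc.hyps(1))
    show "n = card P'" using Suc(2) b Suc.prems(1) by (simp add: P'_def)
  qed (use Suc.prems refl in \<open>auto simp: P'_def\<close>)
  then show ?case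
  proof
    assume "P' = {}"
    then have "P = (*) b ` pos_part 1 0" by (auto simp: P pos_part_def image_iff intro!: exI[of _ 1])
    then show ?thesis using Suc.prems(2)[OF b(1)] by (intro disjI2 exI[of _ b] conjI exI[of _ 1] exI[of _ 0]) auto
  next
    assume "\<exists>d>0. \<exists>k m. 1 \<le> k \<and> P' = (*) d ` pos_part k m"
    then obtain d k m where d: "0 < d" "1 \<le> k" "P' = (*) d ` pos_part k m" by blast
    have "m = 0 \<and> b = d * (int k + 1) \<or> b = d * (int k + 2 * int m + 2)"
      by (rule next_element[OF d(2,1)]) (use lt refl b(1) in \<open>auto simp flip: d(3)\<close>)
    then have "P = (*) d ` pos_part (Suc k) 0 \<or> P = (*) d ` pos_part k (Suc m)"
      unfolding P d(3) pos_part_Suc by auto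
    then show ?thesis using d(1,2) by (metis le_SucI)
  qed
qed

text \<open>The factor 2 allows half-integral dilations: an interval with an even number of elements is half of
  some \<^term>\<open>F_set 0 m\<close>.\<close>

definition affine_copy :: "int set \<Rightarrow> int set \<Rightarrow> bool" where
  "affine_copy A S \<longleftrightarrow> (\<exists>d t. d \<noteq> 0 \<and> (\<lambda>x. 2 * x) ` A = (\<lambda>s. d * s + t) ` S)"

section \<open>Classification of the extremal sets of integers\<close>

lemma affine_copyI: "d \<noteq> 0 \<Longrightarrow> A = (\<lambda>x. c + x) ` ((*) d ` S) \<Longrightarrow> affine_copy A S"
  unfolding affine_copy_def by (rule exI[of _ "2 * d"], rule exI[of _ "2 * c"]) (auto simp: image_image algebra_simps)

lemma affine_copy_uminus: "affine_copy (uminus ` A) S \<Longrightarrow> affine_copy A S"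
proof -
  assume "affine_copy (uminus ` A) S"
  then obtain d t where d: "d \<noteq> 0" "(\<lambda>x. 2 * x) ` uminus ` A = (\<lambda>s. d * s + t) ` S" unfolding affine_copy_def by blast
  have "(\<lambda>x. 2 * x) ` A = uminus ` (\<lambda>x. 2 * x) ` uminus ` A" by (simp add: image_image)
  also have "\<dots> = (\<lambda>s. (- d) * s + (- t)) ` S" unfolding d(2) by (simp add: image_image)
  finally show ?thesis using d(1) unfolding affine_copy_def by (metis neg_equal_0_iff_equal)
qed

text \<open>The median has equally many elements on both sides, so reflection in it preserves
  \<open>A\<close>. For elements above the median the upper side is the shorter one, which is what
  \<open>reflecting_positive_part\<close> requires.\<close>

lemma reflecting_odd:
  assumes A: "finite A" "\<And>y. y \<in> A \<Longrightarrow> reflecting A y"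
    and c: "c \<in> A" "card {x\<in>A. x < c} = card {x\<in>A. c < x}"
  shows "\<exists>k m. affine_copy A (E_set k m)"
proof -
  define P where "P = (\<lambda>x. x - c) ` {x\<in>A. c < x}"
  have memP: "a \<in> P \<longleftrightarrow> 0 < a \<and> c + a \<in> A" for a by (auto simp: P_def image_iff)
  have down: "2 * c - x \<in> A" if "x \<in> A" for x
    using card_reflections(3,4)[OF A(1) c(1) A(2)[OF c(1)] _ that] c that by (cases x c rule: linorder_cases) auto
  have sym: "x \<in> symmetrize P \<longleftrightarrow> c + x \<in> A" for x
    using down[of "c + x"] down[of "c - x"] c(1)
    by (cases x "0 :: int" rule: linorder_cases) (auto simp: mem_symmetrize memP)
  have AP: "A = (\<lambda>x. c + x) ` symmetrize P"
  proof (intro equalityI subsetI)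
    fix x assume "x \<in> A"
    then have "x - c \<in> symmetrize P" by (simp add: sym)
    then show "x \<in> (\<lambda>x. c + x) ` symmetrize P" by (rule rev_image_eqI) simp
  qed (auto simp: sym)
  have "2 * a - b \<in> symmetrize P" if "a \<in> P" "b \<in> P" "a < b" for a b
  proof -
    have ca: "c + a \<in> A" "0 < a" using that memP by auto
    have "card {x\<in>A. c + a < x} \<le> card {x\<in>A. c < x}" "card {x\<in>A. x < c} \<le> card {x\<in>A. x < c + a}"
      using A(1) ca by (auto intro!: card_mono)
    then have "2 * (c + a) - (c + b) \<in> A"
      using card_reflections(4)[OF A(1) ca(1) A(2)[OF ca(1)], of "c + b"] that c memP by auto
    then show ?thesis unfolding sym by (simp add: algebra_simps)
  qed
  then have "P = {} \<or> (\<exists>d>0. \<exists>k m. 1 \<le> k \<and> P = (*) d ` pos_part k m)"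
    by (intro reflecting_positive_part) (use A in \<open>auto simp: P_def\<close>)
  then show ?thesis
  proof
    assume "P = {}"
    then have "A = (\<lambda>x. c + x) ` ((*) 1 ` E_set 0 0)" unfolding AP by (auto simp: symmetrize_def E_set_eq)
    then have "affine_copy A (E_set 0 0)" by (rule affine_copyI[rotated]) simp
    then show ?thesis by blast
  next
    assume "\<exists>d>0. \<exists>k m. 1 \<le> k \<and> P = (*) d ` pos_part k m"
    then obtain d k m where d: "0 < d" "1 \<le> k" "P = (*) d ` pos_part k m" by blast
    have "A = (\<lambda>x. c + x) ` ((*) d ` E_set k m)"
      unfolding AP d(3) symmetrize_mult E_set_eq_symmetrize[OF d(2)] ..
    then have "affine_copy A (E_set k m)" by (rule affine_copyI[rotated]) (use d in simp)
    then show ?thesis by blast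
  qed
qed

lemma affine_copyI': "d \<noteq> 0 \<Longrightarrow> (\<lambda>x. 2 * x) ` A = (\<lambda>s. d * s + t) ` S \<Longrightarrow> affine_copy A S"
  unfolding affine_copy_def by blast

text \<open>The elements below \<open>u\<close> are reflected into the upper part and by
  \<open>top\<close> miss the maximum, so \<open>A\<close> without its maximum is symmetric about
  \<open>u\<close>. Then \<open>next_element\<close> leaves only two places for the maximum.\<close>

lemma reflecting_even:
  assumes A: "finite A" "\<And>y. y \<in> A \<Longrightarrow> reflecting A y"
    and u: "u \<in> A" "card {x\<in>A. u < x} = Suc (card {x\<in>A. x < u})"
    and top: "\<And>x. x \<in> A \<Longrightarrow> 2 * u - x \<noteq> Max A"
  shows "\<exists>k m. affine_copy A (F_set k m)"
proof -
  have Mx: "Max A \<in> A" "\<And>x. x \<in> A \<Longrightarrow> x \<le> Max A" using A(1) u(1) by (auto intro: Max_in)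
  have uM: "u < Max A"
  proof -
    have "{x\<in>A. u < x} \<noteq> {}" using u(2) by (metis card.empty nat.distinct(1))
    then show ?thesis using Mx(2) by force
  qed
  define b where "b = Max A - u"
  define P where "P = (\<lambda>x. x - u) ` {x\<in>A. u < x \<and> x < Max A}"
  have memP: "a \<in> P \<longleftrightarrow> 0 < a \<and> a < b \<and> u + a \<in> A" for a by (auto simp: P_def image_iff b_def)
  define L where "L = {x\<in>A. x < u}"
  have up: "2 * u - x \<in> A" "2 * u - x < Max A" if "x \<in> A" "x < u" for x
  proof -
    show "2 * u - x \<in> A" using card_reflections(3)[OF A(1) u(1) A(2)[OF u(1)] _ that] u(2) by simp
    then show "2 * u - x < Max A" using top[OF that(1)] Mx(2) by (simp add: less_le)
  qed
  have "(\<lambda>x. 2 * u - x) ` L = {x\<in>A. u < x \<and> x < Max A}"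
  proof (rule card_subset_eq)
    show "(\<lambda>x. 2 * u - x) ` L \<subseteq> {x\<in>A. u < x \<and> x < Max A}" using up by (auto simp: L_def)
    have "{x\<in>A. u < x} = insert (Max A) {x\<in>A. u < x \<and> x < Max A}" using Mx uM by (auto simp: less_le)
    then have "card {x\<in>A. u < x} = Suc (card {x\<in>A. u < x \<and> x < Max A})" using A(1) by simp
    then show "card ((\<lambda>x. 2 * u - x) ` L) = card {x\<in>A. u < x \<and> x < Max A}"
      using u(2) by (simp add: card_image inj_on_def L_def)
  qed (use A in simp)
  note image_L = this
  have down: "2 * u - x \<in> A" if "x \<in> A" "u < x" "x < Max A" for x
  proof -
    have "x \<in> (\<lambda>x. 2 * u - x) ` L" unfolding image_L using that by simp
    then obtain y where "y \<in> L" "x = 2 * u - y" by (rule imageE)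
    then show ?thesis by (simp add: L_def)
  qed
  have sym: "x \<in> symmetrize P \<longleftrightarrow> u + x \<in> A \<and> x \<noteq> b" for x
  proof (cases x "0 :: int" rule: linorder_cases)
    case less
    then show ?thesis using down[of "u - x"] up[of "u + x"] uM by (auto simp: mem_symmetrize memP b_def)
  next
    case equal
    then show ?thesis using u(1) uM by (auto simp: mem_symmetrize b_def)
  next
    case greater
    then show ?thesis using Mx(2)[of "u + x"] by (auto simp: mem_symmetrize memP b_def)
  qed
  have AP: "A = (\<lambda>x. u + x) ` insert b (symmetrize P)"
  proof (intro equalityI subsetI)
    fix x assume "x \<in> A"
    then have "x - u \<in> insert b (symmetrize P)" by (simp add: sym)
    then show "x \<in> (\<lambda>x. u + x) ` insert b (symmetrize P)" by (rule rev_image_eqI) simp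
  qed (use Mx(1) in \<open>auto simp: sym b_def\<close>)
  have refl: "2 * a - c \<in> symmetrize P" if "a \<in> P" "u + c \<in> A" "a < c" for a c
  proof -
    have ca: "u + a \<in> A" "0 < a" "a < b" using that memP by auto
    have "card {x\<in>A. u + a < x} < card {x\<in>A. u < x}"
    proof (rule psubset_card_mono)
      have "u + a \<in> {x\<in>A. u < x}" "u + a \<notin> {x\<in>A. u + a < x}" using ca by simp_all
      moreover have "{x\<in>A. u + a < x} \<subseteq> {x\<in>A. u < x}" using ca by auto
      ultimately show "{x\<in>A. u + a < x} \<subset> {x\<in>A. u < x}" by blast
    qed (use A in simp)
    moreover have "card {x\<in>A. x < u} \<le> card {x\<in>A. x < u + a}"
      using A(1) ca by (intro card_mono) auto
    ultimately have "2 * (u + a) - (u + c) \<in> A"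
      using card_reflections(4)[OF A(1) ca(1) A(2)[OF ca(1)], of "u + c"] that u(2) by auto
    then show ?thesis unfolding sym using ca that by (simp add: algebra_simps)
  qed
  then have "P = {} \<or> (\<exists>d>0. \<exists>k m. 1 \<le> k \<and> P = (*) d ` pos_part k m)"
    by (intro reflecting_positive_part) (use A memP in \<open>auto simp: P_def\<close>)
  then show ?thesis
  proof
    assume P: "P = {}"
    have "x \<in> F_set 0 1 \<longleftrightarrow> x = 0 \<or> x = 2" for x
      unfolding One_nat_def F_set_Suc_eq mem_Collect_eq by simp presburger
    then have "F_set 0 1 = {0, 2}" by blast
    moreover have "A = {u + b, u}" using AP by (simp add: P symmetrize_def)
    ultimately have im: "(\<lambda>x. 2 * x) ` A = (\<lambda>s. b * s + 2 * u) ` F_set 0 1" by (simp add: algebra_simps insert_commute)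
    have "b \<noteq> 0" using uM by (simp add: b_def)
    then have "affine_copy A (F_set 0 1)" using im by (rule affine_copyI')
    then show ?thesis by blast
  next
    assume "\<exists>d>0. \<exists>k m. 1 \<le> k \<and> P = (*) d ` pos_part k m"
    then obtain d k m where d: "0 < d" "1 \<le> k" "P = (*) d ` pos_part k m" by blast
    have "m = 0 \<and> b = d * (int k + 1) \<or> b = d * (int k + 2 * int m + 2)"
    proof (rule next_element[OF d(2,1)])
      fix a assume "a \<in> (*) d ` pos_part k m"
      then have a: "a \<in> P" by (simp add: d(3))
      then show "a < b" using memP by blast
      then show "2 * a - b \<in> symmetrize ((*) d ` pos_part k m)"
        using refl[OF a, of b] Mx(1) by (simp add: b_def d(3))
    qed
    then show ?thesis
    proof
      assume h: "b = d * (int k + 2 * int m + 2)"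
      have "A = (\<lambda>x. u + x) ` ((*) d ` F_set k (Suc m))"
        unfolding F_set_eq_symmetrize[OF d(2)] by (subst AP) (simp add: d(3) symmetrize_mult h)
      then have "affine_copy A (F_set k (Suc m))" by (rule affine_copyI[rotated]) (use d in simp)
      then show ?thesis by blast
    next
      assume h: "m = 0 \<and> b = d * (int k + 1)"
      have "E_set k 0 = {- int k..int k}" by (auto simp: E_set_def)
      then have "insert b (symmetrize P) = (*) d ` insert (int k + 1) {- int k..int k}"
        using h by (simp add: d(3) symmetrize_mult flip: E_set_eq_symmetrize[OF d(2)])
      also have "insert (int k + 1) {- int k..int k} = {- int k..int k + 1}" by auto
      finally have A1: "A = (\<lambda>x. u + x) ` ((*) d ` {- int k..int k + 1})" by (subst AP) simp
      have F: "F_set 0 (Suc k) = (\<lambda>x. 2 * x) ` {- int k..int k + 1}"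
      proof (intro equalityI subsetI)
        fix x assume "x \<in> F_set 0 (Suc k)"
        then have "even x" "- int k \<le> x div 2" "x div 2 \<le> int k + 1" by (auto simp: F_set_Suc_eq)
        then show "x \<in> (\<lambda>x. 2 * x) ` {- int k..int k + 1}" by (intro rev_image_eqI[of "x div 2"]) auto
      qed (auto simp: F_set_Suc_eq)
      have "(\<lambda>x. 2 * x) ` A = (\<lambda>s. d * s + 2 * u) ` F_set 0 (Suc k)"
        unfolding A1 F by (simp add: image_image algebra_simps)
      then have "affine_copy A (F_set 0 (Suc k))" by (rule affine_copyI'[rotated]) (use d in simp)
      then show ?thesis by blast
    qed
  qed
qed

text \<open>In the even case the two central elements \<open>u < v\<close> satisfy \<open>2 u \<noteq> 2 v\<close>, so the reflection in
  one of them misses an extreme element; deleting that element leaves a symmetric set.\<close>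

lemma reflecting_imp_affine_copy:
  assumes A: "finite A" "A \<noteq> {}" "\<And>y. y \<in> A \<Longrightarrow> reflecting A y"
  shows "\<exists>k m. affine_copy A (E_set k m) \<or> affine_copy A (F_set k m)"
proof -
  have rank: "\<exists>y\<in>A. card {x\<in>A. x < y} = i" if "i < card A" for i
  proof -
    have "i \<in> (\<lambda>y. card {x\<in>A. x < y}) ` A"
      using that unfolding bij_betw_imp_surj_on[OF bij_betw_rank[OF A(1)]] by simp
    then show ?thesis by auto
  qed
  show ?thesis
  proof (cases "odd (card A)")
    case True
    then obtain h where h: "card A = Suc (2 * h)" by (auto elim: oddE)
    then obtain c where c: "c \<in> A" "card {x\<in>A. x < c} = h" using rank[of h] by auto
    then have "card {x\<in>A. x < c} = card {x\<in>A. c < x}" using card_above[OF A(1) c(1)] h by simp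
    then show ?thesis using reflecting_odd[OF A(1,3) c(1)] by blast
  next
    case False
    then obtain h' where h': "card A = 2 * h'" by (auto elim: evenE)
    then obtain h where h: "card A = Suc (Suc (2 * h))" using A by (cases h') auto
    obtain u where u: "u \<in> A" "card {x\<in>A. x < u} = h" using rank[of h] h by auto
    obtain v where v: "v \<in> A" "card {x\<in>A. x < v} = Suc h" using rank[of "Suc h"] h by auto
    have u': "card {x\<in>A. u < x} = Suc h" using card_above[OF A(1) u(1)] h u by simp
    have v': "card {x\<in>A. v < x} = h" using card_above[OF A(1) v(1)] h v by simp
    show ?thesis
    proof (cases "\<forall>x\<in>A. 2 * u - x \<noteq> Max A")
      case True
      then show ?thesis using reflecting_even[OF A(1,3) u(1)] u u' by auto
    next
      case False
      then obtain x0 where x0: "x0 \<in> A" "2 * u - x0 = Max A" by blast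
      have Mx: "x \<le> Max A" if "x \<in> A" for x using A that by simp
      have uv: "u < v"
      proof (rule ccontr)
        assume "\<not> u < v"
        then have "card {x\<in>A. x < v} \<le> card {x\<in>A. x < u}" using A(1) by (intro card_mono) auto
        then show False using u v by simp
      qed
      \<comment> \<open>As the maximum is a reflection in \<open>u\<close>, the sum of the two
        extreme elements is at most \<open>2 * u\<close>. If the minimum were a reflection in
        \<open>v\<close>, that sum would be at least \<open>2 * v\<close>, which exceeds
        \<open>2 * u\<close>. So the negated set satisfies the hypothesis \<open>top\<close> at
        \<open>- v\<close>.\<close>
      let ?B = "uminus ` A"
      have B: "finite ?B" using A by simp
      have memB: "x \<in> ?B \<longleftrightarrow> - x \<in> A" for x by (auto simp: image_iff) (metis minus_minus)
      have reflB: "reflecting ?B y" if "y \<in> ?B" for y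
      proof -
        have "reflecting A (- y)" using A(3) that memB by blast
        moreover have mem: "2 * y - x \<in> ?B \<longleftrightarrow> 2 * (- y) - (- x) \<in> A" for x by (simp add: memB)
        ultimately show ?thesis
          unfolding reflecting_def
        proof (elim disjE)
          assume h: "\<forall>x\<in>A. x < - y \<longrightarrow> 2 * - y - x \<in> A"
          have "2 * y - x \<in> ?B" if "x \<in> ?B" "y < x" for x
          proof -
            have "- x \<in> A" "- x < - y" using that memB[of x] by simp_all
            then have "2 * (- y) - (- x) \<in> A" using h by blast
            then show ?thesis using mem[of x] by blast
          qed
          then have "\<forall>x\<in>?B. y < x \<longrightarrow> 2 * y - x \<in> ?B" by blast
          then show "(\<forall>x\<in>?B. x < y \<longrightarrow> 2 * y - x \<in> ?B) \<or> (\<forall>x\<in>?B. y < x \<longrightarrow> 2 * y - x \<in> ?B)" ..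
        next
          assume h: "\<forall>x\<in>A. - y < x \<longrightarrow> 2 * - y - x \<in> A"
          have "2 * y - x \<in> ?B" if "x \<in> ?B" "x < y" for x
          proof -
            have "- x \<in> A" "- y < - x" using that memB[of x] by simp_all
            then have "2 * (- y) - (- x) \<in> A" using h by blast
            then show ?thesis using mem[of x] by blast
          qed
          then have "\<forall>x\<in>?B. x < y \<longrightarrow> 2 * y - x \<in> ?B" by blast
          then show "(\<forall>x\<in>?B. x < y \<longrightarrow> 2 * y - x \<in> ?B) \<or> (\<forall>x\<in>?B. y < x \<longrightarrow> 2 * y - x \<in> ?B)" ..
        qed
      qed
      have "{x\<in>?B. - v < x} = uminus ` {x\<in>A. x < v}" "{x\<in>?B. x < - v} = uminus ` {x\<in>A. v < x}" by auto
      then have cB: "card {x\<in>?B. - v < x} = Suc (card {x\<in>?B. x < - v})" using v v' by (simp add: card_image)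
      have topB: "2 * (- v) - x \<noteq> Max ?B" if "x \<in> ?B" for x
      proof
        assume e: "2 * (- v) - x = Max ?B"
        have "- x0 \<le> Max ?B" using B x0 by (intro Max_ge) auto
        moreover have "- x \<le> Max A" using that memB Mx by blast
        ultimately show False using e x0 uv by linarith
      qed
      have "\<exists>k m. affine_copy ?B (F_set k m)"
        by (rule reflecting_even[OF B reflB _ cB topB]) (use v in auto)
      then show ?thesis using affine_copy_uminus by blast
    qed
  qed
qed

section \<open>Rectification\<close>

text \<open>A Freiman isomorphism for the single equation \<open>x + z = 2 * y\<close>, with its own
  modulus on each side so that integers (modulus 0) and residues can be compared.\<close>

lemma card_aps_transfer:
  assumes inj: "inj_on g S"
    and eq: "\<And>x y z. x \<in> S \<Longrightarrow> y \<in> S \<Longrightarrow> z \<in> S \<Longrightarrow> int N dvd g x + g z - 2 * g y \<longleftrightarrow> int M dvd x + z - 2 * y"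
  shows "card (aps N (g ` S)) = card (aps M S)"
proof -
  have "aps N (g ` S) = (\<lambda>(x, y, z). (g x, g y, g z)) ` aps M S"
  proof (intro equalityI subsetI)
    fix t assume "t \<in> aps N (g ` S)"
    then obtain x y z where t: "t = (g x, g y, g z)" "x \<in> S" "y \<in> S" "z \<in> S" "int N dvd g x + g z - 2 * g y"
      unfolding aps_def by auto
    then have "(x, y, z) \<in> aps M S" using eq by (simp add: aps_def)
    then show "t \<in> (\<lambda>(x, y, z). (g x, g y, g z)) ` aps M S" by (rule rev_image_eqI) (simp add: t)
  next
    fix t assume "t \<in> (\<lambda>(x, y, z). (g x, g y, g z)) ` aps M S"
    then obtain x y z where "t = (g x, g y, g z)" "(x, y, z) \<in> aps M S" by auto
    then show "t \<in> aps N (g ` S)" using eq by (simp add: aps_def)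
  qed
  moreover have "inj_on (\<lambda>(x, y, z). (g x, g y, g z)) (aps M S)"
    using inj by (auto simp: inj_on_def aps_def)
  ultimately show ?thesis by (simp add: card_image)
qed

text \<open>For representatives of absolute value at most \<open>p / 8\<close> the combination
  \<open>g x + g z - 2 * g y\<close> is at most \<open>p / 2\<close> in absolute value, so it
  vanishes as soon as \<open>p\<close> divides it.\<close>

lemma rectify:
  assumes p: "prime p" and l: "\<not> int p dvd l" and A: "A \<subseteq> {0..<int p}"
    and near: "\<And>x. x \<in> A \<Longrightarrow> near p (p / 8) (l * (x - a))"
  obtains g where "inj_on g A" "\<And>x. x \<in> A \<Longrightarrow> int p dvd g x - l * (x - a)" "\<And>x. x \<in> A \<Longrightarrow> 8 * \<bar>g x\<bar> \<le> int p"
    "card (aps 0 (g ` A)) = card (aps p A)"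
proof -
  have p0: "p > 0" using p prime_gt_0_nat by blast
  have "\<forall>x\<in>A. \<exists>k. \<bar>real_of_int (l * (x - a) - k * int p)\<bar> \<le> p / 8" using near unfolding near_def by blast
  then obtain k where k: "\<forall>x\<in>A. \<bar>real_of_int (l * (x - a) - k x * int p)\<bar> \<le> p / 8" by (rule bchoice[THEN exE])
  define g where "g = (\<lambda>x. l * (x - a) - k x * int p)"
  have small: "8 * \<bar>g x\<bar> \<le> int p" if "x \<in> A" for x
  proof -
    have "8 * \<bar>real_of_int (g x)\<bar> \<le> p" using k that unfolding g_def by fastforce
    then have "real_of_int (8 * \<bar>g x\<bar>) \<le> real_of_int (int p)" by simp
    then show ?thesis by (simp only: of_int_le_iff)
  qed
  have cong: "int p dvd g x - l * (x - a)" for x by (simp add: g_def)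
  have prime: "int p dvd t" if "int p dvd l * t" for t
    using that p l by (simp add: prime_dvd_mult_iff)
  have inj: "inj_on g A"
  proof (rule inj_onI)
    fix x y assume xy: "x \<in> A" "y \<in> A" "g x = g y"
    have "int p dvd (g y - l * (y - a)) - (g x - l * (x - a))" by (intro dvd_diff cong)
    also have "(g y - l * (y - a)) - (g x - l * (x - a)) = l * (x - y)" using xy(3) by (simp add: algebra_simps)
    finally have "int p dvd x - y" by (rule prime)
    then show "x = y" by (rule residue_eqI[OF subsetD[OF A xy(1)] subsetD[OF A xy(2)]])
  qed
  have "card (aps 0 (g ` A)) = card (aps p A)"
  proof (rule card_aps_transfer[OF inj])
    fix x y z assume xyz: "x \<in> A" "y \<in> A" "z \<in> A"
    let ?G = "g x + g z - 2 * g y"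
    have "\<bar>?G\<bar> < int p" using small[OF xyz(1)] small[OF xyz(2)] small[OF xyz(3)] p0 by arith
    then have "?G = 0 \<longleftrightarrow> int p dvd ?G" using zdvd_imp_le[of "int p" "\<bar>?G\<bar>"] by (cases "?G = 0") auto
    also have "\<dots> \<longleftrightarrow> int p dvd l * (x + z - 2 * y)"
    proof -
      have "?G = l * (x + z - 2 * y) + int p * (2 * k y - k x - k z)" by (simp add: g_def algebra_simps)
      then show ?thesis by (metis dvd_add_left_iff dvd_triv_left)
    qed
    also have "\<dots> \<longleftrightarrow> int p dvd x + z - 2 * y" using prime by (metis dvd_mult)
    finally show "int 0 dvd ?G \<longleftrightarrow> int p dvd x + z - 2 * y" by simp
  qed
  then show ?thesis using that[of g] inj cong small by blast
qed

lemma card_aps_arc_le: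
  assumes p: "prime p" and l: "\<not> int p dvd l" and A: "A \<subseteq> {0..<int p}"
    and near: "\<And>x. x \<in> A \<Longrightarrow> near p (p / 8) (l * (x - a))"
  shows "2 * card (aps p A) \<le> (card A)\<^sup>2 + 1"
proof -
  have fin: "finite A" using A finite_subset by blast
  obtain g where g: "inj_on g A" "card (aps 0 (g ` A)) = card (aps p A)"
    by (rule rectify[OF p l A near])
  have "card (aps 0 (g ` A)) \<le> ((card (g ` A))\<^sup>2 + 1) div 2" using fin by (intro card_aps_int) simp
  then show ?thesis using g by (simp add: card_image)
qed

lemma card_aps_le_square:
  assumes "odd N" "A \<subseteq> {0..<int N}"
  shows "card (aps N A) \<le> (card A)\<^sup>2"
proof -
  have fin: "finite A" using assms(2) finite_subset by blast
  have "card (aps N A) \<le> card (A \<times> A)"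
    by (rule card_inj_on_le[OF inj_on_aps(1)[OF assms]]) (use fin in \<open>auto simp: aps_def\<close>)
  then show ?thesis by (simp add: card_cartesian_product power2_eq_square)
qed

section \<open>Sets with many progressions lie in a short arc\<close>

abbreviation progression_rich :: "nat \<Rightarrow> real \<Rightarrow> int set \<Rightarrow> bool" where
  "progression_rich p c A \<equiv> prime p \<and> A \<subseteq> {0..<int p} \<and> 0 < card A \<and> real (card A) \<le> c * real p \<and> (card A)\<^sup>2 \<le> 2 * card (aps p A)"

text \<open>Arcs are split off from \<open>A\<close> one at a time, so that the number of progressions in \<open>A\<close> is essentially
  at most the sum of half the squares of their sizes; hence some arc contains almost all of \<open>A\<close>.\<close>

lemma almost_all_in_arc_large:
  fixes \<epsilon> \<tau> :: real
  assumes \<epsilon>: "0 < \<epsilon>" "\<epsilon> \<le> 1" and \<tau>: "0 < \<tau>" "\<tau> \<le> 1 / 8"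
  shows "\<exists>(c::real) (n0::nat). 0 < c \<and> (\<forall>(p::nat) A. n0 \<le> card A \<and> progression_rich p c A \<longrightarrow>
    (\<exists>l a. \<not> int p dvd l \<and> (1 - \<epsilon>) * card A \<le> card (arc p (\<tau> * p) l a A)))"
proof -
  \<comment> \<open>Three errors compete with the gain \<open>\<epsilon> * n\<^sup>2 / 2\<close>:
    the progressions in the unsplit remainder and the total splitting error, each
    \<open>\<eta> * n\<^sup>2\<close>, and a rounding error of \<open>1 / 2\<close> per arc. This
    \<open>\<eta>\<close> leaves a third of the gain for the rounding, which suffices once
    \<open>n\<close> is large; hence \<open>n0\<close>.\<close>
  define \<eta> where "\<eta> = \<epsilon> / 6"
  have \<eta>: "0 < \<eta>" using \<epsilon> by (simp add: \<eta>_def)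
  \<comment> \<open>A subset of \<open>A\<close> with more than \<open>\<eta> * n\<^sup>2\<close>
    progressions has at least \<open>\<eta> * n\<close> elements, and a proportion
    \<open>\<eta> / 16\<close> of them lies in the first arc. So every arc split off has at least
    \<open>c1 * n\<close> elements, and \<open>j\<close> arcs exhaust \<open>A\<close>.\<close>
  define c1 where "c1 = \<eta>\<^sup>2 / 16"
  have c1: "0 < c1" using \<eta> by (simp add: c1_def)
  define j where "j = nat \<lceil>1 / c1\<rceil>"
  have j: "1 \<le> j * c1"
  proof -
    have "1 / c1 \<le> j" unfolding j_def by linarith
    then show ?thesis using c1 by (simp add: field_simps)
  qed
  have j0: "0 < real j" using j c1 by (metis less_le_trans mult_zero_left of_nat_0_le_iff order_le_less zero_less_one linorder_not_less)
  define \<delta> where "\<delta> = \<eta> / (6 * j)"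
  have \<delta>: "0 < \<delta>" using \<eta> j0 by (simp add: \<delta>_def)
  obtain \<tau>0 :: real and p0 :: nat where \<tau>0: "0 < \<tau>0" and split: "\<forall>(p::nat) R (n::real) l a. prime p \<and> p > p0 \<and> R \<subseteq> {0..<int p} \<and> card R \<le> n \<and> 0 < n \<and> \<not> int p dvd l \<longrightarrow>
    arc_splits \<delta> p R n a \<tau>0 l \<tau>"
    using split_off_arc[OF \<delta> \<tau>(1)] by blast
  define \<tau>1 where "\<tau>1 = min \<tau>0 (1 / 4)"
  have \<tau>1: "0 < \<tau>1" "\<tau>1 < 1 / 2" "\<tau>1 \<le> \<tau>0" using \<tau>0 by (auto simp: \<tau>1_def)
  obtain c2 :: real where c2: "c2 > 0" and piece: "\<forall>N A. odd N \<and> finite A \<and> A \<noteq> {} \<and> A \<subseteq> {0..<int N} \<and> card A \<le> c2 * N \<and> \<eta> * (card A)\<^sup>2 \<le> card (aps N A) \<longrightarrow>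
    (\<exists>r a. 0 < r \<and> r < int N \<and> a \<in> A \<and> \<eta> / 16 * card A \<le> card (arc N (\<tau>1 * N) r a A))"
    using concentrated_piece[OF \<eta> \<tau>1(1,2)] by blast
  \<comment> \<open>As \<open>A\<close> is nonempty, \<open>card A \<le> c * p\<close> now forces
    \<open>p > p0\<close>.\<close>
  define c where "c = min c2 (1 / (p0 + 3))"
  have c: "0 < c" "c \<le> c2" "c \<le> 1 / (p0 + 3)" using c2 by (auto simp: c_def)
  define n0 where "n0 = Suc (nat \<lceil>3 * j / \<epsilon>\<rceil>)"
  show ?thesis
  proof (intro exI[of _ c] exI[of _ n0] conjI allI impI c(1))
    fix p :: nat and A
    assume "n0 \<le> card A \<and> progression_rich p c A"
    then have p: "prime p" and A: "A \<subseteq> {0..<int p}" "n0 \<le> card A" "0 < card A" "card A \<le> c * p" "(card A)\<^sup>2 \<le> 2 * card (aps p A)"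
      by auto
    define n where "n = real (card A)"
    have n: "0 < n" using A by (simp add: n_def)
    have finA: "finite A" using A(1) finite_subset by blast
    have "1 \<le> c * p" using A(3,4) by linarith
    also have "\<dots> \<le> 1 / (p0 + 3) * p" by (rule mult_right_mono) (use c in auto)
    finally have "real (p0 + 3) \<le> real p" by (simp add: field_simps)
    then have pp0: "p0 < p" "2 < p" by linarith+
    have podd: "odd p" using p pp0 prime_odd_nat by blast
    show "\<exists>l a. \<not> int p dvd l \<and> (1 - \<epsilon>) * card A \<le> card (arc p (\<tau> * p) l a A)"
    proof (rule ccontr)
      assume neg: "\<not> ?thesis"
      have small: "card B \<le> (1 - \<epsilon>) * n" if "B \<subseteq> A" "\<not> int p dvd l" "\<forall>x\<in>B. near p (\<tau> * p) (l * (x - a))" for B l a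
      proof -
        have "card B \<le> card (arc p (\<tau> * p) l a A)" by (rule card_mono) (use finA that in auto)
        moreover have "card (arc p (\<tau> * p) l a A) < (1 - \<epsilon>) * n" using neg that(2) by (auto simp: n_def not_le)
        ultimately show ?thesis by linarith
      qed
      \<comment> \<open>By the assumption for contradiction an arc has at most
        \<open>(1 - \<epsilon>) * n\<close> elements. This makes the quadratic bound for each arc
        linear in its size, and linear bounds add up over the splittings.\<close>
      have claim: "card (aps p R) \<le> (1 - \<epsilon>) * n / 2 * card R + \<eta> * n\<^sup>2 + i * (6 * \<delta> * n\<^sup>2 + 1 / 2)"
        if "R \<subseteq> A" "card R \<le> i * (c1 * n)" for i :: nat and R
        using that
      proof (induction i arbitrary: R)
        case 0
        then have "card R = 0" by simp
        then have "R = {}" using 0 finA finite_subset by fastforce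
        then have "aps p R = {}" by (simp add: aps_def)
        then show ?case using \<eta> \<open>R = {}\<close> by simp
      next
        case (Suc i)
        have finR: "finite R" using Suc.prems(1) finA finite_subset by blast
        have Rp: "R \<subseteq> {0..<int p}" using Suc.prems(1) A(1) by blast
        have Rn: "card R \<le> n" using Suc.prems(1) finA by (simp add: n_def card_mono)
        show ?case
        proof (cases "card (aps p R) \<le> \<eta> * n\<^sup>2")
          case True
          have "0 \<le> (1 - \<epsilon>) * n / 2 * card R" "0 \<le> Suc i * (6 * \<delta> * n\<^sup>2 + 1 / 2)" using \<epsilon> n \<delta> by auto
          with True show ?thesis by linarith
        next
          case False
          have "\<eta> * (card R)\<^sup>2 \<le> \<eta> * n\<^sup>2" by (intro mult_left_mono power_mono) (use Rn \<eta> in auto)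
          then have 1: "\<eta> * (card R)\<^sup>2 \<le> card (aps p R)" using False by simp
          have Rne: "R \<noteq> {}" using False \<eta> by (auto simp: aps_def)
          have "card R \<le> card A" using Suc.prems(1) finA by (rule card_mono[rotated])
          moreover have "c * p \<le> c2 * p" by (rule mult_right_mono) (use c in auto)
          ultimately have "card R \<le> c2 * p" using A(4) by linarith
          then obtain r a where r: "0 < r" "r < int p" "\<eta> / 16 * card R \<le> card (arc p (\<tau>1 * p) r a R)"
            using piece podd finR Rne Rp 1 by blast
          have rp: "\<not> int p dvd r" using r zdvd_imp_le by fastforce
          obtain B l' where B: "arc p (\<tau>0 * p) r a R \<subseteq> B" "B \<subseteq> R" "\<not> int p dvd l'"
            "\<forall>x\<in>B. near p (\<tau> * p) (l' * (x - a))"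
            "card (aps p R) \<le> card (aps p B) + card (aps p (R - B)) + 6 * \<delta> * n\<^sup>2"
            using split p pp0(1) Rp Rn n rp unfolding arc_splits_def by meson
          have finB: "finite B" using B(2) finR finite_subset by blast
          have BA: "B \<subseteq> A" using B(2) Suc.prems(1) by blast
          have cB: "c1 * n \<le> card B"
          proof -
            have "\<eta> * n * n \<le> card (aps p R)" using False by (simp add: power2_eq_square mult.assoc)
            also have "\<dots> \<le> real ((card R)\<^sup>2)" using card_aps_le_square[OF podd Rp] of_nat_le_iff by blast
            also have "\<dots> \<le> card R * n" using Rn by (simp add: power2_eq_square mult_left_mono)
            finally have "\<eta> * n \<le> card R" using n by simp
            then have "\<eta> / 16 * (\<eta> * n) \<le> \<eta> / 16 * card R" by (rule mult_left_mono) (use \<eta> in simp)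
            then have "c1 * n \<le> \<eta> / 16 * card R" by (simp add: c1_def power2_eq_square)
            also have "\<dots> \<le> card (arc p (\<tau>1 * p) r a R)" by (rule r(3))
            also have "card (arc p (\<tau>1 * p) r a R) \<le> card B"
            proof (rule card_mono[OF finB])
              have "\<tau>1 * p \<le> \<tau>0 * p" by (rule mult_right_mono) (use \<tau>1 in auto)
              then show "arc p (\<tau>1 * p) r a R \<subseteq> B" using B(1) near_mono by blast
            qed
            finally show ?thesis by simp
          qed
          have cRB: "card (R - B) = real (card R) - card B"
            using card_Diff_subset[OF finB B(2)] card_mono[OF finR B(2)] by simp
          have tau8: "near p (p / 8) (l' * (x - a))" if "x \<in> B" for x
          proof -
            have "\<tau> * p \<le> 1 / 8 * p" by (rule mult_right_mono[OF \<tau>(2)]) simp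
            then show ?thesis using B(4) that near_mono by fastforce
          qed
          have "2 * card (aps p B) \<le> (card B)\<^sup>2 + 1"
            by (rule card_aps_arc_le[OF p B(3) _ tau8]) (use B(2) Rp in auto)
          from of_nat_mono[OF this, where 'a = real]
          have "2 * real (card (aps p B)) \<le> real (card B) * card B + 1"
            by (simp only: of_nat_mult of_nat_add of_nat_power of_nat_numeral of_nat_1 power2_eq_square)
          also have "real (card B) * card B \<le> (1 - \<epsilon>) * n * card B"
            by (rule mult_right_mono[OF small[OF BA B(3,4)]]) simp
          finally have 2: "real (card (aps p B)) \<le> (1 - \<epsilon>) * n / 2 * card B + 1 / 2" by simp
          have "card (aps p (R - B)) \<le> (1 - \<epsilon>) * n / 2 * card (R - B) + \<eta> * n\<^sup>2 + i * (6 * \<delta> * n\<^sup>2 + 1 / 2)"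
          proof (rule Suc.IH)
            show "card (R - B) \<le> i * (c1 * n)" using Suc.prems(2) cB cRB by (simp add: algebra_simps)
          qed (use Suc.prems in auto)
          moreover have "real (Suc i) * (6 * \<delta> * n\<^sup>2 + 1 / 2) = i * (6 * \<delta> * n\<^sup>2 + 1 / 2) + (6 * \<delta> * n\<^sup>2 + 1 / 2)"
            by (simp only: of_nat_Suc distrib_right mult_1)
          moreover have "(1 - \<epsilon>) * n / 2 * card (R - B) = (1 - \<epsilon>) * n / 2 * card R - (1 - \<epsilon>) * n / 2 * card B"
            unfolding cRB by (rule right_diff_distrib)
          ultimately show ?thesis using 2 B(5) by linarith
        qed
      qed
      have "1 * n \<le> j * c1 * n" by (rule mult_right_mono[OF j]) (use n in simp)
      then have "card A \<le> j * (c1 * n)" by (simp add: n_def mult.assoc)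
      from claim[OF subset_refl this] have "card (aps p A) \<le> (1 - \<epsilon>) * n / 2 * n + \<eta> * n\<^sup>2 + j * (6 * \<delta> * n\<^sup>2 + 1 / 2)"
        by (simp add: n_def)
      moreover have "j * (6 * \<delta> * n\<^sup>2 + 1 / 2) = \<eta> * n\<^sup>2 + j / 2" using j0 by (simp add: \<delta>_def field_simps)
      moreover have "n\<^sup>2 \<le> 2 * card (aps p A)"
        using of_nat_mono[OF A(5), where 'a = real] unfolding n_def by (simp only: of_nat_mult of_nat_add of_nat_power of_nat_numeral of_nat_1 power2_eq_square)
      moreover have "(1 - \<epsilon>) * n / 2 * n = (1 - \<epsilon>) * n\<^sup>2 / 2" by (simp add: power2_eq_square)
      ultimately have "n\<^sup>2 \<le> (1 - \<epsilon>) * n\<^sup>2 + 4 * (\<eta> * n\<^sup>2) + j" by linarith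
      then have "\<epsilon> / 3 * n\<^sup>2 \<le> j" by (simp add: \<eta>_def field_simps)
      moreover have "3 * j / \<epsilon> < n" using A(2) unfolding n0_def n_def by linarith
      then have "j < \<epsilon> / 3 * n" using \<epsilon> by (simp add: field_simps)
      moreover have "n * 1 \<le> n * n" using A(3) n by (intro mult_left_mono) (auto simp: n_def)
      then have "\<epsilon> / 3 * n \<le> \<epsilon> / 3 * n\<^sup>2" using \<epsilon> by (intro mult_left_mono) (auto simp: power2_eq_square)
      ultimately show False by linarith
    qed
  qed
qed

lemma almost_all_in_arc:
  fixes \<epsilon> \<tau> :: real
  assumes \<epsilon>: "0 < \<epsilon>" "\<epsilon> \<le> 1" and \<tau>: "0 < \<tau>" "\<tau> \<le> 1 / 8"
  shows "\<exists>c::real. 0 < c \<and> (\<forall>(p::nat) A. progression_rich p c A \<longrightarrow>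
    (\<exists>l a. \<not> int p dvd l \<and> (1 - \<epsilon>) * card A \<le> card (arc p (\<tau> * p) l a A)))"
proof -
  obtain c :: real and n0 :: nat where c: "0 < c" and large: "\<forall>(p::nat) A. n0 \<le> card A \<and> progression_rich p c A \<longrightarrow>
    (\<exists>l a. \<not> int p dvd l \<and> (1 - \<epsilon>) * card A \<le> card (arc p (\<tau> * p) l a A))"
    using almost_all_in_arc_large[OF assms] by blast
  define M where "M = nat \<lceil>1 / \<tau>\<rceil>"
  have M: "M > 0" "1 / M \<le> \<tau>"
  proof -
    have "0 < 1 / \<tau>" "1 / \<tau> \<le> M" using \<tau> unfolding M_def by (simp, linarith)
    then show "M > 0" by linarith
    then show "1 / M \<le> \<tau>" using \<open>1 / \<tau> \<le> M\<close> \<tau> by (simp add: field_simps)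
  qed
  \<comment> \<open>A set with fewer than \<open>n0\<close> elements is put into an arc by
    Dirichlet's theorem alone; this density makes \<open>p\<close> larger than the
    multiplier.\<close>
  define c' where "c' = min c (1 / (M ^ n0 + 1))"
  have c': "0 < c'" "c' \<le> c" "c' \<le> 1 / (M ^ n0 + 1)" using c by (auto simp: c'_def add_pos_nonneg)
  show ?thesis
  proof (intro exI[of _ c'] conjI allI impI c'(1))
    fix p :: nat and A
    assume "progression_rich p c' A"
    then have p: "prime p" and A: "A \<subseteq> {0..<int p}" "0 < card A" "card A \<le> c' * p" "(card A)\<^sup>2 \<le> 2 * card (aps p A)"
      by auto
    have finA: "finite A" using A(1) finite_subset by blast
    show "\<exists>l a. \<not> int p dvd l \<and> (1 - \<epsilon>) * card A \<le> card (arc p (\<tau> * p) l a A)"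
    proof (cases "n0 \<le> card A")
      case True
      have "c' * p \<le> c * p" by (rule mult_right_mono) (use c' in auto)
      then have "card A \<le> c * p" using A(3) by linarith
      then show ?thesis using large p A True by blast
    next
      case False
      have "1 \<le> c' * p" using A(2,3) by linarith
      also have "\<dots> \<le> 1 / (M ^ n0 + 1) * p" by (rule mult_right_mono) (use c' in auto)
      finally have "real (M ^ n0 + 1) \<le> real p" by (simp add: field_simps add_pos_nonneg)
      then have pM: "M ^ n0 < p" by linarith
      have p0: "p > 0" using pM by simp
      obtain q where q: "1 \<le> q" "q \<le> M ^ card A" "\<And>x. x \<in> A \<Longrightarrow> near p (p / M) (int q * (x - 0))"
        by (rule simultaneous_approximation[OF finA M(1) p0, of "\<lambda>x. x - 0"]) blast
      have "M ^ card A \<le> M ^ n0" by (rule power_increasing) (use False M in auto)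
      then have "q < p" using q(2) pM by linarith
      then have qp: "\<not> int p dvd int q" using q(1) by (auto dest: dvd_imp_le)
      have "p * (1 / M) \<le> p * \<tau>" by (rule mult_left_mono[OF M(2)]) simp
      then have "p / M \<le> \<tau> * p" by (simp add: mult.commute)
      then have "arc p (\<tau> * p) (int q) 0 A = A" using q(3) near_mono by blast
      moreover have "(1 - \<epsilon>) * card A \<le> 1 * real (card A)" by (rule mult_right_mono) (use \<epsilon> in auto)
      ultimately show ?thesis using qp by (intro exI[of _ "int q"] exI[of _ 0] conjI) auto
    qed
  qed
qed

text \<open>An element outside the doubled arc takes part in progressions only together with one of the few
  elements outside the original arc, too few to compensate for its removal.\<close>

lemma all_in_arc:
  shows "\<exists>c::real. 0 < c \<and> (\<forall>(p::nat) A. progression_rich p c A \<longrightarrow>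
    (\<exists>l a. \<not> int p dvd l \<and> (\<forall>x\<in>A. near p (p / 8) (l * (x - a)))))"
proof -
  \<comment> \<open>A third term multiplies the radius \<open>1 / 48\<close> by 3 and the dilation
    by 2 doubles it, which gives the \<open>1 / 8\<close> of \<open>rectify\<close>. With
    \<open>1 / 24\<close>, at most \<open>card R * n / 4\<close> progressions meet the stray set
    \<open>R\<close>, while its removal lowers the extremal value by about
    \<open>card R * n\<close>.\<close>
  obtain c :: real where c: "0 < c" and arc: "\<forall>(p::nat) A. progression_rich p c A \<longrightarrow>
    (\<exists>l a. \<not> int p dvd l \<and> (1 - 1 / 24) * card A \<le> card (arc p (1 / 48 * p) l a A))"
    using almost_all_in_arc[of "1 / 24" "1 / 48"] by auto
  define c' where "c' = min c (1 / 3)"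
  have c': "0 < c'" "c' \<le> c" "c' \<le> 1 / 3" using c by (auto simp: c'_def)
  show ?thesis
  proof (intro exI[of _ c'] conjI allI impI c'(1))
    fix p :: nat and A
    assume "progression_rich p c' A"
    then have p: "prime p" and A: "A \<subseteq> {0..<int p}" "0 < card A" "card A \<le> c' * p" "(card A)\<^sup>2 \<le> 2 * card (aps p A)"
      by auto
    have finA: "finite A" using A(1) finite_subset by blast
    have "1 \<le> c' * p" using A(2,3) by linarith
    also have "\<dots> \<le> 1 / 3 * p" by (rule mult_right_mono) (use c' in auto)
    finally have p2: "2 < p" by linarith
    then have podd: "odd p" using p prime_odd_nat by blast
    have "c' * p \<le> c * p" by (rule mult_right_mono) (use c' in auto)
    then have "card A \<le> c * p" using A(3) by linarith
    then obtain l a where l: "\<not> int p dvd l" and la: "(1 - 1 / 24) * card A \<le> card (arc p (1 / 48 * p) l a A)"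
      using arc p A by blast
    have two: "\<not> int p dvd 2 * l"
    proof -
      have "\<not> int p dvd 2" using p2 zdvd_imp_le[of "int p" 2] by linarith
      then show ?thesis using l p by (simp add: prime_dvd_mult_iff)
    qed
    define B where "B = arc p (1 / 48 * p) l a A"
    define B' where "B' = arc p (p / 8) (2 * l) a A"
    define R where "R = A - B'"
    have fin: "finite B" "finite B'" "finite R" using finA by (auto simp: B_def B'_def R_def)
    have nB: "near p (1 / 48 * p) (l * (x - a))" if "x \<in> B" for x using that by (simp add: B_def)
    have B'I: "x \<in> B'" if "x \<in> A" "near p (1 / 16 * p) (l * (x - a))" for x
    proof -
      have "near p (real 2 * (1 / 16 * p)) (int 2 * (l * (x - a)))" by (rule near_mult) fact
      then show ?thesis using that by (simp add: B'_def mult.assoc)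
    qed
    have BB': "B \<subseteq> B'"
    proof
      fix x assume x: "x \<in> B"
      then show "x \<in> B'" by (intro B'I near_mono[OF nB]) (auto simp: B_def)
    qed
    define e where "e = card (A - B)"
    have e: "real e \<le> card A / 24"
    proof -
      have "B \<subseteq> A" by (auto simp: B_def)
      then have "real e = real (card A) - card B"
        using card_Diff_subset[OF fin(1)] card_mono[OF finA] unfolding e_def by simp
      then show ?thesis using la by (simp add: B_def)
    qed
    have RB: "R \<subseteq> A - B" using BB' by (auto simp: R_def)
    have Re: "card R \<le> e" unfolding e_def by (rule card_mono[OF _ RB]) (use finA in simp)
    have "R = {}"
    proof (rule ccontr)
      assume "R \<noteq> {}"
      then have \<rho>: "1 \<le> card R" using fin(3) by (simp add: Suc_le_eq card_gt_0_iff)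
      note inj = inj_on_aps_coords[OF podd A(1)]
      define S where "S = (\<lambda>g h. {t \<in> aps p A. g t \<in> R \<and> h t \<in> A - B})"
      have S: "card (S g h) \<le> card R * e" if "inj_on (\<lambda>t. (g t, h t)) (aps p A)" for g h
        unfolding S_def e_def by (rule card_aps_pairs_le[OF that]) (use fin finA in auto)
      \<comment> \<open>A term in \<open>R\<close> comes with a second term outside
        \<open>B\<close>, since two terms in \<open>B\<close> would put the third into
        \<open>B'\<close>. The six sets run through the positions of these two terms.\<close>
      have cover: "aps p A \<subseteq> aps p B' \<union> (S fst3 snd3 \<union> S fst3 thd3 \<union> S snd3 thd3 \<union> S snd3 fst3 \<union> S thd3 fst3 \<union> S thd3 snd3)"
      proof
        fix t assume t: "t \<in> aps p A"
        obtain x y z where xyz: "t = (x, y, z)" by (cases t) auto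
        have d: "int p dvd x + z - 2 * y" and A3: "x \<in> A" "y \<in> A" "z \<in> A" using t xyz by (auto simp: aps_def)
        have d': "int p dvd z + x - 2 * y" using d by (simp add: add.commute)
        have 12: "z \<in> B'" if "x \<in> B" "y \<in> B"
          using near_third_term(1)[OF d nB nB, OF that] by (intro B'I A3) simp
        have 32: "x \<in> B'" if "z \<in> B" "y \<in> B"
          using near_third_term(1)[OF d' nB nB, OF that] by (intro B'I A3) simp
        have 13: "y \<in> B'" if "x \<in> B" "z \<in> B"
        proof -
          have "near p (p / 8) (2 * l * (y - a))"
            by (rule near_mono[OF near_third_term(2)[OF d nB nB, OF that]]) simp
          then show ?thesis using A3 by (simp add: B'_def)
        qed
        have "t \<in> aps p B'" if "x \<in> B'" "y \<in> B'" "z \<in> B'" using that d xyz by (simp add: aps_def)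
        then show "t \<in> aps p B' \<union> (S fst3 snd3 \<union> S fst3 thd3 \<union> S snd3 thd3 \<union> S snd3 fst3 \<union> S thd3 fst3 \<union> S thd3 snd3)"
          using t A3 12 32 13 unfolding xyz S_def coords R_def by simp blast
      qed
      have finaps: "finite (aps p A)" by (rule finite_aps[OF finA])
      have "card (aps p A) \<le> card (aps p B' \<union> (S fst3 snd3 \<union> S fst3 thd3 \<union> S snd3 thd3 \<union> S snd3 fst3 \<union> S thd3 fst3 \<union> S thd3 snd3))"
        using cover finite_aps[OF fin(2)] finaps by (intro card_mono) (auto simp: S_def)
      also have "\<dots> \<le> card (aps p B') + (card R * e + card R * e + card R * e + card R * e + card R * e + card R * e)"
        by (intro order_trans[OF card_Un_le] add_mono order_refl S inj)
      finally have 1: "card (aps p A) \<le> card (aps p B') + 6 * (card R * e)" by simp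
      have "2 * card (aps p B') \<le> (card B')\<^sup>2 + 1"
        by (rule card_aps_arc_le[OF p two]) (use A(1) in \<open>auto simp: B'_def\<close>)
      then have "(card A)\<^sup>2 \<le> (card B')\<^sup>2 + 1 + 12 * (card R * e)" using 1 A(4) by linarith
      from of_nat_mono[OF this, where 'a = real]
      have 2: "(real (card A))\<^sup>2 \<le> (real (card B'))\<^sup>2 + 1 + 12 * (real (card R) * e)"
        by (simp only: of_nat_mult of_nat_add of_nat_power of_nat_numeral of_nat_1 power2_eq_square)
      define n r where "n = real (card A)" and "r = real (card R)"
      have "card A = card B' + card R"
        unfolding R_def using card_Diff_subset[OF fin(2), of A] card_mono[OF finA, of B'] by (auto simp: B'_def)
      then have B'n: "real (card B') = n - r" by (simp add: n_def r_def)
      have r: "1 \<le> r" "r \<le> n / 24" using \<rho> Re e by (auto simp: r_def n_def)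
      have "12 * (r * e) \<le> 12 * (r * (n / 24))"
        using e r by (intro mult_left_mono) (auto simp: n_def)
      moreover have "n\<^sup>2 \<le> (n - r)\<^sup>2 + 1 + 12 * (r * e)" using 2 unfolding B'n unfolding n_def r_def .
      moreover have "12 * (r * (n / 24)) = r * n / 2" by simp
      ultimately have "n\<^sup>2 \<le> (n - r)\<^sup>2 + 1 + r * n / 2" by linarith
      then have "3 / 2 * (r * n) \<le> r * r + 1" by (simp add: power2_eq_square algebra_simps)
      moreover have "r * r \<le> r * n" using r by (intro mult_left_mono) auto
      moreover have "1 * 24 \<le> r * n" using r by (intro mult_mono) auto
      ultimately show False by linarith
    qed
    then have "\<forall>x\<in>A. near p (p / 8) (2 * l * (x - a))" by (auto simp: R_def B'_def)
    then show "\<exists>l a. \<not> int p dvd l \<and> (\<forall>x\<in>A. near p (p / 8) (l * (x - a)))" using two by blast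
  qed
qed

section \<open>The extremal problem modulo a prime\<close>

lemma T3_residue_ring:
  assumes N: "N > 0" and A: "A \<subseteq> carrier (residue_ring (int N))"
  shows "T3 (residue_ring (int N)) A = card (aps N A)"
proof -
  let ?m = "int N"
  have AN: "x \<in> A \<Longrightarrow> 0 \<le> x \<and> x < ?m" for x using A by (auto simp: residue_ring_def)
  let ?D = "{(x, d). 0 \<le> x \<and> x \<le> ?m - 1 \<and> 0 \<le> d \<and> d \<le> ?m - 1 \<and> x \<in> A \<and> (x + d) mod ?m \<in> A \<and> (x + (d + d) mod ?m) mod ?m \<in> A}"
  let ?f = "\<lambda>(x, d). (x, (x + d) mod ?m, (x + (d + d) mod ?m) mod ?m)"
  have inj: "inj_on ?f ?D"
  proof (rule inj_onI)
    fix u v assume uv: "u \<in> ?D" "v \<in> ?D" "?f u = ?f v"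
    obtain x d x' d' where e: "u = (x, d)" "v = (x', d')" by (cases u, cases v)
    have x: "x = x'" and d: "d \<in> {0..<?m}" "d' \<in> {0..<?m}" "(x + d) mod ?m = (x + d') mod ?m"
      using uv unfolding e by auto
    have "?m dvd d - d'" using d(3) by (simp add: mod_eq_dvd_iff)
    then show "u = v" using residue_eqI[OF d(1,2)] x unfolding e by simp
  qed
  have "?f ` ?D = aps N A"
  proof (intro equalityI subsetI)
    fix t assume "t \<in> ?f ` ?D"
    then obtain x d where t: "t = ?f (x, d)" "(x, d) \<in> ?D" by blast
    define y z where "y = (x + d) mod ?m" and "z = (x + (d + d) mod ?m) mod ?m"
    have "?m dvd 2 * ((x + d) - y) - ((d + d) - (d + d) mod ?m) - ((x + (d + d) mod ?m) - z)"
      unfolding y_def z_def by (intro dvd_diff dvd_mult dvd_minus_mod)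
    then have "?m dvd x + z - 2 * y" by (simp add: algebra_simps)
    then show "t \<in> aps N A" using t by (simp add: aps_def y_def z_def)
  next
    fix t assume "t \<in> aps N A"
    then obtain x y z where t: "t = (x, y, z)" "x \<in> A" "y \<in> A" "z \<in> A" "?m dvd x + z - 2 * y" by (auto simp: aps_def)
    define d where "d = (y - x) mod ?m"
    have d: "0 \<le> d" "d \<le> ?m - 1" using N by (auto simp: d_def)
    have y: "(x + d) mod ?m = y" using AN[OF t(3)] by (simp add: d_def mod_simps)
    have "(x + (d + d) mod ?m) mod ?m = (x + ((y - x) + (y - x))) mod ?m" unfolding d_def by (simp only: mod_simps)
    also have "\<dots> = z mod ?m"
    proof -
      have "x + ((y - x) + (y - x)) - z = - (x + z - 2 * y)" by simp
      then have "?m dvd x + ((y - x) + (y - x)) - z" using t(5) by (simp only: dvd_minus_iff)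
      then show ?thesis by (simp only: mod_eq_dvd_iff)
    qed
    finally have z: "(x + (d + d) mod ?m) mod ?m = z" using AN[OF t(4)] by simp
    have "(x, d) \<in> ?D" using d y z t AN[OF t(2)] by simp
    moreover have "t = ?f (x, d)" using y z t(1) by simp
    ultimately show "t \<in> ?f ` ?D" by (rule rev_image_eqI)
  qed
  then have "card (aps N A) = card ?D" using card_image[OF inj] by simp
  moreover have "T3 (residue_ring ?m) A = card ?D" unfolding T3_def residue_ring_def
    by (rule arg_cong[where f = card]) auto
  ultimately show ?thesis by simp
qed

lemma T3_int_ring: "T3 int_ring A = card (aps 0 A)"
proof -
  let ?D = "{(x, d). x \<in> A \<and> x + d \<in> A \<and> x + (d + d) \<in> A}"
  have "T3 int_ring A = card ?D" by (simp add: T3_def)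
  also have "\<dots> = card (aps 0 A)"
  proof (rule bij_betw_same_card)
    have aps: "aps 0 A = {(x, y, z). x \<in> A \<and> y \<in> A \<and> z \<in> A \<and> z = 2 * y - x}" by (auto simp: aps_0)
    show "bij_betw (\<lambda>(x, d). (x, x + d, x + (d + d))) ?D (aps 0 A)"
      unfolding aps by (rule bij_betw_byWitness[where f' = "\<lambda>(x, y, z). (x, y - x)"]) auto
  qed
  finally show ?thesis .
qed

lemma card_aps_interval: "card (aps 0 {0..<int n}) = (n\<^sup>2 + 1) div 2"
proof -
  have "reflecting {0..<int n} y" if "y \<in> {0..<int n}" for y
    unfolding reflecting_def using that by (cases "2 * y < int n") auto
  then show ?thesis using card_aps_int(2)[of "{0..<int n}"] by simp
qed

lemma M3_eqI:
  assumes "\<And>A. A \<subseteq> carrier G \<Longrightarrow> finite A \<Longrightarrow> card A = n \<Longrightarrow> T3 G A \<le> K"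
    and "B \<subseteq> carrier G" "finite B" "card B = n" "T3 G B = K"
  shows "M3 G n = K"
  unfolding M3_def
proof (rule Max_eqI)
  show "finite {T3 G A |A. A \<subseteq> carrier G \<and> finite A \<and> card A = n}"
    by (rule finite_subset[of _ "{..K}"]) (use assms(1) in auto)
qed (use assms in auto)

lemma M3_int_ring: "M3 int_ring n = (n\<^sup>2 + 1) div 2"
proof (rule M3_eqI)
  show "T3 int_ring A \<le> (n\<^sup>2 + 1) div 2" if "finite A" "card A = n" for A
    using card_aps_int(1)[OF that(1)] that(2) by (simp add: T3_int_ring)
  show "T3 int_ring {0..<int n} = (n\<^sup>2 + 1) div 2" by (simp add: T3_int_ring card_aps_interval)
qed auto

lemma ceiling_half_square: "\<lceil>(real n)\<^sup>2 / 2\<rceil> = int ((n\<^sup>2 + 1) div 2)"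
proof (rule ceiling_unique)
  define q where "q = (n\<^sup>2 + 1) div 2"
  have "2 * q \<le> n\<^sup>2 + 1" "n\<^sup>2 \<le> 2 * q" unfolding q_def by linarith+
  then have "real (2 * q) \<le> real (n\<^sup>2 + 1)" "real (n\<^sup>2) \<le> real (2 * q)" by (simp_all only: of_nat_le_iff)
  then show "of_int (int q) - 1 < (real n)\<^sup>2 / 2" "(real n)\<^sup>2 / 2 \<le> of_int (int q)" by simp_all
qed

section \<open>Affine images modulo a prime\<close>

abbreviation affine_mod :: "nat \<Rightarrow> int set \<Rightarrow> int set \<Rightarrow> bool" where
  "affine_mod p A S \<equiv> \<exists>a b. \<not> int p dvd a \<and> A = (\<lambda>s. (a * s + b) mod int p) ` S"

lemma affine_image_residue_ring:
  assumes p: "prime p"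
  shows "affine_image (residue_ring (int p)) A (reduce_mod p S) \<longleftrightarrow>
    affine_mod p A S"
proof -
  interpret R: residues_prime p "residue_ring (int p)" by unfold_locales (use p in auto)
  have p1: "int p > 1" using prime_gt_1_nat[OF p] by simp
  have U: "Units (residue_ring (int p)) = {1..int p - 1}"
    unfolding R.res_prime_units_eq using p1 by (simp add: of_nat_diff)
  have C: "carrier (residue_ring (int p)) = {0..int p - 1}" by (simp add: residue_ring_def)
  have im: "(\<lambda>x. a \<otimes>\<^bsub>residue_ring (int p)\<^esub> x \<oplus>\<^bsub>residue_ring (int p)\<^esub> b) ` reduce_mod p S = (\<lambda>s. (a * s + b) mod int p) ` S" for a b
    unfolding reduce_mod_def image_image
  proof (rule image_cong[OF refl])
    fix s
    show "a \<otimes>\<^bsub>residue_ring (int p)\<^esub> (s mod int p) \<oplus>\<^bsub>residue_ring (int p)\<^esub> b = (a * s + b) mod int p"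
      by (simp add: residue_ring_def mod_add_left_eq mod_mult_right_eq)
  qed
  show ?thesis
  proof
    assume "affine_image (residue_ring (int p)) A (reduce_mod p S)"
    then obtain a b where a: "a \<in> {1..int p - 1}" and A: "A = (\<lambda>s. (a * s + b) mod int p) ` S"
      unfolding affine_image_def U im by blast
    have "\<not> int p dvd a" using a zdvd_imp_le[of "int p" a] by auto
    then show "affine_mod p A S" using A by blast
  next
    assume "affine_mod p A S"
    then obtain a b where a: "\<not> int p dvd a" and A: "A = (\<lambda>s. (a * s + b) mod int p) ` S" by blast
    have "a mod int p \<noteq> 0" "0 \<le> a mod int p" "a mod int p < int p" "0 \<le> b mod int p" "b mod int p < int p"
      using a p1 by (simp_all add: dvd_eq_mod_eq_0)
    then have "a mod int p \<in> {1..int p - 1}" "b mod int p \<in> {0..int p - 1}" by auto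
    moreover have "A = (\<lambda>s. ((a mod int p) * s + b mod int p) mod int p) ` S" 
      unfolding A by (rule image_cong[OF refl]) (metis mod_add_left_eq mod_add_right_eq mod_mult_left_eq)
    ultimately show "affine_image (residue_ring (int p)) A (reduce_mod p S)"
      unfolding affine_image_def U C im by blast
  qed
qed

text \<open>The hypothesis on the size of the image rules out wrap-around: the image contains the images of
  \<open>0, \<dots>, k\<close> and of \<open>k + 2, \<dots>, k + 2 m\<close>, which are distinct, so \<open>S\<close> is short compared to \<open>p\<close>.\<close>

lemma card_aps_affine_image:
  fixes S :: "int set"
  assumes p: "prime p" "2 < p" and a: "\<not> int p dvd a" and n: "card ((\<lambda>s. (a * s + b) mod int p) ` S) = n" "13 * n \<le> p" "0 < n"
    and S: "finite S" "{0..int k} \<subseteq> S" "\<And>j. 1 \<le> j \<Longrightarrow> j \<le> m \<Longrightarrow> int k + 2 * int j \<in> S"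
      "\<And>s. s \<in> S \<Longrightarrow> \<bar>s\<bar> \<le> int k + 2 * int m" "\<And>s. s \<in> S \<Longrightarrow> reflecting S s"
  shows "card (aps p ((\<lambda>s. (a * s + b) mod int p) ` S)) = (n\<^sup>2 + 1) div 2"
proof -
  define g where "g = (\<lambda>s. (a * s + b) mod int p)"
  have cong: "int p dvd a * s + b - g s" for s by (simp add: g_def minus_mod_eq_mult_div)
  have prime: "int p dvd t" if "int p dvd a * t" for t using that p a by (simp add: prime_dvd_mult_iff)
  have g_eq: "int p dvd s - t" if "g s = g t" for s t
  proof -
    have "int p dvd (a * s + b) - (a * t + b)" using that by (simp add: g_def mod_eq_dvd_iff)
    also have "(a * s + b) - (a * t + b) = a * (s - t)" by (simp add: algebra_simps)
    finally show ?thesis by (rule prime)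
  qed
  have podd: "odd p" using p prime_odd_nat by blast
  have np: "n < p" using n by linarith
  have fin: "finite (g ` S)" using S by simp
  have n': "card (g ` S) = n" using n by (simp add: g_def)
  have kn: "k < n"
  proof -
    \<comment> \<open>Truncation keeps the images distinct before anything is known about
      \<open>k\<close>; as \<open>n < p\<close>, the minimum can only be \<open>k\<close>.\<close>
    have "card {0..int (min k (p - 1))} \<le> card (g ` S)"
    proof (rule card_inj_on_le[OF _ _ fin])
      show "inj_on g {0..int (min k (p - 1))}"
      proof (rule inj_onI)
        fix s t assume "s \<in> {0..int (min k (p - 1))}" "t \<in> {0..int (min k (p - 1))}" "g s = g t"
        moreover from this have "int p dvd s - t" by (intro g_eq)
        ultimately show "s = t" using p by (intro residue_eqI[of s p t]) auto
      qed
      show "g ` {0..int (min k (p - 1))} \<subseteq> g ` S"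
        by (intro image_mono subset_trans[OF _ S(2)]) simp
    qed
    moreover have card: "card {0..int q} = Suc q" for q
      by (simp only: card_atLeastAtMost_int)
    ultimately have "min k (p - 1) < n" unfolding n' card by linarith
    then show ?thesis using np by linarith
  qed
  have mn: "m \<le> n"
  proof -
    have "card {1..min m p} \<le> card (g ` S)"
    proof (rule card_inj_on_le[of "\<lambda>j. g (int k + 2 * int j)"])
      show "inj_on (\<lambda>j. g (int k + 2 * int j)) {1..min m p}"
      proof (rule inj_onI)
        fix i j assume ij: "i \<in> {1..min m p}" "j \<in> {1..min m p}" "g (int k + 2 * int i) = g (int k + 2 * int j)"
        have "int p dvd 2 * (int i - int j)" using g_eq[OF ij(3)] by (simp add: algebra_simps)
        then have d: "int p dvd int i - int j" by (rule odd_dvd_double[OF podd])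
        have "int p dvd (int i - 1) - (int j - 1)" using d by simp
        then have "int i - 1 = int j - 1" using ij by (intro residue_eqI[of _ p]) auto
        then show "i = j" by simp
      qed
      show "(\<lambda>j. g (int k + 2 * int j)) ` {1..min m p} \<subseteq> g ` S" using S(3) by auto
    qed (rule fin)
    then have "min m p \<le> n" by (simp add: n')
    then show ?thesis using np by linarith
  qed
  \<comment> \<open>The source of the constant 13: \<open>x + z - 2 * y\<close> is at most
    \<open>12 * n\<close> in absolute value, hence below \<open>p\<close>.\<close>
  have W: "\<bar>s\<bar> \<le> 3 * int n" if "s \<in> S" for s using S(4)[OF that] kn mn by linarith
  have inj: "inj_on g S"
  proof (rule inj_onI)
    fix s t assume st: "s \<in> S" "t \<in> S" "g s = g t"
    have "\<bar>s - t\<bar> < int p" using W[OF st(1)] W[OF st(2)] n by linarith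
    then show "s = t" using g_eq[OF st(3)] zdvd_imp_le[of "int p" "\<bar>s - t\<bar>"] by (cases "s = t") auto
  qed
  have "card (aps p (g ` S)) = card (aps 0 S)"
  proof (rule card_aps_transfer[OF inj])
    fix x y z assume xyz: "x \<in> S" "y \<in> S" "z \<in> S"
    have "\<bar>x + z - 2 * y\<bar> < int p" using W[OF xyz(1)] W[OF xyz(2)] W[OF xyz(3)] n by linarith
    then have "x + z - 2 * y = 0 \<longleftrightarrow> int p dvd x + z - 2 * y"
      using zdvd_imp_le[of "int p" "\<bar>x + z - 2 * y\<bar>"] by (cases "x + z - 2 * y = 0") auto
    also have "\<dots> \<longleftrightarrow> int p dvd a * (x + z - 2 * y)" using prime by (metis dvd_mult)
    also have "\<dots> \<longleftrightarrow> int p dvd g x + g z - 2 * g y"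
    proof -
      have "int p dvd (a * x + b - g x) + (a * z + b - g z) - ((a * y + b - g y) + (a * y + b - g y))"
        by (intro dvd_diff dvd_add cong)
      then have "int p dvd a * (x + z - 2 * y) - (g x + g z - 2 * g y)" by (simp add: algebra_simps)
      then show ?thesis by (metis dvd_diffD dvd_diff_right_iff dvd_diff_commute)
    qed
    finally show "int p dvd g x + g z - 2 * g y \<longleftrightarrow> int 0 dvd x + z - 2 * y" by simp
  qed
  also have "\<dots> = (n\<^sup>2 + 1) div 2" using card_aps_int(2)[OF S(1)] S(5) n' by (simp add: card_image[OF inj])
  finally show ?thesis by (simp add: g_def)
qed

text \<open>Two is invertible modulo \<open>p\<close>, so the half-integral dilations of
  \<open>affine_copy\<close> become genuine ones: \<open>m\<close> inverts \<open>2 * l\<close>, and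
  \<open>m * d\<close> is the dilation sought. That \<open>p\<close> does not divide
  \<open>d\<close> follows from two distinct elements, since \<open>2 * g x1\<close> and
  \<open>2 * g x2\<close> differ by a nonzero multiple of \<open>d\<close> of absolute value below
  \<open>p\<close>.\<close>

lemma affine_image_if_affine_copy:
  assumes p: "prime p" "2 < p" and A: "A \<subseteq> {0..<int p}" and x12: "x1 \<in> A" "x2 \<in> A" "x1 \<noteq> x2" and l: "\<not> int p dvd l"
    and g: "inj_on g A" "\<And>x. x \<in> A \<Longrightarrow> int p dvd g x - l * (x - a)" "\<And>x. x \<in> A \<Longrightarrow> 8 * \<bar>g x\<bar> \<le> int p"
    and copy: "affine_copy (g ` A) S"
  shows "affine_mod p A S"
proof -
  obtain d t where dt: "(\<lambda>x. 2 * x) ` g ` A = (\<lambda>s. d * s + t) ` S" using copy unfolding affine_copy_def by blast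
  have ex: "\<exists>s\<in>S. 2 * g x = d * s + t" if "x \<in> A" for x
  proof -
    have "2 * g x \<in> (\<lambda>x. 2 * x) ` g ` A" using that by blast
    then show ?thesis unfolding dt by blast
  qed
  have ex': "\<exists>x\<in>A. 2 * g x = d * s + t" if "s \<in> S" for s
  proof -
    have "d * s + t \<in> (\<lambda>s. d * s + t) ` S" using that by blast
    then show ?thesis unfolding dt[symmetric] by auto
  qed
  have d: "\<not> int p dvd d"
  proof
    assume d: "int p dvd d"
    obtain s1 s2 where s: "2 * g x1 = d * s1 + t" "2 * g x2 = d * s2 + t" using ex x12 by meson
    then have "2 * (g x1 - g x2) = d * (s1 - s2)" by (simp add: algebra_simps)
    then have "int p dvd 2 * (g x1 - g x2)" using d by simp
    moreover have "\<bar>2 * (g x1 - g x2)\<bar> < int p"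
    proof -
      have eq: "\<bar>2 * (g x1 - g x2)\<bar> = 2 * \<bar>g x1 - g x2\<bar>"
        by (simp only: abs_mult abs_numeral)
      have "0 < int p" using p(2) by simp
      have lt: "2 * c < P" if "8 * a \<le> P" "8 * b \<le> P" "c \<le> a + b" "0 < P" for a b c P :: int
        using that by linarith
      show ?thesis
        unfolding eq using g(3)[OF x12(1)] g(3)[OF x12(2)] abs_triangle_ineq4 \<open>0 < int p\<close> by (rule lt)
    qed
    ultimately have "g x1 = g x2" using zdvd_imp_le[of "int p" "\<bar>2 * (g x1 - g x2)\<bar>"] by (cases "g x1 = g x2") auto
    then show False using g(1) x12 by (auto simp: inj_on_def)
  qed
  have "\<not> int p dvd 2" using p(2) zdvd_imp_le[of "int p" 2] by linarith
  then have "\<not> int p dvd 2 * l" using l p by (simp add: prime_dvd_mult_iff)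
  then have "coprime (2 * l) (int p)" using p prime_imp_coprime[of "int p" "2 * l"] by (simp add: coprime_commute)
  then obtain m where "[(2 * l) * m = 1] (mod int p)" using cong_solve_coprime_int by blast
  then have m: "int p dvd 2 * l * m - 1" by (simp add: cong_iff_dvd_diff)
  have md: "\<not> int p dvd m * d"
  proof
    assume "int p dvd m * d"
    then have "int p dvd m" using d p by (simp add: prime_dvd_mult_iff)
    then have "int p dvd 2 * l * m" by simp
    then have "int p dvd 2 * l * m - (2 * l * m - 1)" using m by (rule dvd_diff)
    then show False using p by simp
  qed
  have val: "x = (m * d * s + (m * t + a)) mod int p" if "x \<in> A" "2 * g x = d * s + t" for x s
  proof -
    have "int p dvd (2 * m) * (g x - l * (x - a)) + (2 * l * m - 1) * (x - a)"
      by (intro dvd_add dvd_mult g that dvd_mult2 m)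
    also have "(2 * m) * (g x - l * (x - a)) + (2 * l * m - 1) * (x - a) = m * (2 * g x) - (x - a)"
      by (simp add: algebra_simps)
    also have "\<dots> = (m * d * s + (m * t + a)) - x" unfolding that(2) by (simp add: algebra_simps)
    finally have "(m * d * s + (m * t + a)) mod int p = x mod int p" by (simp add: mod_eq_dvd_iff)
    then show ?thesis using A that(1) by auto
  qed
  have "A = (\<lambda>s. (m * d * s + (m * t + a)) mod int p) ` S"
  proof (intro equalityI subsetI)
    fix x assume x: "x \<in> A"
    then obtain s where "s \<in> S" "2 * g x = d * s + t" using ex by blast
    then show "x \<in> (\<lambda>s. (m * d * s + (m * t + a)) mod int p) ` S" using val[OF x] by blast
  next
    fix y assume "y \<in> (\<lambda>s. (m * d * s + (m * t + a)) mod int p) ` S"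
    then obtain s where s: "s \<in> S" "y = (m * d * s + (m * t + a)) mod int p" by blast
    then obtain x where x: "x \<in> A" "2 * g x = d * s + t" using ex' by blast
    then show "y \<in> A" using val[OF x] s(2) by simp
  qed
  then show ?thesis using md by blast
qed

lemma prime_residues_extremal:
  shows "\<exists>c::real. c > 0 \<and> (\<forall>(p::nat) A. prime p \<and> A \<subseteq> {0..<int p} \<and> 0 < card A \<and> card A \<le> c * p \<longrightarrow>
    2 < p \<and> 13 * card A \<le> p \<and> card (aps p A) \<le> ((card A)\<^sup>2 + 1) div 2 \<and>
    (card (aps p A) = ((card A)\<^sup>2 + 1) div 2 \<longrightarrow>
      (\<exists>k m. affine_mod p A (E_set k m) \<or> affine_mod p A (F_set k m))))"
proof -
  obtain c :: real where c: "0 < c" and arc: "\<forall>(p::nat) A. progression_rich p c A \<longrightarrow>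
    (\<exists>l a. \<not> int p dvd l \<and> (\<forall>x\<in>A. near p (p / 8) (l * (x - a))))"
    using all_in_arc by blast
  define c' where "c' = min c (1 / 13)"
  have c': "0 < c'" "c' \<le> c" "c' \<le> 1 / 13" using c by (auto simp: c'_def)
  show ?thesis
  proof (intro exI[of _ c'] conjI c'(1) allI impI; elim conjE)
    fix p :: nat and A assume p: "prime p" and A: "A \<subseteq> {0..<int p}" "0 < card A" "card A \<le> c' * p"
    have finA: "finite A" using A(1) finite_subset by blast
    have "c' * p \<le> 1 / 13 * p" by (rule mult_right_mono) (use c' in auto)
    then have "real (13 * card A) \<le> real p" using A(3) by simp
    then show p13: "13 * card A \<le> p" by (simp only: of_nat_le_iff)
    then show p2: "2 < p" using A(2) by linarith
    have "c' * p \<le> c * p" by (rule mult_right_mono) (use c' in auto)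
    then have Ac: "card A \<le> c * p" using A(3) by linarith
    show "card (aps p A) \<le> ((card A)\<^sup>2 + 1) div 2"
    proof (cases "(card A)\<^sup>2 \<le> 2 * card (aps p A)")
      case True
      then obtain l a where l: "\<not> int p dvd l" "\<forall>x\<in>A. near p (p / 8) (l * (x - a))" using arc p A Ac by blast
      have "2 * card (aps p A) \<le> (card A)\<^sup>2 + 1" by (rule card_aps_arc_le[OF p l(1) A(1)]) (use l in blast)
      then show ?thesis by linarith
    next
      case False
      then show ?thesis by linarith
    qed
    assume eq: "card (aps p A) = ((card A)\<^sup>2 + 1) div 2"
    show "\<exists>k m. affine_mod p A (E_set k m) \<or> affine_mod p A (F_set k m)"
    \<comment> \<open>The dilation is seen to be invertible only with the help of two distinct
      elements, so singletons are treated apart.\<close>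
    proof (cases "card A = 1")
      case True
      then obtain x where x: "A = {x}" by (auto simp: card_1_singleton_iff)
      have "E_set 0 0 = {0}" by (auto simp: E_set_def)
      then have "A = (\<lambda>s. (1 * s + x) mod int p) ` E_set 0 0" using A(1) x by simp
      moreover have "\<not> int p dvd 1" using p2 by simp
      ultimately show ?thesis by blast
    next
      case False
      then have "\<exists>x1\<in>A. \<exists>x2\<in>A. x1 \<noteq> x2" using A(2) finA by (metis One_nat_def card_1_singleton_iff card_gt_0_iff ex_in_conv singletonI subset_singletonD subsetI insert_iff)
      then obtain x1 x2 where x12: "x1 \<in> A" "x2 \<in> A" "x1 \<noteq> x2" by blast
      have "(card A)\<^sup>2 \<le> 2 * card (aps p A)" unfolding eq by linarith
      then obtain l a where l: "\<not> int p dvd l" "\<forall>x\<in>A. near p (p / 8) (l * (x - a))" using arc p A Ac by blast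
      have near: "near p (p / 8) (l * (x - a))" if "x \<in> A" for x using l(2) that by blast
      show ?thesis
      proof (rule rectify[OF p l(1) A(1) near])
        fix g assume g: "inj_on g A" "\<And>x. x \<in> A \<Longrightarrow> int p dvd g x - l * (x - a)" "\<And>x. x \<in> A \<Longrightarrow> 8 * \<bar>g x\<bar> \<le> int p"
          "card (aps 0 (g ` A)) = card (aps p A)"
        have "card (g ` A) = card A" by (rule card_image[OF g(1)])
        then have "\<forall>y\<in>g ` A. reflecting (g ` A) y" using card_aps_int(2)[of "g ` A"] finA eq g(4) by simp
        then have "\<exists>k m. affine_copy (g ` A) (E_set k m) \<or> affine_copy (g ` A) (F_set k m)"
          by (intro reflecting_imp_affine_copy) (use finA x12 in auto)
        then show ?thesis using affine_image_if_affine_copy[OF p p2 A(1) x12 l(1) g(1-3)] by meson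
      qed
    qed
  qed
qed

theorem theorem1p5:
  shows "\<exists>c::real. c > 0 \<and>
    (\<forall>n N :: nat. n > 0 \<and> prime N \<and> real n \<le> c * real N \<longrightarrow>
      M3 (residue_ring (int N)) n = M3 int_ring n \<and>
      int (M3 int_ring n) = \<lceil>(real n)\<^sup>2 / 2\<rceil> \<and>
      (\<forall>A. A \<subseteq> carrier (residue_ring (int N)) \<and> card A = n \<longrightarrow>
        (T3 (residue_ring (int N)) A = M3 (residue_ring (int N)) n \<longleftrightarrow>
          (\<exists>k m :: nat.
            affine_image (residue_ring (int N)) A (reduce_mod N (E_set k m)) \<or>
            affine_image (residue_ring (int N)) A (reduce_mod N (F_set k m))))))"
proof -
  obtain c :: real where c: "c > 0" and main: "\<forall>(p::nat) A. prime p \<and> A \<subseteq> {0..<int p} \<and> 0 < card A \<and> card A \<le> c * p \<longrightarrow>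
    2 < p \<and> 13 * card A \<le> p \<and> card (aps p A) \<le> ((card A)\<^sup>2 + 1) div 2 \<and>
    (card (aps p A) = ((card A)\<^sup>2 + 1) div 2 \<longrightarrow>
      (\<exists>k m. affine_mod p A (E_set k m) \<or> affine_mod p A (F_set k m)))"
    using prime_residues_extremal by blast
  \<comment> \<open>The bound \<open>13 * n \<le> N\<close> is needed before any set is given, to
    make sure that the interval \<open>{0..<int n}\<close> fits into the carrier without
    wrap-around.\<close>
  define c' where "c' = min c (1 / 13)"
  have c': "0 < c'" "c' \<le> c" "c' \<le> 1 / 13" using c by (auto simp: c'_def)
  show ?thesis
  proof (intro exI[of _ c'] conjI c'(1) allI impI; elim conjE)
    fix n N :: nat assume n: "0 < n" and N: "prime N" and "real n \<le> c' * real N"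
    moreover have "c' * N \<le> c * N" "c' * N \<le> 1 / 13 * N" by (rule mult_right_mono; use c' in simp)+
    ultimately have nN: "real n \<le> c * N" "13 * n \<le> N" by linarith+
    have N0: "N > 0" using n nN by simp
    have carr: "carrier (residue_ring (int N)) = {0..<int N}" by (auto simp: residue_ring_def)
    note T = T3_residue_ring[OF N0, unfolded carr]
    have "card (aps N {0..<int n}) = card (aps 0 {0..<int n})"
    proof -
      have "card (aps N (id ` {0..<int n})) = card (aps 0 {0..<int n})"
      proof (rule card_aps_transfer)
        fix x y z assume "x \<in> {0..<int n}" "y \<in> {0..<int n}" "z \<in> {0..<int n}"
        then have "\<bar>x + z - 2 * y\<bar> < int N" using nN(2) by auto
        then show "int N dvd id x + id z - 2 * id y \<longleftrightarrow> int 0 dvd x + z - 2 * y"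
          using zdvd_imp_le[of "int N" "\<bar>x + z - 2 * y\<bar>"] by (cases "x + z - 2 * y = 0") auto
      qed simp
      then show ?thesis by simp
    qed
    then have "T3 (residue_ring (int N)) {0..<int n} = (n\<^sup>2 + 1) div 2"
      using nN(2) by (simp add: T card_aps_interval)
    then have M3: "M3 (residue_ring (int N)) n = (n\<^sup>2 + 1) div 2"
    proof (rule M3_eqI[rotated 4])
      fix A assume "A \<subseteq> carrier (residue_ring (int N))" "card A = n"
      then show "T3 (residue_ring (int N)) A \<le> (n\<^sup>2 + 1) div 2" using main N n nN(1) T unfolding carr by metis
    qed (use nN in \<open>auto simp: carr\<close>)
    show "M3 (residue_ring (int N)) n = M3 int_ring n" by (simp add: M3 M3_int_ring)
    show "int (M3 int_ring n) = \<lceil>(real n)\<^sup>2 / 2\<rceil>" by (simp add: M3_int_ring ceiling_half_square)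
    fix A assume A: "A \<subseteq> carrier (residue_ring (int N))" "card A = n"
    note A' = A(1)[unfolded carr]
    have N2: "2 < N" using n nN(2) by linarith
    show "T3 (residue_ring (int N)) A = M3 (residue_ring (int N)) n \<longleftrightarrow>
          (\<exists>k m :: nat.
            affine_image (residue_ring (int N)) A (reduce_mod N (E_set k m)) \<or>
            affine_image (residue_ring (int N)) A (reduce_mod N (F_set k m)))"
      unfolding M3 T[OF A'] affine_image_residue_ring[OF N]
    proof
      assume "card (aps N A) = (n\<^sup>2 + 1) div 2"
      then show "\<exists>k m. affine_mod N A (E_set k m) \<or> affine_mod N A (F_set k m)"
        using main N A' A(2) n nN(1) by blast
    next
      assume "\<exists>k m. affine_mod N A (E_set k m) \<or> affine_mod N A (F_set k m)"
      then obtain k m a b where a: "\<not> int N dvd a"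
        and A_eq: "A = (\<lambda>s. (a * s + b) mod int N) ` E_set k m \<or> A = (\<lambda>s. (a * s + b) mod int N) ` F_set k m" by blast
      \<comment> \<open>Nothing bounds \<open>k\<close> and \<open>m\<close> here except the size
        \<open>n\<close> of the image, from which \<open>card_aps_affine_image\<close> deduces that
        reduction is injective.\<close>
      from A_eq show "card (aps N A) = (n\<^sup>2 + 1) div 2"
      proof
        assume AE: "A = (\<lambda>s. (a * s + b) mod int N) ` E_set k m"
        show ?thesis unfolding AE
        proof (rule card_aps_affine_image[OF N N2 a _ nN(2) n])
          show "card ((\<lambda>s. (a * s + b) mod int N) ` E_set k m) = n" using A(2) AE by simp
          show "finite (E_set k m)" by (rule finite_subset[of _ "{- (int k + 2 * int m)..int k + 2 * int m}"]) (auto simp: E_set_def)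
          show "int k + 2 * int j \<in> E_set k m" if "1 \<le> j" "j \<le> m" for j
            using that unfolding E_set_def by blast
          show "reflecting (E_set k m) s" if "s \<in> E_set k m" for s
            using that by (rule reflecting_E_set)
        qed (auto simp: E_set_def)
      next
        assume AF: "A = (\<lambda>s. (a * s + b) mod int N) ` F_set k m"
        show ?thesis unfolding AF
        proof (rule card_aps_affine_image[OF N N2 a _ nN(2) n])
          show "card ((\<lambda>s. (a * s + b) mod int N) ` F_set k m) = n" using A(2) AF by simp
          show "finite (F_set k m)" by (rule finite_subset[of _ "{- (int k + 2 * int m)..int k + 2 * int m}"]) (auto simp: F_set_def)
          show "int k + 2 * int j \<in> F_set k m" if "1 \<le> j" "j \<le> m" for j
            using that unfolding F_set_def by blast
          show "reflecting (F_set k m) s" if "s \<in> F_set k m" for s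
            using that by (rule reflecting_F_set)
        qed (auto simp: F_set_def)
      qed
    qed
  qed
qed

end
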